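(* Let $p\in(0,1)$ and assume that (i) $(X_t)_{t\ge 0}$ is an adapted non-negative right-continuous process; (ii) $(A_t)_{t\ge 0}$ is a deterministic non-decreasing càdlàg function with $A_0=0$; (iii) $(H_t)_{t\ge 0}$ is a predictable non-negative non-decreasing càdlàg process; (iv) $(M_t)_{t\ge 0}$ is a càdlàg local martingale with $M_0=0$; (v) $\eta:[0,\infty)\to[0,\infty)$ is a continuous non-decreasing function with $\eta(x)>0$ for all $x>0$ such that the function $\eta_p:(0,\infty)\to[0,\infty)$, $\eta_p(x)=\frac{p}{1-p}\,\eta(x^{1/p})\,x^{1-1/p}$, is concave and non-decreasing. Moreover, assume that for all $t\ge 0$ $$X_t\le \int_{(0,t]}\eta(X^*_{s^-})\,\mathrm{d}A_s+M_t+H_t\qquad \mathbb{P}\text{-a.s.}$$ Then for all $T>0$ such that $\mathbb{E}[H_T^p]<\infty$, $$\mathbb{E}\Big[\sup_{t\in[0,T]}X_t^p\Big]^{1/p}\le G^{-1}\Big(G\big(\alpha_1\alpha_2\,\mathbb{E}[H_T^p]^{1/p}\big)+\beta A_T\Big),$$ where $G(v)=\int_1^v\frac{\mathrm{d}u}{\eta(u)}$, $\beta=(1-p)^{-1}$ and $\alpha_1\alpha_2=(1-p)^{-1/p}p^{-1}$. The constants $\beta$ and $\alpha_1\alpha_2$ are sharp.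
   Context: All processes are defined on a filtered probability space $(\Omega,\mathcal{F},\mathbb{P},(\mathcal{F}_t)_{t\ge0})$ satisfying the usual conditions. Running supremum: $X^*_t=\sup_{0\le s\le t}X_s$ for $t\geq 0$, $X^*_{t^-}=\lim_{s\nearrow t}X^*_s=\sup_{s<t}X_s$ for $t>0$, and $X^*_{0^-}=X_0$; these take values in $[0,+\infty]$. The function $G$ is increasing with $G(0)\in[-\infty,0)$; $G^{-1}:\mathrm{range}(G)\cap(-\infty,\infty)\to[0,\infty)$ denotes its inverse. If $G(0)=-\infty$, one sets $G^{-1}(G(0)+a)=0$ for $a\in(-\infty,\infty)$. A constant in the estimate is called sharp if, keeping the other constant unchanged, it cannot be replaced by a strictly smaller constant depending only on $p$ such that the estimate remains true for all filtered probability spaces, processes and functions $\eta$ satisfying the hypotheses. *)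

theory Defs
  imports "HOL-Probability.Probability"
begin

text \<open>
  Time is the half-line \<open>[0, \<infinity>)\<close>, embedded in \<^typ>\<open>real\<close>: filtrations, processes and
  deterministic functions of time are total on \<^typ>\<open>real\<close>, and their values at negative times
  are never constrained or used.
\<close>

section \<open>Filtered probability spaces and processes\<close>

locale usual_filtered_prob_space = prob_space M + complete_measure M
  for M :: "'a measure" and F :: "real \<Rightarrow> 'a measure" +
  assumes subalgebra_F: "\<And>t. 0 \<le> t \<Longrightarrow> subalgebra M (F t)"
    and F_mono: "\<And>s t. 0 \<le> s \<Longrightarrow> s \<le> t \<Longrightarrow> sets (F s) \<subseteq> sets (F t)"
    and null_sets_F0: "null_sets M \<subseteq> sets (F 0)"
    and F_right_continuous: "\<And>t. 0 \<le> t \<Longrightarrow> sets (F t) = (\<Inter>s\<in>{t<..}. sets (F s))"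

definition adapted_process :: "(real \<Rightarrow> 'a measure) \<Rightarrow> (real \<Rightarrow> 'a \<Rightarrow> real) \<Rightarrow> bool" where
  "adapted_process F X \<longleftrightarrow> (\<forall>t\<ge>0. X t \<in> borel_measurable (F t))"

definition right_continuous_path :: "(real \<Rightarrow> real) \<Rightarrow> bool" where
  "right_continuous_path f \<longleftrightarrow> (\<forall>t\<ge>0. continuous (at_right t) f)"

definition cadlag_path :: "(real \<Rightarrow> real) \<Rightarrow> bool" where
  "cadlag_path f \<longleftrightarrow> right_continuous_path f \<and> (\<forall>t>0. \<exists>l. (f \<longlongrightarrow> l) (at_left t))"

definition predictable_sigma :: "'a measure \<Rightarrow> (real \<Rightarrow> 'a measure) \<Rightarrow> (real \<times> 'a) measure" where
  "predictable_sigma M F = sigma ({0..} \<times> space M)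
     ({{0} \<times> B | B. B \<in> sets (F 0)} \<union>
      {{s<..t} \<times> B | s t B. 0 \<le> s \<and> s \<le> t \<and> B \<in> sets (F s)})"

definition predictable_process ::
    "'a measure \<Rightarrow> (real \<Rightarrow> 'a measure) \<Rightarrow> (real \<Rightarrow> 'a \<Rightarrow> real) \<Rightarrow> bool" where
  "predictable_process M F H \<longleftrightarrow>
     (\<lambda>(t, \<omega>). H t \<omega>) \<in> borel_measurable (predictable_sigma M F)"

definition martingale ::
    "'a measure \<Rightarrow> (real \<Rightarrow> 'a measure) \<Rightarrow> (real \<Rightarrow> 'a \<Rightarrow> real) \<Rightarrow> bool" where
  "martingale M F N \<longleftrightarrow>
     adapted_process F N \<and> (\<forall>t\<ge>0. integrable M (N t)) \<and>
     (\<forall>s\<ge>0. \<forall>t\<ge>s. AE \<omega> in M. real_cond_exp M (F s) (N t) \<omega> = N s \<omega>)"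

text \<open>
  Stopping times take values in \<open>[0, \<infinity>]\<close>. The library predicate \<^const>\<open>stopping_time\<close>
  requires the time index type and the value type to coincide, hence the separate definition.
\<close>

definition random_stopping_time ::
    "'a measure \<Rightarrow> (real \<Rightarrow> 'a measure) \<Rightarrow> ('a \<Rightarrow> ennreal) \<Rightarrow> bool" where
  "random_stopping_time M F \<tau> \<longleftrightarrow> (\<forall>t\<ge>0. {\<omega> \<in> space M. \<tau> \<omega> \<le> ennreal t} \<in> sets (F t))"

definition stopped_process ::
    "(real \<Rightarrow> 'a \<Rightarrow> real) \<Rightarrow> ('a \<Rightarrow> ennreal) \<Rightarrow> real \<Rightarrow> 'a \<Rightarrow> real" where
  "stopped_process N \<tau> t \<omega> = N (enn2real (min (ennreal t) (\<tau> \<omega>))) \<omega>"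

text \<open>
  This is the notion of local martingale for processes started at 0; for a general initial value
  one would stop \<open>N - N 0\<close> instead.
\<close>

definition local_martingale ::
    "'a measure \<Rightarrow> (real \<Rightarrow> 'a measure) \<Rightarrow> (real \<Rightarrow> 'a \<Rightarrow> real) \<Rightarrow> bool" where
  "local_martingale M F N \<longleftrightarrow> adapted_process F N \<and>
     (\<exists>\<tau> :: nat \<Rightarrow> 'a \<Rightarrow> ennreal.
        (\<forall>n. random_stopping_time M F (\<tau> n)) \<and>
        (AE \<omega> in M. incseq (\<lambda>n. \<tau> n \<omega>) \<and> (\<lambda>n. \<tau> n \<omega>) \<longlonglongrightarrow> \<infinity>) \<and>
        (\<forall>n. martingale M F (stopped_process N (\<tau> n))))"

section \<open>The integral term\<close>

definition running_sup_left :: "(real \<Rightarrow> 'a \<Rightarrow> real) \<Rightarrow> real \<Rightarrow> 'a \<Rightarrow> ennreal" where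
  "running_sup_left X s \<omega> =
     (if s = 0 then ennreal (X 0 \<omega>) else (SUP u\<in>{0..<s}. ennreal (X u \<omega>)))"

text \<open>
  The left limit of the running supremum may be \<open>\<infinity>\<close>; there the non-decreasing function \<open>\<eta>\<close>
  is evaluated as its limit at infinity.
\<close>

definition extend_eta :: "(real \<Rightarrow> real) \<Rightarrow> ennreal \<Rightarrow> ennreal" where
  "extend_eta \<eta> x =
     (if x = \<infinity> then (SUP y\<in>{0..}. ennreal (\<eta> y)) else ennreal (\<eta> (enn2real x)))"

text \<open>
  Lebesgue--Stieltjes integral with respect to \<open>A\<close> over \<open>(0, t]\<close>. Since
  \<^const>\<open>interval_measure\<close> expects a function on the whole line, \<open>A\<close> is continued to the left
  by \<open>A 0\<close>.
\<close>

definition eta_integral ::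
    "(real \<Rightarrow> real) \<Rightarrow> (real \<Rightarrow> real) \<Rightarrow> (real \<Rightarrow> 'a \<Rightarrow> real) \<Rightarrow> real \<Rightarrow> 'a \<Rightarrow> ennreal" where
  "eta_integral \<eta> A X t \<omega> =
     (\<integral>\<^sup>+ s\<in>{0<..t}. extend_eta \<eta> (running_sup_left X s \<omega>)
        \<partial>interval_measure (\<lambda>s. A (max 0 s)))"

section \<open>Hypotheses\<close>

definition eta_p :: "real \<Rightarrow> (real \<Rightarrow> real) \<Rightarrow> real \<Rightarrow> real" where
  "eta_p p \<eta> x = p / (1 - p) * \<eta> (x powr (1 / p)) * x powr (1 - 1 / p)"

locale bihari_lasalle_setting = usual_filtered_prob_space M F
  for M :: "'a measure" and F :: "real \<Rightarrow> 'a measure" +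
  fixes p :: real
    and X :: "real \<Rightarrow> 'a \<Rightarrow> real"
    and A :: "real \<Rightarrow> real"
    and H :: "real \<Rightarrow> 'a \<Rightarrow> real"
    and N :: "real \<Rightarrow> 'a \<Rightarrow> real"
    and \<eta> :: "real \<Rightarrow> real"
  assumes X_adapted: "adapted_process F X"
    and X_nonneg: "\<And>t \<omega>. 0 \<le> t \<Longrightarrow> \<omega> \<in> space M \<Longrightarrow> 0 \<le> X t \<omega>"
    and X_right_continuous: "\<And>\<omega>. \<omega> \<in> space M \<Longrightarrow> right_continuous_path (\<lambda>t. X t \<omega>)"
    and A_mono: "mono_on {0..} A"
    and A_cadlag: "cadlag_path A"
    and A_zero: "A 0 = 0"
    and H_predictable: "predictable_process M F H"
    and H_nonneg: "\<And>t \<omega>. 0 \<le> t \<Longrightarrow> \<omega> \<in> space M \<Longrightarrow> 0 \<le> H t \<omega>"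
    and H_mono: "\<And>\<omega>. \<omega> \<in> space M \<Longrightarrow> mono_on {0..} (\<lambda>t. H t \<omega>)"
    and H_cadlag: "\<And>\<omega>. \<omega> \<in> space M \<Longrightarrow> cadlag_path (\<lambda>t. H t \<omega>)"
    and N_local_martingale: "local_martingale M F N"
    and N_cadlag: "\<And>\<omega>. \<omega> \<in> space M \<Longrightarrow> cadlag_path (\<lambda>t. N t \<omega>)"
    and N_zero: "\<And>\<omega>. \<omega> \<in> space M \<Longrightarrow> N 0 \<omega> = 0"
    and eta_nonneg: "\<And>x. 0 \<le> x \<Longrightarrow> 0 \<le> \<eta> x"
    and eta_continuous: "continuous_on {0..} \<eta>"
    and eta_mono: "mono_on {0..} \<eta>"
    and eta_pos: "\<And>x. 0 < x \<Longrightarrow> 0 < \<eta> x"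
    and eta_p_concave: "concave_on {0<..} (eta_p p \<eta>)"
    and eta_p_mono: "mono_on {0<..} (eta_p p \<eta>)"
    and X_le: "\<And>t. 0 \<le> t \<Longrightarrow>
      AE \<omega> in M. ereal (X t \<omega>) \<le> enn2ereal (eta_integral \<eta> A X t \<omega>) + ereal (N t \<omega>) + ereal (H t \<omega>)"

section \<open>The estimate\<close>

text \<open>
  \<open>G v\<close> is the oriented integral of \<open>1/\<eta>\<close> from 1 to \<open>v\<close>, for \<open>v \<ge> 0\<close>; the only infinite value
  it can take is \<open>G 0 = -\<infinity>\<close>.
\<close>

definition bihari_G :: "(real \<Rightarrow> real) \<Rightarrow> real \<Rightarrow> ereal" where
  "bihari_G \<eta> v =
     (if 1 \<le> v then enn2ereal (\<integral>\<^sup>+ u\<in>{1..v}. ennreal (1 / \<eta> u) \<partial>lborel)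
      else - enn2ereal (\<integral>\<^sup>+ u\<in>{v..1}. ennreal (1 / \<eta> u) \<partial>lborel))"

text \<open>
  Inverse of \<open>G\<close> on \<open>G ` [0, \<infinity>)\<close>. If \<open>G 0 = -\<infinity>\<close>, then \<open>G 0 + a = -\<infinity> = G 0\<close> for every real \<open>a\<close>,
  so the convention that the inverse of \<open>G\<close> is 0 at \<open>G 0 + a\<close> is built in.
\<close>

definition bihari_G_inv :: "(real \<Rightarrow> real) \<Rightarrow> ereal \<Rightarrow> real" where
  "bihari_G_inv \<eta> = inv_into {0..} (bihari_G \<eta>)"

text \<open>Power with a positive exponent on \<open>[0, \<infinity>]\<close>.\<close>

definition ennreal_powr :: "ennreal \<Rightarrow> real \<Rightarrow> ennreal" where
  "ennreal_powr x a = (if x = \<infinity> then \<infinity> else ennreal (enn2real x powr a))"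

text \<open>
  The first two conjuncts say that the right-hand side of the estimate is meaningful, i.e. that
  \<open>G\<close> and its inverse are evaluated inside their domains.
\<close>

definition bihari_estimate ::
    "real \<Rightarrow> real \<Rightarrow> real \<Rightarrow> 'a measure \<Rightarrow> (real \<Rightarrow> 'a \<Rightarrow> real) \<Rightarrow> (real \<Rightarrow> real) \<Rightarrow>
     (real \<Rightarrow> 'a \<Rightarrow> real) \<Rightarrow> (real \<Rightarrow> real) \<Rightarrow> real \<Rightarrow> bool" where
  "bihari_estimate p \<alpha> \<beta> M X A H \<eta> T \<longleftrightarrow>
     (let c = \<alpha> * (\<integral>\<omega>. H T \<omega> powr p \<partial>M) powr (1 / p);
          y = bihari_G \<eta> c + ereal (\<beta> * A T)
      in 0 \<le> c \<and> y \<in> bihari_G \<eta> ` {0..} \<and>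
         ennreal_powr (\<integral>\<^sup>+ \<omega>. (SUP t\<in>{0..T}. ennreal (X t \<omega> powr p)) \<partial>M) (1 / p)
           \<le> ennreal (bihari_G_inv \<eta> y))"

text \<open>
  The estimate is true, with constants \<open>\<alpha>\<close> and \<open>\<beta>\<close>, for all filtered probability spaces over
  the type \<open>'a\<close>, all processes and all functions \<open>\<eta>\<close> satisfying the hypotheses.
\<close>

definition bihari_estimate_valid :: "'a itself \<Rightarrow> real \<Rightarrow> real \<Rightarrow> real \<Rightarrow> bool" where
  "bihari_estimate_valid (_ :: 'a itself) p \<alpha> \<beta> \<longleftrightarrow>
     (\<forall>(M :: 'a measure) F X A H N \<eta>. bihari_lasalle_setting M F p X A H N \<eta> \<longrightarrow>
        (\<forall>T>0. (\<integral>\<^sup>+ \<omega>. ennreal (H T \<omega> powr p) \<partial>M) < \<infinity> \<longrightarrow>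
           bihari_estimate p \<alpha> \<beta> M X A H \<eta> T))"

text \<open>
  Sharpness, each constant taken separately with the other one unchanged. The type \<^typ>\<open>real\<close> of
  sample points carries atomless probability spaces; since quantification over types is not
  available inside a formula, the failure of a smaller constant is asserted already for filtered
  probability spaces over this type, which entails its failure for the class of all spaces.
\<close>

definition sharp_alpha :: "real \<Rightarrow> real \<Rightarrow> real \<Rightarrow> bool" where
  "sharp_alpha p \<alpha> \<beta> \<longleftrightarrow> (\<forall>\<alpha>'<\<alpha>. \<not> bihari_estimate_valid TYPE(real) p \<alpha>' \<beta>)"

definition sharp_beta :: "real \<Rightarrow> real \<Rightarrow> real \<Rightarrow> bool" where
  "sharp_beta p \<alpha> \<beta> \<longleftrightarrow> (\<forall>\<beta>'<\<beta>. \<not> bihari_estimate_valid TYPE(real) p \<alpha> \<beta>')"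

end

theory Submission
  imports Defs "HOL-Real_Asymp.Real_Asymp"
begin

text \<open>
  Let \<open>u > 0\<close>. Stop \<open>X\<close> when it exceeds \<open>u\<close>, and strictly before \<open>H\<close> reaches the level \<open>p u\<close>,
  which is possible because \<open>H\<close> is predictable. Optional stopping then gives, for the running
  supremum \<open>S\<close> of \<open>X\<close>,
  \<open>u P(S_T > u) \<le> E (\<integral> 1{S_(s-) \<le> u} \<eta>(S_(s-)) dA_s) + E (H_T \<and> p u) + u P(H_T \<ge> p u)\<close>.
  Multiplying by \<open>p u^(p - 2)\<close> and integrating over \<open>0 < u < b\<close> turns the terms with \<open>H\<close> into
  \<open>p^(-p) / (1 - p) E (H_T^p)\<close> and the first one into the integral of \<open>E (\<eta>_p (S_(s-)^p))\<close>, so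
  that Jensen's inequality for the concave function \<open>\<eta>_p\<close> leads to a deterministic Bihari--LaSalle
  inequality for the moment \<open>E ((S_t \<and> b)^p)\<close>. Cutting off at \<open>b\<close> makes all quantities finite.

  Both constants are sharp already for \<open>\<eta> x = x\<close>. The extremal processes stay at 0 except for
  rare excursions, during which \<open>X\<close> is a martingale that is multiplied by a constant close to 1 or
  dies. For \<open>\<alpha>\<close>, \<open>A = 0\<close> and \<open>H\<close> grows until a jump of \<open>X\<close> to the level \<open>H / p\<close> stops it; for \<open>\<beta>\<close>,
  \<open>H = 1\<close> and the drift starts the excursions at the current maximum.
\<close>

section \<open>The functions \<open>\<eta>\<close> and \<open>G\<close>\<close>

text \<open>The constants come from two changes of scale. The weight
  \<open>p * u powr (p - 2)\<close>, integrated over \<open>u > r\<close> and multiplied by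
  \<open>\<eta> r\<close>, gives exactly \<open>eta_p p \<eta> (r powr p)\<close>; this is why
  concavity is demanded of \<eta>_p and not of \<eta>. In the variable \<open>v powr (1 / p)\<close>
  the function \<open>G\<close> has derivative \<open>1 / ((1 - p) * eta_p p \<eta> v)\<close>,
  hence \<beta> = 1 / (1 - p), while \<alpha> is the p-th root of
  \<open>p powr (- p) / (1 - p)\<close>. For a local martingale \<open>N\<close>, optional stopping
  is an inequality, obtained from a lower bound for \<open>N\<close> along the whole path up to the
  stopping time. Since \<open>X \<ge> 0\<close>, such a bound follows as long as the drift and
  \<open>H\<close> are bounded there. A jump of \<open>H\<close> may destroy it at the very moment
  of crossing a level, which is the reason for stopping strictly earlier. In the extremal examples
  the maximum of an excursion from height \<open>x\<close> has tail about \<open>x / u\<close>,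
  hence p-th moment about \<open>x powr p / (1 - p)\<close>. For \<alpha> the other factor
  \<open>1 / p\<close> is the height of the jump relative to \<open>H\<close>. For \<beta> each
  excursion from the maximum \<open>S\<close> adds about \<open>p / (1 - p) * S powr p\<close> to
  the moment, and this is the growth rate that the estimate has to allow.\<close>

locale bihari_eta =
  fixes p :: real and \<eta> :: "real \<Rightarrow> real"
  assumes p_pos: "0 < p" and p_less_1: "p < 1"
    and eta_nonneg: "\<And>x. 0 \<le> x \<Longrightarrow> 0 \<le> \<eta> x"
    and eta_continuous: "continuous_on {0..} \<eta>"
    and eta_mono: "mono_on {0..} \<eta>"
    and eta_pos: "\<And>x. 0 < x \<Longrightarrow> 0 < \<eta> x"
    and eta_p_concave: "concave_on {0<..} (eta_p p \<eta>)"
    and eta_p_mono: "mono_on {0<..} (eta_p p \<eta>)"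
begin

abbreviation "ep \<equiv> eta_p p \<eta>"

lemma ep_pos: "0 < x \<Longrightarrow> 0 < ep x"
  using eta_pos p_pos p_less_1 by (simp add: eta_p_def)

lemma ep_0 [simp]: "ep 0 = 0"
  by (simp add: eta_p_def)

lemma ep_nonneg: "0 \<le> x \<Longrightarrow> 0 \<le> ep x"
  using ep_pos[of x] by (cases "x = 0") auto

lemma ep_le: "0 \<le> x \<Longrightarrow> x \<le> y \<Longrightarrow> ep x \<le> ep y"
  using mono_onD[OF eta_p_mono, of x y] ep_nonneg[of y] by (cases "x = 0") auto

text \<open>A positive value at 0 would make \<open>ep x\<close> at least a positive multiple of
  \<open>x powr (1 - 1 / p)\<close>, which blows up at 0 because \<open>1 - 1 / p < 0\<close>,
  whereas monotonicity bounds \<open>ep\<close> by \<open>ep 1\<close> on (0, 1].\<close>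

lemma eta_0: "\<eta> 0 = 0"
proof (rule ccontr)
  assume "\<eta> 0 \<noteq> 0"
  then have e0: "0 < \<eta> 0" using eta_nonneg[of 0] by simp
  define c where "c = p / (1 - p) * \<eta> 0"
  have c: "0 < c" using e0 p_pos p_less_1 by (simp add: c_def)
  have "c * x powr (1 - 1 / p) \<le> ep 1" if x: "0 < x" "x \<le> 1" for x
  proof -
    have "\<eta> 0 \<le> \<eta> (x powr (1 / p))" by (rule mono_onD[OF eta_mono]) auto
    then have "c * x powr (1 - 1 / p) \<le> ep x"
      unfolding eta_p_def c_def using p_pos p_less_1
      by (intro mult_right_mono mult_left_mono) auto
    also have "\<dots> \<le> ep 1" using x by (intro ep_le) auto
    finally show ?thesis .
  qed
  then have "\<forall>\<^sub>F x in at_right 0. c * x powr (1 - 1 / p) \<le> ep 1"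
    by (auto simp: eventually_at_right_field intro!: exI[of _ 1])
  moreover have "1 - 1 / p < 0" using p_pos p_less_1 by (simp add: field_simps)
  with c have "filterlim (\<lambda>x. c * x powr (1 - 1 / p)) at_top (at_right 0)"
    by real_asymp
  then have "\<forall>\<^sub>F x in at_right 0. ep 1 < c * x powr (1 - 1 / p)"
    by (simp add: filterlim_at_top_dense)
  ultimately have "\<forall>\<^sub>F x :: real in at_right 0. False" by eventually_elim auto
  then show False by simp
qed

text \<open>Concavity is available on the open half-line only. A supporting line dominates positive
  values there, so its limit at 0 is nonnegative; this extends the bound to \<open>x = 0\<close>,
  where \<open>ep\<close> is 0.\<close>

lemma ep_supporting_line:
  assumes "0 < z"
  obtains m where "\<And>x. 0 \<le> x \<Longrightarrow> ep x \<le> ep z + m * (x - z)"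
proof -
  \<comment> \<open>The right derivative of \<open>ep\<close> at \<open>z\<close>: the infimum of
    the right-hand difference quotients of the convex function \<open>- ep\<close>, with the sign
    reversed.\<close>
  define m where "m = - Inf ((\<lambda>t. (- ep z - - ep t) / (z - t)) ` ({z<..} \<inter> {0<..}))"
  have pos: "ep x \<le> ep z + m * (x - z)" if "0 < x" for x
  proof -
    have "convex_on {0<..} (\<lambda>x. - ep x)" using eta_p_concave by (simp add: concave_on_def)
    from convex_le_Inf_differential[OF this, of z x] that assms
    show ?thesis by (simp add: m_def interior_open)
  qed
  have "((\<lambda>x. ep z + m * (x - z)) \<longlongrightarrow> ep z + m * (0 - z)) (at_right 0)"
    by (intro tendsto_intros)
  moreover have "\<forall>\<^sub>F x in at_right 0. 0 \<le> ep z + m * (x - z)"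
    using pos ep_pos by (auto simp: eventually_at_right_field intro!: exI[of _ 1] order_trans[OF less_imp_le[OF ep_pos]])
  ultimately have "0 \<le> ep z + m * (0 - z)"
    by (intro tendsto_lowerbound) auto
  with pos that show ?thesis by (metis ep_0 order_le_less)
qed

text \<open>A concave function that is nonnegative at 0 is subhomogeneous: the supporting line at
  \<open>x\<close> is evaluated at \<open>l * x\<close>, and at 0 to bound its slope.\<close>

lemma ep_mult_le:
  assumes x: "0 \<le> x" and l: "1 \<le> l"
  shows "ep (l * x) \<le> l * ep x"
proof (cases "x = 0")
  case False
  then have x: "0 < x" using x by simp
  obtain m where m: "\<And>y. 0 \<le> y \<Longrightarrow> ep y \<le> ep x + m * (y - x)"
    using ep_supporting_line[OF x] by blast
  have "ep (l * x) \<le> ep x + (l - 1) * (m * x)"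
    using m[of "l * x"] x l by (simp add: algebra_simps)
  also have "\<dots> \<le> ep x + (l - 1) * ep x"
    using m[of 0] l by (intro add_left_mono mult_left_mono) auto
  finally show ?thesis by (simp add: algebra_simps)
qed simp

text \<open>Subhomogeneity of \<open>ep\<close> between 1 and \<open>u powr p\<close>, read back in
  terms of \<open>\<eta>\<close>. At most linear growth is what makes \<open>G\<close> unbounded
  above.\<close>

lemma eta_le_linear:
  assumes "1 \<le> u"
  shows "\<eta> u \<le> \<eta> 1 * u"
proof -
  have "(u powr p) powr (1 / p) = u" using assms p_pos by (simp add: powr_powr)
  moreover have "(u powr p) powr (1 - 1 / p) = u powr (p - 1)"
    using p_pos by (simp add: powr_powr algebra_simps)
  ultimately have "p / (1 - p) * \<eta> u * u powr (p - 1) = ep (u powr p * 1)"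
    by (simp add: eta_p_def)
  also have "\<dots> \<le> u powr p * ep 1"
    using assms p_pos by (intro ep_mult_le) (auto simp: ge_one_powr_ge_zero)
  also have "\<dots> = p / (1 - p) * (\<eta> 1 * u powr p)"
    by (simp add: eta_p_def)
  finally have "p / (1 - p) * (\<eta> u * u powr (p - 1)) \<le> p / (1 - p) * (\<eta> 1 * u powr p)"
    by (simp add: mult.assoc)
  then have "\<eta> u * u powr (p - 1) \<le> \<eta> 1 * u powr p"
    by (rule mult_left_le_imp_le) (use p_pos p_less_1 in simp)
  also have "u powr p = u * u powr (p - 1)"
    using assms by (simp add: powr_mult_base)
  finally have "\<eta> u * u powr (p - 1) \<le> (\<eta> 1 * u) * u powr (p - 1)"
    by (simp add: mult_ac)
  then show ?thesis by (rule mult_right_le_imp_le) (use assms in simp)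
qed

text \<open>The values of \<open>bihari_G\<close> on the positive half-line, as gauge integrals, to
  which the fundamental theorem of calculus applies directly.\<close>

definition Gr :: "real \<Rightarrow> real" where
  "Gr v = (if 1 \<le> v then integral {1..v} (\<lambda>u. 1 / \<eta> u) else - integral {v..1} (\<lambda>u. 1 / \<eta> u))"

lemma inverse_eta_continuous: "0 < a \<Longrightarrow> continuous_on {a..b} (\<lambda>u. 1 / \<eta> u)"
  using eta_pos
  by (intro continuous_intros continuous_on_subset[OF eta_continuous]) (auto simp: less_imp_neq[symmetric])

lemma inverse_eta_integrable: "0 < a \<Longrightarrow> (\<lambda>u. 1 / \<eta> u) integrable_on {a..b}"
  by (intro integrable_continuous_interval inverse_eta_continuous)

lemma Gr_has_derivative:
  assumes "0 < v"
  shows "(Gr has_real_derivative 1 / \<eta> v) (at v)"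
proof -
  \<comment> \<open>Both \<open>v\<close> and 1 lie inside \<open>{a..b}\<close>, so that near
    \<open>v\<close> the function \<open>Gr\<close> is the integral from \<open>a\<close> up to an
    additive constant, in both cases of its definition.\<close>
  define a b where "a = min v 1 / 2" and "b = max v 1 + 1"
  have ab: "0 < a" "a < v" "v < b" "a < 1" "1 < b" using assms by (auto simp: a_def b_def)
  let ?f = "\<lambda>u. 1 / \<eta> u"
  have eq: "integral {a..x} ?f - integral {a..1} ?f = Gr x" if "x \<in> {a<..<b}" for x
  proof (cases "1 \<le> x")
    case True
    then have "integral {a..1} ?f + integral {1..x} ?f = integral {a..x} ?f"
      using ab that by (intro Henstock_Kurzweil_Integration.integral_combine inverse_eta_integrable) auto
    then show ?thesis using True by (simp add: Gr_def)
  next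
    case False
    then have "integral {a..x} ?f + integral {x..1} ?f = integral {a..1} ?f"
      using ab that by (intro Henstock_Kurzweil_Integration.integral_combine inverse_eta_integrable) auto
    then show ?thesis using False by (simp add: Gr_def)
  qed
  have "((\<lambda>x. integral {a..x} ?f) has_real_derivative ?f v) (at v within {a..b})"
    using ab by (intro integral_has_real_derivative inverse_eta_continuous) auto
  then have "((\<lambda>x. integral {a..x} ?f) has_real_derivative ?f v) (at v)"
    using ab by (simp add: at_within_Icc_at)
  then have "((\<lambda>x. integral {a..x} ?f - integral {a..1} ?f) has_real_derivative ?f v) (at v)"
    by (auto intro!: derivative_eq_intros)
  then show ?thesis
    by (rule has_field_derivative_transform_within_open[of _ _ _ "{a<..<b}"]) (use ab eq in auto)
qed

lemma Gr_less: "0 < x \<Longrightarrow> x < y \<Longrightarrow> Gr x < Gr y"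
  by (rule DERIV_pos_imp_increasing[of x y Gr])
    (auto intro!: exI[of _ "1 / \<eta> _"] Gr_has_derivative simp: eta_pos)

lemma Gr_le: "0 < x \<Longrightarrow> x \<le> y \<Longrightarrow> Gr x \<le> Gr y"
  using Gr_less[of x y] by (cases "x = y") auto

lemma Gr_1 [simp]: "Gr 1 = 0"
  by (simp add: Gr_def)

lemma bihari_G_eq_Gr:
  assumes "0 < v"
  shows "bihari_G \<eta> v = ereal (Gr v)"
proof -
  have *: "(\<integral>\<^sup>+ u\<in>{a..b}. ennreal (1 / \<eta> u) \<partial>lborel) = ennreal (integral {a..b} (\<lambda>u. 1 / \<eta> u))"
    "0 \<le> integral {a..b} (\<lambda>u. 1 / \<eta> u)" if "0 < a" for a b
    using that
    by (intro nn_integral_has_integral_lebesgue' integrable_integral inverse_eta_integrable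
        Henstock_Kurzweil_Integration.integral_nonneg divide_nonneg_nonneg eta_nonneg; simp)+
  show ?thesis using assms *[of 1 v] *[of v 1]
    by (simp add: bihari_G_def Gr_def enn2ereal_ennreal)
qed

text \<open>Monotone convergence; the limit is \<open>-\<infinity>\<close> exactly when
  \<open>1 / \<eta>\<close> is not integrable near 0. Facts about \<open>G 0\<close> are derived
  from \<open>Gr\<close> through this limit.\<close>

lemma bihari_G_0_limit: "(\<lambda>n. ereal (Gr (1 / real (Suc n)))) \<longlonglongrightarrow> bihari_G \<eta> 0"
proof -
  have meas: "(\<lambda>u. ennreal (1 / \<eta> u) * indicator {a..1} u) \<in> borel_measurable lborel" if "0 \<le> a" for a
  proof -
    have "(\<lambda>u. indicator {a..1} u *\<^sub>R \<eta> u) \<in> borel_measurable borel"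
      by (rule borel_measurable_continuous_on_indicator)
        (use that in \<open>auto intro: continuous_on_subset[OF eta_continuous]\<close>)
    then have "(\<lambda>u. ennreal (1 / (indicator {a..1} u *\<^sub>R \<eta> u))) \<in> borel_measurable lborel"
      by simp
    also have "(\<lambda>u. ennreal (1 / (indicator {a..1} u *\<^sub>R \<eta> u))) = (\<lambda>u. ennreal (1 / \<eta> u) * indicator {a..1} u)"
      by (auto simp: indicator_def)
    finally show ?thesis .
  qed
  have "(\<lambda>n. \<integral>\<^sup>+ u\<in>{1 / real (Suc n)..1}. ennreal (1 / \<eta> u) \<partial>lborel)
      \<longlonglongrightarrow> (\<integral>\<^sup>+ u\<in>{0..1}. ennreal (1 / \<eta> u) \<partial>lborel)"
  proof (rule nn_integral_LIMSEQ)
    show "incseq (\<lambda>n u. ennreal (1 / \<eta> u) * indicator {1 / real (Suc n)..1} u)"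
    proof (intro monoI le_funI mult_left_mono)
      fix m n :: nat and u :: real assume "m \<le> n"
      then have "1 / real (Suc n) \<le> 1 / real (Suc m)" by (simp add: frac_le)
      then show "indicator {1 / real (Suc m)..1} u \<le> (indicator {1 / real (Suc n)..1} u :: ennreal)"
        unfolding indicator_def by (auto simp del: of_nat_Suc)
    qed simp
    show "(\<lambda>i. ennreal (1 / \<eta> u) * indicator {1 / real (Suc i)..1} u) \<longlonglongrightarrow>
        ennreal (1 / \<eta> u) * indicator {0..1} u" for u
    proof (cases "0 < u")
      case True
      have "\<forall>\<^sub>F n in sequentially. 1 / real (Suc n) < u"
        using True by real_asymp
      then have "\<forall>\<^sub>F n in sequentially. ennreal (1 / \<eta> u) * indicator {0..1} u =
          ennreal (1 / \<eta> u) * indicator {1 / real (Suc n)..1} u"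
        by eventually_elim (use True in \<open>auto simp: indicator_def\<close>)
      then show ?thesis by (rule Lim_transform_eventually[OF tendsto_const])
    next
      case False
      then have "\<not> 1 / real (Suc i) \<le> u" for i
        by (metis divide_pos_pos le_less_trans linorder_not_le of_nat_0_less_iff zero_less_Suc zero_less_one not_less)
      \<comment> \<open>At the point 0 both sides vanish, since \<open>\<eta> 0 = 0\<close> and
        division by 0 yields 0.\<close>
      with False eta_0 show ?thesis
        by (cases "u = 0") (auto simp: indicator_def)
    qed
  qed (rule meas, simp)
  then have "(\<lambda>n. - enn2ereal (\<integral>\<^sup>+ u\<in>{1 / real (Suc n)..1}. ennreal (1 / \<eta> u) \<partial>lborel))
      \<longlonglongrightarrow> - enn2ereal (\<integral>\<^sup>+ u\<in>{0..1}. ennreal (1 / \<eta> u) \<partial>lborel)"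
    by (intro tendsto_uminus_ereal continuous_on_tendsto_compose[OF continuous_on_enn2ereal]) auto
  moreover have "- enn2ereal (\<integral>\<^sup>+ u\<in>{1 / real (Suc n)..1}. ennreal (1 / \<eta> u) \<partial>lborel) = ereal (Gr (1 / real (Suc n)))" for n
  proof (cases n)
    case 0
    then show ?thesis using bihari_G_eq_Gr[of 1]
      by (simp add: bihari_G_def)
  next
    case (Suc m)
    then show ?thesis using bihari_G_eq_Gr[of "1 / real (Suc n)"]
      by (simp add: bihari_G_def)
  qed
  ultimately show ?thesis by (simp add: bihari_G_def)
qed

lemma bihari_G_0_le:
  assumes "0 < v"
  shows "bihari_G \<eta> 0 \<le> ereal (Gr v)"
proof (rule LIMSEQ_le_const2[OF bihari_G_0_limit])
  have "\<forall>\<^sub>F n in sequentially. 1 / real (Suc n) < v"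
    using assms by real_asymp
  then obtain n0 where "\<And>n. n0 \<le> n \<Longrightarrow> 1 / real (Suc n) < v"
    by (auto simp: eventually_sequentially)
  then show "\<exists>N. \<forall>n\<ge>N. ereal (Gr (1 / real (Suc n))) \<le> ereal (Gr v)"
    using Gr_le[of "1 / real (Suc _)" v] by (intro exI[of _ n0]) (simp add: less_imp_le)
qed

lemma bihari_G_less:
  assumes "0 \<le> x" "x < y"
  shows "bihari_G \<eta> x < bihari_G \<eta> y"
proof (cases "x = 0")
  case True
  have "bihari_G \<eta> 0 \<le> ereal (Gr (y / 2))" using assms by (intro bihari_G_0_le) auto
  also have "\<dots> < ereal (Gr y)" using assms Gr_less[of "y / 2" y] by auto
  finally show ?thesis using True assms by (simp add: bihari_G_eq_Gr)
next
  case False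
  then show ?thesis using assms Gr_less by (simp add: bihari_G_eq_Gr)
qed

lemma inj_on_bihari_G: "inj_on (bihari_G \<eta>) {0..}"
  by (intro linorder_inj_onI') (metis atLeast_iff bihari_G_less less_irrefl)

text \<open>By linear growth of \<open>\<eta>\<close>, the function
  \<open>Gr v - ln v / \<eta> 1\<close> has nonnegative derivative beyond 1, so \<open>Gr v\<close>
  is at least \<open>ln v / \<eta> 1\<close>; the witness makes this quotient equal to
  \<open>max y 0\<close>.\<close>

lemma Gr_unbounded:
  obtains v where "1 \<le> v" "y \<le> Gr v"
proof
  define v where "v = exp (\<eta> 1 * max y 0)"
  have e1: "0 < \<eta> 1" by (rule eta_pos) simp
  show v1: "1 \<le> v" using e1 by (simp add: v_def)
  have MVT: "\<exists>z>1. z < v \<and> (Gr v - ln v / \<eta> 1) - (Gr 1 - ln 1 / \<eta> 1) = (v - 1) * (1 / \<eta> z - 1 / (z * \<eta> 1))" if "1 < v"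
    using that e1
    by (intro MVT2) (auto intro!: derivative_eq_intros Gr_has_derivative simp: field_simps)
  have le: "1 / (z * \<eta> 1) \<le> 1 / \<eta> z" if "1 < z" for z
    using eta_le_linear[of z] that eta_pos[of z] e1 by (simp add: frac_le mult.commute)
  have "ln v / \<eta> 1 \<le> Gr v"
  proof (cases "v = 1")
    case False
    then have "1 < v" using v1 by simp
    from MVT[OF this] obtain z where z: "1 < z" "z < v"
        "Gr v - ln v / \<eta> 1 = (v - 1) * (1 / \<eta> z - 1 / (z * \<eta> 1))"
      by auto
    have "0 \<le> (v - 1) * (1 / \<eta> z - 1 / (z * \<eta> 1))"
      using z le[of z] by (intro mult_nonneg_nonneg) auto
    then show ?thesis using z by simp
  qed simp
  moreover have "ln v / \<eta> 1 = max y 0" using e1 by (simp add: v_def)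
  ultimately show "y \<le> Gr v" by linarith
qed

lemma bihari_G_0_approx:
  assumes "bihari_G \<eta> 0 < z"
  obtains v where "0 < v" "ereal (Gr v) < z"
proof -
  have "\<forall>\<^sub>F n in sequentially. ereal (Gr (1 / real (Suc n))) < z"
    using order_tendstoD(2)[OF bihari_G_0_limit assms] .
  then obtain n where "ereal (Gr (1 / real (Suc n))) < z"
    by (auto simp: eventually_sequentially)
  then show ?thesis by (intro that[of "1 / real (Suc n)"]) auto
qed

text \<open>The intermediate value theorem applies as soon as some \<open>v > 0\<close> has
  \<open>Gr v\<close> below the target. Such a \<open>v\<close> can be lacking only if
  \<open>c = 0\<close> and adding \<open>a\<close> does not change \<open>G 0\<close>, and then 0
  itself is the preimage.\<close>

lemma bihari_G_surj:
  assumes c: "0 \<le> c" and a: "0 \<le> a"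
  shows "bihari_G \<eta> c + ereal a \<in> bihari_G \<eta> ` {0..}"
proof -
  have ivt: "ereal y \<in> bihari_G \<eta> ` {0..}" if "0 < v" "Gr v \<le> y" for v y
  proof -
    obtain w where w: "1 \<le> w" "y \<le> Gr w" by (rule Gr_unbounded)
    have "\<exists>x\<ge>v. x \<le> max v w \<and> Gr x = y"
    proof (rule IVT)
      show "y \<le> Gr (max v w)" using w that Gr_le[of w "max v w"] by simp
      show "\<forall>x. v \<le> x \<and> x \<le> max v w \<longrightarrow> isCont Gr x"
        using that by (auto intro!: DERIV_isCont[OF Gr_has_derivative])
    qed (use that in auto)
    then obtain x where "v \<le> x" "Gr x = y" by blast
    then show ?thesis using that bihari_G_eq_Gr[of x] by (intro image_eqI[of _ _ x]) auto
  qed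
  show ?thesis
  proof (cases "c = 0")
    case False
    then show ?thesis using c a ivt[of c "Gr c + a"] by (simp add: bihari_G_eq_Gr)
  next
    case True
    show ?thesis
    proof (cases "bihari_G \<eta> 0 < bihari_G \<eta> 0 + ereal a")
      case less: True
      then obtain v where v: "0 < v" "ereal (Gr v) < bihari_G \<eta> 0 + ereal a"
        by (rule bihari_G_0_approx)
      have "bihari_G \<eta> 0 \<noteq> \<infinity>" using bihari_G_0_le[of 1] by auto
      then obtain y where y: "bihari_G \<eta> 0 + ereal a = ereal y"
        using less by (cases "bihari_G \<eta> 0") auto
      show ?thesis using v ivt[of v y] True y by simp
    next
      case eq: False
      then have "bihari_G \<eta> 0 + ereal a = bihari_G \<eta> 0"
        using a by (cases "bihari_G \<eta> 0") auto
      then show ?thesis using True by auto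
    qed
  qed
qed

text \<open>The inequality is assumed for all \<open>k > 0\<close> above \<open>c\<close> because
  the moment argument works with positive starting values. For \<open>c = 0\<close>, letting
  \<open>k\<close> tend to 0 turns \<open>Gr k\<close> into \<open>G 0\<close>, finite or
  not.\<close>

lemma le_bihari_G_inv:
  assumes D: "0 \<le> D" and c: "0 \<le> c" and a: "0 \<le> a"
    and le: "\<And>k. 0 < k \<Longrightarrow> c \<le> k \<Longrightarrow> 0 < D \<Longrightarrow> Gr D \<le> Gr k + a"
  shows "D \<le> bihari_G_inv \<eta> (bihari_G \<eta> c + ereal a)"
proof -
  define w where "w = bihari_G_inv \<eta> (bihari_G \<eta> c + ereal a)"
  have w: "0 \<le> w" "bihari_G \<eta> w = bihari_G \<eta> c + ereal a"
    using bihari_G_surj[OF c a] inv_into_into[of "bihari_G \<eta> c + ereal a" "bihari_G \<eta>" "{0..}"]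
    by (auto simp: w_def bihari_G_inv_def f_inv_into_f)
  have "D \<le> w"
  proof (rule ccontr)
    assume "\<not> D \<le> w"
    then have lt: "bihari_G \<eta> c + ereal a < ereal (Gr D)" and D: "0 < D"
      using bihari_G_less[of w D] w bihari_G_eq_Gr[of D] by auto
    show False
    proof (cases "c = 0")
      case False
      then show ?thesis using lt le[of c] c D by (simp add: bihari_G_eq_Gr)
    next
      case True
      then have "bihari_G \<eta> 0 < ereal (Gr D - a)"
        using lt by (cases "bihari_G \<eta> 0") auto
      then obtain v where "0 < v" "Gr v < Gr D - a"
        by (rule bihari_G_0_approx) auto
      then show ?thesis using le[of v] D True by simp
    qed
  qed
  then show ?thesis by (simp add: w_def)
qed

section \<open>The deterministic Bihari--LaSalle inequality\<close>

definition Phi :: "real \<Rightarrow> real" where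
  "Phi v = Gr (v powr (1 / p))"

text \<open>In this scale \<open>v\<close> stands for a p-th moment and
  \<open>v powr (1 / p)\<close> for the norm. The factor \<open>1 / (1 - p)\<close> in the
  derivative is the constant \<beta>.\<close>

lemma Phi_has_derivative:
  assumes "0 < v"
  shows "(Phi has_real_derivative 1 / ((1 - p) * ep v)) (at v)"
proof -
  have "((\<lambda>v. Gr (v powr (1 / p))) has_real_derivative
      1 / \<eta> (v powr (1 / p)) * (1 / p * v powr (1 / p - 1))) (at v)"
    using assms
    by (intro DERIV_chain2[OF Gr_has_derivative])
      (auto intro!: derivative_eq_intros simp: powr_diff)
  also have "1 / \<eta> (v powr (1 / p)) * (1 / p * v powr (1 / p - 1)) = 1 / ((1 - p) * ep v)"
  proof -
    have "v powr (1 / p - 1) = 1 / v powr (1 - 1 / p)"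
      using powr_minus_divide[of v "1 - 1 / p"] by simp
    then show ?thesis using p_less_1 by (simp add: eta_p_def)
  qed
  finally show ?thesis by (simp add: Phi_def[abs_def])
qed

text \<open>The derivative of \<open>Phi\<close> decreases because \<open>ep\<close> increases, so
  the increment is bounded by means of the derivative at the left end.\<close>

lemma Phi_diff_le:
  assumes "0 < x" "x \<le> y"
  shows "Phi y - Phi x \<le> (y - x) / ((1 - p) * ep x)"
proof (cases "x = y")
  case False
  then have "x < y" using assms by simp
  then obtain z where z: "x < z" "z < y" "Phi y - Phi x = (y - x) * (1 / ((1 - p) * ep z))"
    using MVT2[of x y Phi "\<lambda>v. 1 / ((1 - p) * ep v)"] Phi_has_derivative assms by auto
  have "1 / ((1 - p) * ep z) \<le> 1 / ((1 - p) * ep x)"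
    using z assms p_less_1 ep_pos[of x] ep_pos[of z]
    by (intro divide_left_mono mult_left_mono ep_le) auto
  then have "(y - x) * (1 / ((1 - p) * ep z)) \<le> (y - x) * (1 / ((1 - p) * ep x))"
    using \<open>x < y\<close> by (intro mult_left_mono) auto
  then show ?thesis using z by simp
qed simp

text \<open>\<open>F\<close> and \<open>A\<close> may jump, so the chain rule is replaced by steps
  along which \<open>F\<close> grows at most by the factor \<open>1 + d\<close>, except for a jump
  at the very end. Since \<open>incr\<close> looks at \<open>F\<close> strictly before
  \<open>t\<close> only, such a jump costs nothing. Each step loses the factor \<open>1 + d\<close>,
  which disappears as \<open>d\<close> tends to 0.\<close>

lemma bihari_deterministic:
  fixes F A :: "real \<Rightarrow> real"
  assumes F0: "0 < F 0" and T: "0 \<le> T"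
    and F_mono: "mono_on {0..T} F" and A_mono: "mono_on {0..T} A"
    and A_cont: "\<And>t. 0 \<le> t \<Longrightarrow> t < T \<Longrightarrow> continuous (at_right t) A"
    and incr: "\<And>s t C. 0 \<le> s \<Longrightarrow> s \<le> t \<Longrightarrow> t \<le> T \<Longrightarrow> 0 \<le> C \<Longrightarrow> (\<And>r. s \<le> r \<Longrightarrow> r < t \<Longrightarrow> F r \<le> C) \<Longrightarrow>
      F t - F s \<le> ep C * (A t - A s)"
  shows "Phi (F T) \<le> Phi (F 0) + (A T - A 0) / (1 - p)"
proof -
  have F_pos: "0 < F t" if "0 \<le> t" "t \<le> T" for t
    using mono_onD[OF F_mono, of 0 t] that F0 by auto
  have bound: "Phi (F T) \<le> Phi (F 0) + (1 + d) * (A T - A 0) / (1 - p)" if d: "0 < d" for d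
  proof -
    let ?P = "\<lambda>t. Phi (F t) \<le> Phi (F 0) + (1 + d) * (A t - A 0) / (1 - p)"
    have step: "?P t" if st: "0 \<le> s" "s \<le> t" "t \<le> T" and s: "?P s"
      and le: "\<And>r. s \<le> r \<Longrightarrow> r < t \<Longrightarrow> F r \<le> (1 + d) * F s" for s t
    proof -
      have pos: "0 < F s" "0 < ep (F s)" using F_pos[of s] ep_pos st by auto
      have "0 \<le> A t - A s" using mono_onD[OF A_mono, of s t] st by auto
      have "F t - F s \<le> ep ((1 + d) * F s) * (A t - A s)"
        using st le pos d by (intro incr) auto
      also have "\<dots> \<le> (1 + d) * ep (F s) * (A t - A s)"
        using pos d \<open>0 \<le> A t - A s\<close> by (intro mult_right_mono ep_mult_le) auto
      finally have *: "F t - F s \<le> (1 + d) * ep (F s) * (A t - A s)" .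
      have "Phi (F t) - Phi (F s) \<le> (F t - F s) / ((1 - p) * ep (F s))"
        using pos st mono_onD[OF F_mono, of s t] by (intro Phi_diff_le) auto
      also have "\<dots> \<le> ((1 + d) * ep (F s) * (A t - A s)) / ((1 - p) * ep (F s))"
        using * pos p_less_1 by (intro divide_right_mono) auto
      also have "\<dots> = (1 + d) * (A t - A s) / (1 - p)"
        using pos by simp
      finally show ?thesis using s by (simp add: right_diff_distrib diff_divide_distrib)
    qed
    \<comment> \<open>Induction over geometric levels: \<open>n\<close> bounds the number of factors
      \<open>1 + d\<close> that \<open>F\<close> gains strictly before \<open>t\<close>.\<close>
    have "?P t" if "0 \<le> t" "t \<le> T" "\<And>r. 0 \<le> r \<Longrightarrow> r < t \<Longrightarrow> F r \<le> (1 + d) ^ n * F 0" for n t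
      using that
    proof (induction n arbitrary: t)
      case 0
      show ?case
      proof (rule step)
        show "F r \<le> (1 + d) * F 0" if "0 \<le> r" "r < t" for r
          using "0.prems"(3)[OF that] F0 d by (simp add: algebra_simps add_increasing2)
      qed (use 0 in auto)
    next
      case (Suc n)
      define B where "B = (1 + d) ^ n * F 0"
      \<comment> \<open>The times at which \<open>F\<close> has left the previous level. Up to their
        infimum \<open>s\<close> the induction hypothesis applies, and from \<open>s\<close> on a
        single step suffices.\<close>
      define S where "S = {r\<in>{0..<t}. B < F r}"
      show ?case
      proof (cases "S = {}")
        case True
        then show ?thesis using Suc.prems by (intro Suc.IH) (auto simp: S_def B_def not_less[symmetric])
      next
        case False
        define s where "s = Inf S"
        have bdd: "bdd_below S" by (auto simp: S_def intro!: bdd_belowI[of _ 0])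
        have s0: "0 \<le> s" unfolding s_def using False by (intro cInf_greatest) (auto simp: S_def)
        have st: "s < t"
        proof -
          obtain r where r: "r \<in> S" using False by auto
          then have "s \<le> r" unfolding s_def by (intro cInf_lower bdd)
          then show ?thesis using r by (simp add: S_def)
        qed
        have "F r \<le> B" if "0 \<le> r" "r < s" for r
          using cInf_lower[OF _ bdd, of r] that st by (auto simp: S_def s_def not_less[symmetric])
        then have Ps: "?P s"
          using s0 st Suc.prems by (intro Suc.IH) (auto simp: B_def)
        \<comment> \<open>Right continuity of \<open>A\<close> enters here: \<open>F r - F s\<close>
          is at most \<open>ep (F T)\<close> times an increment of \<open>A\<close> that tends to 0
          as \<open>r\<close> decreases to \<open>s\<close>, so \<open>F\<close> cannot jump past
          the level immediately after \<open>s\<close>.\<close>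
        have Bs: "B \<le> F s"
        proof (rule ccontr)
          assume "\<not> B \<le> F s"
          then have lt: "F s < B" by simp
          have "(A \<longlongrightarrow> A s) (at_right s)"
            using A_cont[of s] s0 st Suc.prems by (simp add: continuous_within)
          then have "((\<lambda>r. ep (F T) * (A r - A s)) \<longlongrightarrow> ep (F T) * (A s - A s)) (at_right s)"
            by (intro tendsto_intros)
          then have "\<forall>\<^sub>F r in at_right s. ep (F T) * (A r - A s) < B - F s"
            by (rule order_tendstoD) (use lt in simp)
          then obtain b where b: "s < b" "\<And>r. s < r \<Longrightarrow> r < b \<Longrightarrow> ep (F T) * (A r - A s) < B - F s"
            by (auto simp: eventually_at_right_field)
          obtain r where r: "r \<in> S" "r < b"
            using cInf_lessD[OF False] b(1) unfolding s_def by blast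
          have "s \<le> r" unfolding s_def by (intro cInf_lower bdd r)
          then have sr: "s < r" using r lt by (cases "s = r") (auto simp: S_def)
          have "F r - F s \<le> ep (F T) * (A r - A s)"
          proof (rule incr)
            show "F q \<le> F T" if "s \<le> q" "q < r" for q
              using that s0 r Suc.prems by (intro mono_onD[OF F_mono]) (auto simp: S_def)
          qed (use sr s0 r Suc.prems F_pos[of T] T in \<open>auto simp: S_def\<close>)
          then show False using b(2)[OF sr r(2)] r by (simp add: S_def)
        qed
        show ?thesis
        proof (rule step[OF s0 _ _ Ps])
          show "F r \<le> (1 + d) * F s" if "s \<le> r" "r < t" for r
          proof -
            have "F r \<le> (1 + d) * B" using Suc.prems(3)[of r] that s0 by (simp add: B_def mult.assoc)
            also have "\<dots> \<le> (1 + d) * F s" using Bs d by (intro mult_left_mono) auto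
            finally show ?thesis .
          qed
        qed (use st Suc.prems in auto)
      qed
    qed note P = this
    obtain n where "F T / F 0 < (1 + d) ^ n"
      using real_arch_pow[of "1 + d" "F T / F 0"] d by auto
    then have n: "F T \<le> (1 + d) ^ n * F 0"
      using F0 by (simp add: field_simps)
    show ?thesis
    proof (rule P[OF T order_refl])
      show "F r \<le> (1 + d) ^ n * F 0" if "0 \<le> r" "r < T" for r
        using mono_onD[OF F_mono, of r T] n that by auto
    qed
  qed
  have "((\<lambda>d. Phi (F 0) + (1 + d) * (A T - A 0) / (1 - p)) \<longlongrightarrow> Phi (F 0) + (1 + 0) * (A T - A 0) / (1 - p)) (at_right 0)"
    using p_less_1 by (intro tendsto_intros) auto
  moreover have "\<forall>\<^sub>F d in at_right 0. Phi (F T) \<le> Phi (F 0) + (1 + d) * (A T - A 0) / (1 - p)"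
    using bound by (auto simp: eventually_at_right_field intro!: exI[of _ 1])
  ultimately show ?thesis
    using tendsto_lowerbound[of _ _ "at_right (0::real)" "Phi (F T)"] by fastforce
qed

end

section \<open>Optional stopping\<close>

lemma right_continuous_path_LIMSEQ:
  assumes f: "right_continuous_path f" and x: "0 \<le> x" and ge: "\<And>n. x \<le> X n" and X: "X \<longlonglongrightarrow> x"
  shows "(\<lambda>n. f (X n)) \<longlonglongrightarrow> f x"
proof -
  have "(f \<longlongrightarrow> f x) (at x within {x<..})"
    using f x by (simp add: right_continuous_path_def continuous_within)
  then have "(f \<longlongrightarrow> f x) (at x within {x..})"
    by (simp add: at_within_Ici_at_right)
  then have "continuous (at x within {x..}) f" by (simp add: continuous_within)
  then show ?thesis
    using ge X by (intro continuous_within_tendsto_compose'[of x "{x..}" f X]) auto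
qed

context usual_filtered_prob_space
begin

text \<open>Counterpart of \<open>random_stopping_time\<close> for real values, so that a process
  can be evaluated at the time without conversion.\<close>

definition real_stopping_time :: "('a \<Rightarrow> real) \<Rightarrow> bool" where
  "real_stopping_time \<theta> \<longleftrightarrow> (\<forall>t\<ge>0. {\<omega> \<in> space M. \<theta> \<omega> \<le> t} \<in> sets (F t))"

lemma sets_F_subset: "0 \<le> t \<Longrightarrow> A \<in> sets (F t) \<Longrightarrow> A \<in> sets M"
  using subalgebra_F[of t] by (auto simp: subalgebra_def)

lemma space_F: "0 \<le> t \<Longrightarrow> space (F t) = space M"
  using subalgebra_F[of t] by (auto simp: subalgebra_def)

lemma adapted_measurable: "adapted_process F Y \<Longrightarrow> 0 \<le> t \<Longrightarrow> Y t \<in> borel_measurable M"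
  using measurable_from_subalg[OF subalgebra_F[of t], of "Y t"] by (auto simp: adapted_process_def)

lemma real_stopping_time_min:
  assumes "real_stopping_time \<theta>" "real_stopping_time \<theta>'"
  shows "real_stopping_time (\<lambda>\<omega>. min (\<theta> \<omega>) (\<theta>' \<omega>))"
  unfolding real_stopping_time_def
proof (intro allI impI)
  fix t :: real assume t: "0 \<le> t"
  have "{\<omega> \<in> space M. min (\<theta> \<omega>) (\<theta>' \<omega>) \<le> t} = {\<omega> \<in> space M. \<theta> \<omega> \<le> t} \<union> {\<omega> \<in> space M. \<theta>' \<omega> \<le> t}"
    by auto
  also have "\<dots> \<in> sets (F t)"
    using assms t unfolding real_stopping_time_def by (intro sets.Un) auto
  finally show "{\<omega> \<in> space M. min (\<theta> \<omega>) (\<theta>' \<omega>) \<le> t} \<in> sets (F t)" .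
qed

lemma martingale_set_integral:
  assumes L: "martingale M F L" and st: "0 \<le> s" "s \<le> t" and E: "E \<in> sets (F s)"
  shows "(\<integral>\<omega>. indicator E \<omega> * L t \<omega> \<partial>M) = (\<integral>\<omega>. indicator E \<omega> * L s \<omega> \<partial>M)"
proof -
  interpret sub: finite_measure_subalgebra M "F s"
    by unfold_locales (rule subalgebra_F[OF st(1)])
  have EM: "E \<in> sets M" using sets_F_subset[OF st(1) E] .
  have "integrable M (L t)" "AE \<omega> in M. real_cond_exp M (F s) (L t) \<omega> = L s \<omega>"
    using L st by (auto simp: martingale_def)
  note * = this
  have "(\<integral>\<omega>\<in>E. L t \<omega> \<partial>M) = (\<integral>\<omega>\<in>E. real_cond_exp M (F s) (L t) \<omega> \<partial>M)"
    by (rule sub.real_cond_exp_intA[OF *(1) E])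
  also have "\<dots> = (\<integral>\<omega>\<in>E. L s \<omega> \<partial>M)"
  proof (unfold set_lebesgue_integral_def, rule integral_cong_AE)
    show "AE x in M. indicat_real E x *\<^sub>R real_cond_exp M (F s) (L t) x = indicat_real E x *\<^sub>R L s x"
      using *(2) by eventually_elim simp
  qed (use EM L st in \<open>auto simp: martingale_def\<close>)
  finally show ?thesis by (simp add: set_lebesgue_integral_def)
qed

section \<open>Approximation of a bounded stopping time by grid times from above\<close>

context
  fixes \<theta> :: "'a \<Rightarrow> real" and T :: real
  assumes \<theta>: "real_stopping_time \<theta>" and \<theta>_bounds: "\<And>\<omega>. \<omega> \<in> space M \<Longrightarrow> 0 \<le> \<theta> \<omega> \<and> \<theta> \<omega> \<le> T" and T: "0 < T"
begin

definition grid :: "nat \<Rightarrow> nat \<Rightarrow> real" where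
  "grid n i = T * real i / real (Suc n)"

text \<open>Rounding up and not down: the rounded time is again a stopping time, and
  right-continuous paths converge along it.\<close>

definition grid_index :: "nat \<Rightarrow> 'a \<Rightarrow> nat" where
  "grid_index n \<omega> = nat \<lceil>\<theta> \<omega> * real (Suc n) / T\<rceil>"

lemma grid_index_le_iff: "\<omega> \<in> space M \<Longrightarrow> grid_index n \<omega> \<le> i \<longleftrightarrow> \<theta> \<omega> \<le> grid n i"
proof -
  have "grid_index n \<omega> \<le> i \<longleftrightarrow> \<theta> \<omega> * real (Suc n) / T \<le> real i"
    unfolding grid_index_def nat_le_iff ceiling_le_iff by (simp only: of_int_of_nat_eq)
  also have "\<dots> \<longleftrightarrow> \<theta> \<omega> \<le> grid n i"
    using T by (simp add: grid_def pos_divide_le_eq pos_le_divide_eq mult.commute del: of_nat_Suc)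
  finally show ?thesis .
qed

lemma grid_bounds:
  assumes "\<omega> \<in> space M"
  shows "grid_index n \<omega> \<le> Suc n" "\<theta> \<omega> \<le> grid n (grid_index n \<omega>)"
    "grid n (grid_index n \<omega>) \<le> \<theta> \<omega> + T / real (Suc n)"
proof -
  show "grid_index n \<omega> \<le> Suc n"
    unfolding grid_index_le_iff[OF assms] using \<theta>_bounds[OF assms] by (simp add: grid_def del: of_nat_Suc)
  show "\<theta> \<omega> \<le> grid n (grid_index n \<omega>)"
    using grid_index_le_iff[OF assms] by blast
  have "real (grid_index n \<omega>) \<le> \<theta> \<omega> * real (Suc n) / T + 1"
  proof -
    have "0 \<le> \<theta> \<omega> * real (Suc n) / T" using \<theta>_bounds[OF assms] T by simp
    then have "0 \<le> \<lceil>\<theta> \<omega> * real (Suc n) / T\<rceil>" by linarith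
    then have "real (grid_index n \<omega>) = of_int \<lceil>\<theta> \<omega> * real (Suc n) / T\<rceil>"
      unfolding grid_index_def by (rule of_nat_nat)
    then show ?thesis by linarith
  qed
  then have "T * real (grid_index n \<omega>) / real (Suc n) \<le> T * (\<theta> \<omega> * real (Suc n) / T + 1) / real (Suc n)"
    using T by (intro divide_right_mono mult_left_mono) auto
  also have "\<dots> = \<theta> \<omega> + T / real (Suc n)"
    using T by (simp add: distrib_left add_divide_distrib del: of_nat_Suc)
  finally show "grid n (grid_index n \<omega>) \<le> \<theta> \<omega> + T / real (Suc n)"
    by (simp add: grid_def)
qed

lemma grid_nonneg: "0 \<le> grid n i"
  using T by (simp add: grid_def)

lemma grid_le: "i \<le> Suc n \<Longrightarrow> grid n i \<le> T"
  using T by (simp add: grid_def divide_le_eq del: of_nat_Suc)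

lemma grid_LIMSEQ:
  assumes "\<omega> \<in> space M"
  shows "(\<lambda>n. grid n (grid_index n \<omega>)) \<longlonglongrightarrow> \<theta> \<omega>"
proof (rule tendsto_sandwich[OF _ _ tendsto_const])
  show "(\<lambda>n. \<theta> \<omega> + T / real (Suc n)) \<longlonglongrightarrow> \<theta> \<omega>"
    using tendsto_add[OF tendsto_const LIMSEQ_Suc[OF lim_const_over_n[of T]], of "\<theta> \<omega>"] by simp
qed (use grid_bounds[OF assms] in auto)

lemma grid_index_sets: 
  "{\<omega> \<in> space M. grid_index n \<omega> = i} \<in> sets (F (grid n i))"
proof -
  have le: "{\<omega> \<in> space M. grid_index n \<omega> \<le> j} \<in> sets (F (grid n i))" if "j \<le> i" for j
  proof -
    have "{\<omega> \<in> space M. grid_index n \<omega> \<le> j} = {\<omega> \<in> space M. \<theta> \<omega> \<le> grid n j}"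
      using grid_index_le_iff by auto
    also have "\<dots> \<in> sets (F (grid n j))"
      using \<theta> grid_nonneg by (auto simp: real_stopping_time_def)
    also have "sets (F (grid n j)) \<subseteq> sets (F (grid n i))"
      using that T by (intro F_mono grid_nonneg) (auto simp: grid_def intro!: divide_right_mono mult_left_mono)
    finally show ?thesis .
  qed
  show ?thesis
  proof (cases i)
    case 0
    then show ?thesis using le[of 0] by simp
  next
    case (Suc j)
    have "{\<omega> \<in> space M. grid_index n \<omega> = i} =
      {\<omega> \<in> space M. grid_index n \<omega> \<le> i} - {\<omega> \<in> space M. grid_index n \<omega> \<le> j}"
      using Suc by auto
    then show ?thesis using le[of i] le[of j] Suc by auto
  qed
qed

text \<open>A process at the rounded time is a finite sum over the grid, which reduces measurability
  and integrability to fixed times.\<close>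

lemma grid_sum:
  fixes Y :: "real \<Rightarrow> 'a \<Rightarrow> real"
  assumes "\<omega> \<in> space M"
  shows "Y (grid n (grid_index n \<omega>)) \<omega> =
    (\<Sum>i\<le>Suc n. indicator {\<omega> \<in> space M. grid_index n \<omega> = i} \<omega> * Y (grid n i) \<omega>)"
proof -
  have "(\<Sum>i\<le>Suc n. indicator {\<omega> \<in> space M. grid_index n \<omega> = i} \<omega> * Y (grid n i) \<omega>)
    = (\<Sum>i\<in>{grid_index n \<omega>}. indicator {\<omega> \<in> space M. grid_index n \<omega> = i} \<omega> * Y (grid n i) \<omega>)"
    using grid_bounds(1)[OF assms, of n] by (intro sum.mono_neutral_right) (auto simp: indicator_def)
  then show ?thesis using assms by simp
qed

lemma grid_process_measurable:
  assumes "adapted_process F Y"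
  shows "(\<lambda>\<omega>. Y (grid n (grid_index n \<omega>)) \<omega>) \<in> borel_measurable M"
proof (subst measurable_cong)
  show "Y (grid n (grid_index n \<omega>)) \<omega> =
    (\<Sum>i\<le>Suc n. indicator {\<omega> \<in> space M. grid_index n \<omega> = i} \<omega> * Y (grid n i) \<omega>)" if "\<omega> \<in> space M" for \<omega>
    using grid_sum[OF that] .
  show "(\<lambda>\<omega>. \<Sum>i\<le>Suc n. indicator {\<omega> \<in> space M. grid_index n \<omega> = i} \<omega> * Y (grid n i) \<omega>) \<in> borel_measurable M"
    using sets_F_subset[OF grid_nonneg grid_index_sets] adapted_measurable[OF assms grid_nonneg]
    by (intro borel_measurable_sum borel_measurable_times borel_measurable_indicator)
qed

lemma process_at_stopping_time_measurable:
  assumes "adapted_process F Y" and rc: "\<And>\<omega>. \<omega> \<in> space M \<Longrightarrow> right_continuous_path (\<lambda>t. Y t \<omega>)"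
  shows "(\<lambda>\<omega>. Y (\<theta> \<omega>) \<omega>) \<in> borel_measurable M"
proof (rule borel_measurable_LIMSEQ_metric)
  show "(\<lambda>n. Y (grid n (grid_index n \<omega>)) \<omega>) \<longlonglongrightarrow> Y (\<theta> \<omega>) \<omega>" if "\<omega> \<in> space M" for \<omega>
    using that \<theta>_bounds grid_bounds grid_LIMSEQ rc by (intro right_continuous_path_LIMSEQ[of "\<lambda>t. Y t \<omega>"]) auto
qed (rule grid_process_measurable[OF assms(1)])

text \<open>The event that the index is \<open>i\<close> and \<open>L (grid n i)\<close> lies in
  \<open>D\<close> belongs to \<open>F (grid n i)\<close>, so on it \<open>L (grid n i)\<close> may
  be replaced by \<open>L T\<close> under the integral. The set \<open>D\<close> makes it possible
  to discard very negative values before a limit is taken.\<close>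

lemma martingale_grid:
  assumes L: "martingale M F L" and D: "D \<in> sets borel"
  defines "Z \<equiv> \<lambda>n \<omega>. L (grid n (grid_index n \<omega>)) \<omega>"
  shows "integrable M (Z n)"
    and "(\<integral>\<omega>. indicator D (Z n \<omega>) * Z n \<omega> \<partial>M) = (\<integral>\<omega>. indicator D (Z n \<omega>) * L T \<omega> \<partial>M)"
proof -
  have ad: "adapted_process F L" using L by (simp add: martingale_def)
  have int: "integrable M (L t)" if "0 \<le> t" for t
    using L that by (simp add: martingale_def)
  let ?E = "\<lambda>i. {\<omega> \<in> space M. grid_index n \<omega> = i}"
  let ?D = "\<lambda>i. {\<omega> \<in> space M. grid_index n \<omega> = i \<and> L (grid n i) \<omega> \<in> D}"
  have Dset: "?D i \<in> sets (F (grid n i))" for i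
  proof -
    have "L (grid n i) -` D \<inter> space (F (grid n i)) \<in> sets (F (grid n i))"
      using ad D grid_nonneg by (intro measurable_sets[where A = borel]) (auto simp: adapted_process_def)
    then have "?E i \<inter> (L (grid n i) -` D \<inter> space (F (grid n i))) \<in> sets (F (grid n i))"
      using grid_index_sets by blast
    also have "?E i \<inter> (L (grid n i) -` D \<inter> space (F (grid n i))) = ?D i"
      using space_F[OF grid_nonneg] by auto
    finally show ?thesis .
  qed
  have Esum: "Z n \<omega> = (\<Sum>i\<le>Suc n. indicator (?E i) \<omega> * L (grid n i) \<omega>)" if "\<omega> \<in> space M" for \<omega>
    unfolding Z_def using grid_sum[OF that, of L n] .
  have "integrable M (\<lambda>\<omega>. \<Sum>i\<le>Suc n. indicator (?E i) \<omega> * L (grid n i) \<omega>)"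
    using sets_F_subset[OF grid_nonneg grid_index_sets]
    by (intro Bochner_Integration.integrable_sum integrable_mult_indicator[where 'b = real, unfolded real_scaleR_def] int grid_nonneg)
  then show "integrable M (Z n)"
    by (rule Bochner_Integration.integrable_cong[THEN iffD1, OF refl, rotated]) (simp add: Esum)
  have iD: "integrable M (\<lambda>\<omega>. indicator (?D i) \<omega> * L t \<omega>)" if "0 \<le> t" for i t
    using sets_F_subset[OF grid_nonneg Dset]
    by (intro integrable_mult_indicator[where 'b = real, unfolded real_scaleR_def] int that)
  have "(\<integral>\<omega>. indicator D (Z n \<omega>) * Z n \<omega> \<partial>M) = (\<integral>\<omega>. (\<Sum>i\<le>Suc n. indicator (?D i) \<omega> * L (grid n i) \<omega>) \<partial>M)"
  proof (rule Bochner_Integration.integral_cong[OF refl])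
    fix \<omega> assume \<omega>: "\<omega> \<in> space M"
    have "indicator D (Z n \<omega>) * Z n \<omega> = (\<lambda>t \<omega>. indicator D (L t \<omega>) * L t \<omega>) (grid n (grid_index n \<omega>)) \<omega>"
      by (simp add: Z_def)
    also have "\<dots> = (\<Sum>i\<le>Suc n. indicator (?E i) \<omega> * (indicator D (L (grid n i) \<omega>) * L (grid n i) \<omega>))"
      by (subst grid_sum[OF \<omega>]) simp
    also have "\<dots> = (\<Sum>i\<le>Suc n. indicator (?D i) \<omega> * L (grid n i) \<omega>)"
      by (intro sum.cong refl) (auto simp: indicator_def)
    finally show "indicator D (Z n \<omega>) * Z n \<omega> = (\<Sum>i\<le>Suc n. indicator (?D i) \<omega> * L (grid n i) \<omega>)" .
  qed
  also have "\<dots> = (\<Sum>i\<le>Suc n. \<integral>\<omega>. indicator (?D i) \<omega> * L (grid n i) \<omega> \<partial>M)"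
    by (intro Bochner_Integration.integral_sum iD grid_nonneg)
  also have "\<dots> = (\<Sum>i\<le>Suc n. \<integral>\<omega>. indicator (?D i) \<omega> * L T \<omega> \<partial>M)"
    using martingale_set_integral[OF L grid_nonneg grid_le Dset]
    by (intro sum.cong refl) auto
  also have "\<dots> = (\<integral>\<omega>. (\<Sum>i\<le>Suc n. indicator (?D i) \<omega> * L T \<omega>) \<partial>M)"
    using T by (intro Bochner_Integration.integral_sum[symmetric] iD) auto
  also have "\<dots> = (\<integral>\<omega>. indicator D (Z n \<omega>) * L T \<omega> \<partial>M)"
  proof (rule Bochner_Integration.integral_cong[OF refl])
    fix \<omega> assume \<omega>: "\<omega> \<in> space M"
    have "indicator D (Z n \<omega>) * L T \<omega> = (\<lambda>t \<omega>. indicator D (L t \<omega>) * L T \<omega>) (grid n (grid_index n \<omega>)) \<omega>"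
      by (simp add: Z_def)
    also have "\<dots> = (\<Sum>i\<le>Suc n. indicator (?E i) \<omega> * (indicator D (L (grid n i) \<omega>) * L T \<omega>))"
      by (subst grid_sum[OF \<omega>]) simp
    also have "\<dots> = (\<Sum>i\<le>Suc n. indicator (?D i) \<omega> * L T \<omega>)"
      by (intro sum.cong refl) (auto simp: indicator_def)
    finally show "(\<Sum>i\<le>Suc n. indicator (?D i) \<omega> * L T \<omega>) = indicator D (Z n \<omega>) * L T \<omega>" by simp
  qed
  finally show "(\<integral>\<omega>. indicator D (Z n \<omega>) * Z n \<omega> \<partial>M) = (\<integral>\<omega>. indicator D (Z n \<omega>) * L T \<omega> \<partial>M)" .
qed

end

end

text \<open>Before \<open>\<tau>\<close> the stopped path coincides with \<open>N\<close> on a right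
  neighbourhood; from \<open>\<tau>\<close> on it is constant.\<close>

lemma right_continuous_path_stopped:
  assumes rc: "right_continuous_path (\<lambda>t. N t \<omega>)"
  shows "right_continuous_path (\<lambda>t. stopped_process N \<tau> t \<omega>)"
  unfolding right_continuous_path_def
proof (intro allI impI)
  fix t :: real assume t: "0 \<le> t"
  have N: "((\<lambda>t. N t \<omega>) \<longlongrightarrow> N t \<omega>) (at_right t)"
    using rc t by (simp add: right_continuous_path_def continuous_within)
  show "continuous (at_right t) (\<lambda>t. stopped_process N \<tau> t \<omega>)"
  proof (cases "ennreal t < \<tau> \<omega>")
    case True
    obtain r where r: "t < r" "ennreal r \<le> \<tau> \<omega>"
    proof (cases "\<tau> \<omega>")
      case (real r)
      then show ?thesis using True t that[of r] by (simp add: ennreal_less_iff)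
    next
      case top
      then show ?thesis using that[of "t + 1"] by simp
    qed
    have eq: "stopped_process N \<tau> s \<omega> = N s \<omega>" if "t \<le> s" "s < r" for s
    proof -
      have "ennreal s \<le> \<tau> \<omega>"
        using that r by (meson ennreal_leI less_imp_le order_trans)
      then show ?thesis using that t by (simp add: stopped_process_def min_absorb1)
    qed
    have "\<forall>\<^sub>F s in at_right t. N s \<omega> = stopped_process N \<tau> s \<omega>"
      using r eq by (auto simp: eventually_at_right_field intro!: exI[of _ r])
    then have "((\<lambda>t. stopped_process N \<tau> t \<omega>) \<longlongrightarrow> N t \<omega>) (at_right t)"
      by (rule Lim_transform_eventually[OF N])
    then show ?thesis using eq[of t] r by (simp add: continuous_within)
  next
    case False
    have eq: "stopped_process N \<tau> s \<omega> = stopped_process N \<tau> t \<omega>" if "t \<le> s" for s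
    proof -
      have t: "\<tau> \<omega> \<le> ennreal t" using False by (simp add: not_less)
      also have "\<dots> \<le> ennreal s" using that by (rule ennreal_leI)
      finally show ?thesis unfolding stopped_process_def by (simp only: min_absorb2[OF t] min_absorb2)
    qed
    have "\<forall>\<^sub>F s in at_right t. stopped_process N \<tau> t \<omega> = stopped_process N \<tau> s \<omega>"
      by (rule eventually_mono[OF eventually_at_right_less eq[symmetric]]) (rule less_imp_le)
    then show ?thesis
      unfolding continuous_within by (rule Lim_transform_eventually[OF tendsto_const])
  qed
qed

context usual_filtered_prob_space
begin

text \<open>The lower bound is known at \<open>\<theta>\<close> only and not at the grid times after
  it, so Fatou's lemma cannot be applied to the approximations directly. Values below
  \<open>- (c + 1)\<close> are cut off; the extra 1 is a margin, so that along almost every path the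
  cut is eventually inactive.\<close>

lemma optional_stopping_martingale:
  assumes \<theta>: "real_stopping_time \<theta>" and \<theta>_bounds: "\<And>\<omega>. \<omega> \<in> space M \<Longrightarrow> 0 \<le> \<theta> \<omega> \<and> \<theta> \<omega> \<le> T"
    and T: "0 < T"
    and L: "martingale M F L" and rc: "\<And>\<omega>. \<omega> \<in> space M \<Longrightarrow> right_continuous_path (\<lambda>t. L t \<omega>)"
    and L0: "\<And>\<omega>. \<omega> \<in> space M \<Longrightarrow> L 0 \<omega> = 0"
    and lower: "AE \<omega> in M. - c \<le> L (\<theta> \<omega>) \<omega>"
  shows "(\<integral>\<^sup>+ \<omega>. ennreal (L (\<theta> \<omega>) \<omega> + c + 1) \<partial>M) \<le> ennreal (c + 1)"
proof -
  note ctx = \<theta> \<theta>_bounds T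
  define D where "D = {- (c + 1)<..}"
  have D: "D \<in> sets borel" by (simp add: D_def)
  define Z where "Z n \<omega> = L (grid T n (grid_index \<theta> T n \<omega>)) \<omega>" for n \<omega>
  have ad: "adapted_process F L" and int: "integrable M (L T)"
    using L T by (auto simp: martingale_def)
  have Z_meas [measurable]: "Z n \<in> borel_measurable M" for n
    unfolding Z_def[abs_def] by (rule grid_process_measurable[OF ctx ad])
  have Z_int: "integrable M (Z n)" for n
    using martingale_grid(1)[OF ctx L D, of n] by (simp add: Z_def[abs_def])
  have Z_eq: "(\<integral>\<omega>. indicator D (Z n \<omega>) * Z n \<omega> \<partial>M) = (\<integral>\<omega>. indicator D (Z n \<omega>) * L T \<omega> \<partial>M)" for n
    using martingale_grid(2)[OF ctx L D, of n] by (simp add: Z_def)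
  have Z_lim: "(\<lambda>n. Z n \<omega>) \<longlonglongrightarrow> L (\<theta> \<omega>) \<omega>" if "\<omega> \<in> space M" for \<omega>
    unfolding Z_def
    using that \<theta>_bounds grid_bounds[OF ctx] grid_LIMSEQ[OF ctx] rc
    by (intro right_continuous_path_LIMSEQ[of "\<lambda>t. L t \<omega>"]) auto
  have [measurable]: "L T \<in> borel_measurable M" using int by auto
  have [measurable]: "D \<in> sets borel" by (rule D)
  have ind_int: "integrable M (\<lambda>\<omega>. indicator D (Z n \<omega>) * f \<omega>)" if "integrable M f" for n and f :: "'a \<Rightarrow> real"
    by (rule Bochner_Integration.integrable_bound[OF that]) (use that in \<open>auto simp: indicator_def\<close>)
  have ind_lim: "AE \<omega> in M. (\<lambda>n. indicator D (Z n \<omega>) :: real) \<longlonglongrightarrow> 1"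
    using lower AE_space
  proof eventually_elim
    case (elim \<omega>)
    have "\<forall>\<^sub>F n in sequentially. - (c + 1) < Z n \<omega>"
      using order_tendstoD(1)[OF Z_lim[OF elim(2)], of "- (c + 1)"] elim(1) by auto
    then have "\<forall>\<^sub>F n in sequentially. 1 = (indicator D (Z n \<omega>) :: real)"
      by eventually_elim (simp add: D_def)
    then show ?case by (rule Lim_transform_eventually[OF tendsto_const])
  qed
  define g where "g n \<omega> = indicator D (Z n \<omega>) * (Z n \<omega> + c + 1)" for n \<omega>
  have g_nonneg: "0 \<le> g n \<omega>" for n \<omega>
    by (auto simp: g_def D_def indicator_def)
  have "(\<integral>\<^sup>+ \<omega>. ennreal (L (\<theta> \<omega>) \<omega> + c + 1) \<partial>M) = (\<integral>\<^sup>+ \<omega>. liminf (\<lambda>n. ennreal (g n \<omega>)) \<partial>M)"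
  proof (rule nn_integral_cong_AE)
    show "AE \<omega> in M. ennreal (L (\<theta> \<omega>) \<omega> + c + 1) = liminf (\<lambda>n. ennreal (g n \<omega>))"
      using ind_lim AE_space
    proof eventually_elim
      case (elim \<omega>)
      have "(\<lambda>n. g n \<omega>) \<longlonglongrightarrow> 1 * (L (\<theta> \<omega>) \<omega> + c + 1)"
        unfolding g_def using elim by (intro tendsto_intros Z_lim)
      then have "(\<lambda>n. ennreal (g n \<omega>)) \<longlonglongrightarrow> ennreal (L (\<theta> \<omega>) \<omega> + c + 1)"
        by (intro tendsto_ennrealI) simp
      then show ?case by (simp add: lim_imp_Liminf)
    qed
  qed
  also have "\<dots> \<le> liminf (\<lambda>n. \<integral>\<^sup>+ \<omega>. ennreal (g n \<omega>) \<partial>M)"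
    unfolding g_def by (intro nn_integral_liminf) measurable
  also have "(\<lambda>n. \<integral>\<^sup>+ \<omega>. ennreal (g n \<omega>) \<partial>M) = (\<lambda>n. ennreal (\<integral>\<omega>. indicator D (Z n \<omega>) * (L T \<omega> + (c + 1)) \<partial>M))"
  proof
    fix n
    have gi: "integrable M (g n)"
      unfolding g_def[abs_def] by (rule ind_int) (use Z_int in auto)
    have "(\<integral>\<omega>. g n \<omega> \<partial>M) = (\<integral>\<omega>. indicator D (Z n \<omega>) * Z n \<omega> + indicator D (Z n \<omega>) * (c + 1) \<partial>M)"
      by (simp add: g_def algebra_simps)
    also have "\<dots> = (\<integral>\<omega>. indicator D (Z n \<omega>) * L T \<omega> \<partial>M) + (\<integral>\<omega>. indicator D (Z n \<omega>) * (c + 1) \<partial>M)"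
      unfolding Z_eq[symmetric] by (intro Bochner_Integration.integral_add ind_int Z_int) auto
    also have "\<dots> = (\<integral>\<omega>. indicator D (Z n \<omega>) * L T \<omega> + indicator D (Z n \<omega>) * (c + 1) \<partial>M)"
      by (intro Bochner_Integration.integral_add[symmetric] ind_int int) auto
    finally show "(\<integral>\<^sup>+ \<omega>. ennreal (g n \<omega>) \<partial>M) = ennreal (\<integral>\<omega>. indicator D (Z n \<omega>) * (L T \<omega> + (c + 1)) \<partial>M)"
      using gi g_nonneg by (simp add: nn_integral_eq_integral distrib_left)
  qed
  \<comment> \<open>The indicators now multiply the fixed variable \<open>L T\<close> instead of the
    approximations, so an integrable dominating function exists.\<close>
  also have "liminf \<dots> = ennreal (\<integral>\<omega>. L T \<omega> + (c + 1) \<partial>M)"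
  proof (rule lim_imp_Liminf)
    have "(\<lambda>n. \<integral>\<omega>. indicator D (Z n \<omega>) * (L T \<omega> + (c + 1)) \<partial>M) \<longlonglongrightarrow> (\<integral>\<omega>. L T \<omega> + (c + 1) \<partial>M)"
    proof (rule integral_dominated_convergence[where w = "\<lambda>\<omega>. \<bar>L T \<omega>\<bar> + \<bar>c + 1\<bar>"])
      show "AE \<omega> in M. (\<lambda>n. indicator D (Z n \<omega>) * (L T \<omega> + (c + 1))) \<longlonglongrightarrow> L T \<omega> + (c + 1)"
        using ind_lim
      proof eventually_elim
        case (elim \<omega>)
        from tendsto_mult[OF elim tendsto_const[of "L T \<omega> + (c + 1)"]] show ?case by simp
      qed
    qed (use int in \<open>auto simp: indicator_def\<close>)
    then show "(\<lambda>n. ennreal (\<integral>\<omega>. indicator D (Z n \<omega>) * (L T \<omega> + (c + 1)) \<partial>M)) \<longlonglongrightarrow>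
        ennreal (\<integral>\<omega>. L T \<omega> + (c + 1) \<partial>M)"
      by (rule tendsto_ennrealI)
  qed simp
  also have "(\<integral>\<omega>. L T \<omega> + (c + 1) \<partial>M) = (\<integral>\<omega>. L T \<omega> \<partial>M) + (c + 1)"
    using int prob_space by simp
  also have "(\<integral>\<omega>. L T \<omega> \<partial>M) = (\<integral>\<omega>. indicator (space M) \<omega> * L T \<omega> \<partial>M)"
    by (intro Bochner_Integration.integral_cong) auto
  also have "\<dots> = (\<integral>\<omega>. indicator (space M) \<omega> * L 0 \<omega> \<partial>M)"
    using T sets.top[of "F 0"] space_F[of 0] by (intro martingale_set_integral[OF L]) auto
  also have "\<dots> = (\<integral>\<omega>. 0 \<partial>M)"
    by (intro Bochner_Integration.integral_cong) (auto simp: L0)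
  finally show ?thesis by simp
qed

text \<open>A second use of Fatou's lemma, along the localizing sequence. The stopped process at
  \<open>\<theta>\<close> is \<open>N\<close> at some time between 0 and \<open>\<theta>\<close>,
  which is why the lower bound is required on the whole path up to \<open>\<theta>\<close>.\<close>

lemma optional_stopping_local_martingale:
  assumes \<theta>: "real_stopping_time \<theta>" and \<theta>_bounds: "\<And>\<omega>. \<omega> \<in> space M \<Longrightarrow> 0 \<le> \<theta> \<omega> \<and> \<theta> \<omega> \<le> T"
    and T: "0 < T"
    and N: "local_martingale M F N" and rc: "\<And>\<omega>. \<omega> \<in> space M \<Longrightarrow> right_continuous_path (\<lambda>t. N t \<omega>)"
    and N0: "\<And>\<omega>. \<omega> \<in> space M \<Longrightarrow> N 0 \<omega> = 0"
    and lower: "AE \<omega> in M. \<forall>s. 0 \<le> s \<and> s \<le> \<theta> \<omega> \<longrightarrow> - c \<le> N s \<omega>"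
  shows "(\<integral>\<^sup>+ \<omega>. ennreal (N (\<theta> \<omega>) \<omega> + c + 1) \<partial>M) \<le> ennreal (c + 1)"
proof -
  note ctx = \<theta> \<theta>_bounds T
  obtain \<tau> where \<tau>_lim: "AE \<omega> in M. incseq (\<lambda>n. \<tau> n \<omega>) \<and> (\<lambda>n. \<tau> n \<omega>) \<longlonglongrightarrow> (\<infinity> :: ennreal)"
    and mart: "\<And>n. martingale M F (stopped_process N (\<tau> n))"
    using N by (auto simp: local_martingale_def)
  let ?L = "\<lambda>n. stopped_process N (\<tau> n)"
  have meas: "(\<lambda>\<omega>. ?L n (\<theta> \<omega>) \<omega>) \<in> borel_measurable M" for n
    using mart[of n] right_continuous_path_stopped[OF rc]
    by (intro process_at_stopping_time_measurable[OF ctx]) (auto simp: martingale_def)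
  have le: "(\<integral>\<^sup>+ \<omega>. ennreal (?L n (\<theta> \<omega>) \<omega> + c + 1) \<partial>M) \<le> ennreal (c + 1)" for n
  proof (rule optional_stopping_martingale[OF ctx mart])
    show "right_continuous_path (\<lambda>t. ?L n t \<omega>)" if "\<omega> \<in> space M" for \<omega>
      by (intro right_continuous_path_stopped rc that)
    show "?L n 0 \<omega> = 0" if "\<omega> \<in> space M" for \<omega>
      using N0[OF that] by (simp add: stopped_process_def)
    show "AE \<omega> in M. - c \<le> ?L n (\<theta> \<omega>) \<omega>"
      using lower AE_space
    proof eventually_elim
      case (elim \<omega>)
      have "enn2real (min (ennreal (\<theta> \<omega>)) (\<tau> n \<omega>)) \<le> enn2real (ennreal (\<theta> \<omega>))"
        by (intro enn2real_mono) auto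
      then show ?case using elim \<theta>_bounds by (simp add: stopped_process_def)
    qed
  qed
  have "(\<integral>\<^sup>+ \<omega>. ennreal (N (\<theta> \<omega>) \<omega> + c + 1) \<partial>M) = (\<integral>\<^sup>+ \<omega>. liminf (\<lambda>n. ennreal (?L n (\<theta> \<omega>) \<omega> + c + 1)) \<partial>M)"
  proof (rule nn_integral_cong_AE)
    show "AE \<omega> in M. ennreal (N (\<theta> \<omega>) \<omega> + c + 1) = liminf (\<lambda>n. ennreal (?L n (\<theta> \<omega>) \<omega> + c + 1))"
      using \<tau>_lim AE_space
    proof eventually_elim
      case (elim \<omega>)
      have "\<forall>\<^sub>F n in sequentially. ennreal (\<theta> \<omega>) < \<tau> n \<omega>"
        using elim by (intro order_tendstoD(1)[of _ \<infinity>]) auto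
      then have "\<forall>\<^sub>F n in sequentially. ennreal (N (\<theta> \<omega>) \<omega> + c + 1) = ennreal (?L n (\<theta> \<omega>) \<omega> + c + 1)"
        by eventually_elim (use \<theta>_bounds elim in \<open>simp add: stopped_process_def min_absorb1 less_imp_le\<close>)
      then have "(\<lambda>n. ennreal (?L n (\<theta> \<omega>) \<omega> + c + 1)) \<longlonglongrightarrow> ennreal (N (\<theta> \<omega>) \<omega> + c + 1)"
        by (rule Lim_transform_eventually[OF tendsto_const])
      then show ?case by (simp add: lim_imp_Liminf)
    qed
  qed
  also have "\<dots> \<le> liminf (\<lambda>n. \<integral>\<^sup>+ \<omega>. ennreal (?L n (\<theta> \<omega>) \<omega> + c + 1) \<partial>M)"
    using meas by (intro nn_integral_liminf) simp
  also have "\<dots> \<le> ennreal (c + 1)"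
    using le by (intro Liminf_le) auto
  finally show ?thesis .
qed

end

section \<open>Announcing a level crossing of a predictable process\<close>

context usual_filtered_prob_space
begin

text \<open>Right continuity of the filtration enters here: \<open>{\<theta> \<le> t}\<close> lies
  in \<open>F s\<close> for every \<open>s > t\<close>, being a countable intersection of events
  \<open>{\<theta> < r}\<close> with \<open>t < r \<le> s\<close>.\<close>

lemma real_stopping_time_lessI:
  assumes less: "\<And>t. 0 < t \<Longrightarrow> {\<omega> \<in> space M. \<theta> \<omega> < t} \<in> sets (F t)"
  shows "real_stopping_time \<theta>"
  unfolding real_stopping_time_def
proof (intro allI impI)
  fix t :: real assume t: "0 \<le> t"
  have "{\<omega> \<in> space M. \<theta> \<omega> \<le> t} \<in> sets (F s)" if s: "t < s" for s
  proof -
    have pos: "0 < (s - t) / real (Suc n)" for n using s by simp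
    have "\<exists>n. x \<ge> t + (s - t) / real (Suc n)" if "t < x" for x
    proof -
      have "(\<lambda>n. t + (s - t) / real (Suc n)) \<longlonglongrightarrow> t + 0"
        by (intro tendsto_intros LIMSEQ_Suc[OF lim_const_over_n])
      then have "\<forall>\<^sub>F n in sequentially. t + (s - t) / real (Suc n) < x"
        using that by (intro order_tendstoD) auto
      then show ?thesis by (auto simp: eventually_sequentially intro: less_imp_le)
    qed
    then have "{\<omega> \<in> space M. \<theta> \<omega> \<le> t} = (\<Inter>n. {\<omega> \<in> space M. \<theta> \<omega> < t + (s - t) / real (Suc n)})"
      using pos by (auto simp: not_less[symmetric] intro: le_less_trans) (meson less_add_same_cancel1 le_less_trans not_less)
    also have "\<dots> \<in> sets (F s)"
    proof (intro sets.countable_INT image_subsetI)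
      fix n
      have le: "t + (s - t) / real (Suc n) \<le> s"
      proof -
        have "(s - t) / real (Suc n) \<le> (s - t) / 1" using s by (intro divide_left_mono) auto
        then show ?thesis by simp
      qed
      have "{\<omega> \<in> space M. \<theta> \<omega> < t + (s - t) / real (Suc n)} \<in> sets (F (t + (s - t) / real (Suc n)))"
        using t pos[of n] by (intro less) linarith
      also have "\<dots> \<subseteq> sets (F s)" using t pos[of n] le by (intro F_mono) linarith+
      finally show "{\<omega> \<in> space M. \<theta> \<omega> < t + (s - t) / real (Suc n)} \<in> sets (F s)" .
    qed simp
    finally show ?thesis .
  qed
  then show "{\<omega> \<in> space M. \<theta> \<omega> \<le> t} \<in> sets (F t)"
    using F_right_continuous[OF t] by auto
qed

section \<open>Predictable sets\<close>

definition pred_gen :: "(real \<times> 'a) set set" where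
  "pred_gen = {{0} \<times> B | B. B \<in> sets (F 0)} \<union>
      {{s<..t} \<times> B | s t B. 0 \<le> s \<and> s \<le> t \<and> B \<in> sets (F s)}"

lemma sets_predictable: "sets (predictable_sigma M F) = sigma_sets ({0..} \<times> space M) pred_gen"
  unfolding predictable_sigma_def pred_gen_def
proof (rule sets_measure_of)
  have "B \<subseteq> space M" if "B \<in> sets (F s)" "0 \<le> s" for B s
    using sets.sets_into_space[OF that(1)] space_F[OF that(2)] by simp
  then show "{{0} \<times> B | B. B \<in> sets (F 0)} \<union>
      {{s<..t} \<times> B | s t B. 0 \<le> s \<and> s \<le> t \<and> B \<in> sets (F s)} \<subseteq> Pow ({0..} \<times> space M)"
    by fastforce
qed

lemma space_predictable: "space (predictable_sigma M F) = {0..} \<times> space M"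
  by (simp add: predictable_sigma_def space_measure_of_conv)

lemma predictable_rect: "0 \<le> s \<Longrightarrow> B \<in> sets (F s) \<Longrightarrow> {s<..t} \<times> B \<in> sets (predictable_sigma M F)"
proof (cases "s \<le> t")
  case True
  assume "0 \<le> s" "B \<in> sets (F s)"
  with True show ?thesis
    unfolding sets_predictable by (intro sigma_sets.Basic) (auto simp: pred_gen_def)
qed simp

lemma predictable_rect0: "B \<in> sets (F 0) \<Longrightarrow> {0} \<times> B \<in> sets (predictable_sigma M F)"
  unfolding sets_predictable by (intro sigma_sets.Basic) (auto simp: pred_gen_def)

text \<open>This yields that predictable processes are adapted. For a generator
  \<open>{s<..u} \<times> B\<close> the section is empty or \<open>B\<close>, and in the latter case
  \<open>s < t\<close>, so \<open>B\<close> is known at time \<open>t\<close>.\<close>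

lemma predictable_section:
  assumes K: "K \<in> sets (predictable_sigma M F)" and t: "0 \<le> t"
  shows "{\<omega> \<in> space M. (t, \<omega>) \<in> K} \<in> sets (F t)"
  using K unfolding sets_predictable
proof (induction rule: sigma_sets.induct)
  case (Basic K)
  then consider (zero) B where "K = {0} \<times> B" "B \<in> sets (F 0)"
    | (pos) s u B where "K = {s<..u} \<times> B" "0 \<le> s" "B \<in> sets (F s)"
    by (auto simp: pred_gen_def)
  then show ?case
  proof cases
    case zero
    then have "{\<omega> \<in> space M. (t, \<omega>) \<in> K} = (if t = 0 then B else {})"
      using sets.sets_into_space[of B "F 0"] space_F[of 0] by auto
    then show ?thesis using zero by auto
  next
    case pos
    have "{\<omega> \<in> space M. (t, \<omega>) \<in> K} = (if s < t \<and> t \<le> u then B else {})"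
      using pos sets.sets_into_space[of B "F s"] space_F[of s] by auto
    then show ?thesis using pos F_mono[of s t] by auto
  qed
next
  case (Compl K)
  have "{\<omega> \<in> space M. (t, \<omega>) \<in> {0..} \<times> space M - K} = space (F t) - {\<omega> \<in> space M. (t, \<omega>) \<in> K}"
    using t space_F[OF t] by auto
  then show ?case using Compl by auto
next
  case (Union K)
  have "{\<omega> \<in> space M. (t, \<omega>) \<in> (\<Union>i. K i)} = (\<Union>i. {\<omega> \<in> space M. (t, \<omega>) \<in> K i})"
    by auto
  then show ?case using Union by auto
qed simp

lemma predictable_adapted: "predictable_process M F H \<Longrightarrow> adapted_process F H"
  unfolding adapted_process_def
proof (intro allI impI)
  fix t :: real assume H: "predictable_process M F H" and t: "0 \<le> t"
  show "H t \<in> borel_measurable (F t)"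
  proof (rule measurableI)
    fix D :: "real set" assume D: "D \<in> sets borel"
    have "(\<lambda>(t, \<omega>). H t \<omega>) -` D \<inter> space (predictable_sigma M F) \<in> sets (predictable_sigma M F)"
      using H D by (intro measurable_sets[where A = borel]) (auto simp: predictable_process_def)
    from predictable_section[OF this t]
    have "{\<omega> \<in> space M. (t, \<omega>) \<in> (\<lambda>(t, \<omega>). H t \<omega>) -` D \<inter> space (predictable_sigma M F)} \<in> sets (F t)" .
    also have "{\<omega> \<in> space M. (t, \<omega>) \<in> (\<lambda>(t, \<omega>). H t \<omega>) -` D \<inter> space (predictable_sigma M F)} = H t -` D \<inter> space (F t)"
      using t space_F[OF t] by (auto simp: space_predictable)
    finally show "H t -` D \<inter> space (F t) \<in> sets (F t)" .
  qed simp
qed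

text \<open>Finite unions of rectangles \<open>[s, t] \<times> B\<close> with \<open>B\<close> known strictly before \<open>s\<close>: these have
  compact sections, and their debuts can be announced.\<close>

definition foreseen :: "(real \<times> 'a) set \<Rightarrow> bool" where
  "foreseen K \<longleftrightarrow> (\<exists>R. finite R \<and> K = (\<Union>(s, t, B)\<in>R. {s..t} \<times> B) \<and>
     (\<forall>(s, t, B)\<in>R. \<exists>r. 0 \<le> r \<and> r < s \<and> B \<in> sets (F r)))"

lemma foreseen_rect: "0 \<le> r \<Longrightarrow> r < s \<Longrightarrow> B \<in> sets (F r) \<Longrightarrow> foreseen ({s..t} \<times> B)"
  unfolding foreseen_def by (intro exI[of _ "{(s, t, B)}"]) auto

lemma foreseen_empty: "foreseen {}"
  unfolding foreseen_def by (intro exI[of _ "{}"]) auto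

lemma foreseen_Un:
  assumes "foreseen K" "foreseen L"
  shows "foreseen (K \<union> L)"
proof -
  obtain R S where "finite R" "K = (\<Union>(s, t, B)\<in>R. {s..t} \<times> B)"
     "\<forall>(s, t, B)\<in>R. \<exists>r. 0 \<le> r \<and> r < s \<and> B \<in> sets (F r)"
     "finite S" "L = (\<Union>(s, t, B)\<in>S. {s..t} \<times> B)"
     "\<forall>(s, t, B)\<in>S. \<exists>r. 0 \<le> r \<and> r < s \<and> B \<in> sets (F r)"
    using assms by (auto simp: foreseen_def)
  then show ?thesis
    unfolding foreseen_def by (intro exI[of _ "R \<union> S"] conjI finite_UnI) (simp_all only: UN_Un ball_Un simp_thms)
qed

lemma foreseen_UN: "finite I \<Longrightarrow> (\<And>i. i \<in> I \<Longrightarrow> foreseen (K i)) \<Longrightarrow> foreseen (\<Union>i\<in>I. K i)"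
  by (induction I rule: finite_induct) (auto intro: foreseen_empty foreseen_Un)

text \<open>Rectangles intersect in rectangles, and the later of the two times at which the bases
  are known is still strictly before the later left endpoint.\<close>

lemma foreseen_Int:
  assumes "foreseen K" "foreseen L"
  shows "foreseen (K \<inter> L)"
proof -
  obtain R S where R: "finite R" "K = (\<Union>(s, t, B)\<in>R. {s..t} \<times> B)"
     "\<forall>(s, t, B)\<in>R. \<exists>r. 0 \<le> r \<and> r < s \<and> B \<in> sets (F r)"
    and S: "finite S" "L = (\<Union>(s, t, B)\<in>S. {s..t} \<times> B)"
     "\<forall>(s, t, B)\<in>S. \<exists>r. 0 \<le> r \<and> r < s \<and> B \<in> sets (F r)"
    using assms by (auto simp: foreseen_def)
  have "K \<inter> L = (\<Union>((s, t, B), (s', t', B'))\<in>R \<times> S. {max s s'..min t t'} \<times> (B \<inter> B'))"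
  proof (rule set_eqI)
    fix x :: "real \<times> 'a"
    have K: "x \<in> K \<longleftrightarrow> (\<exists>i\<in>R. x \<in> {fst i..fst (snd i)} \<times> snd (snd i))"
      unfolding R by (simp add: case_prod_beta)
    have L: "x \<in> L \<longleftrightarrow> (\<exists>j\<in>S. x \<in> {fst j..fst (snd j)} \<times> snd (snd j))"
      unfolding S by (simp add: case_prod_beta)
    have "x \<in> (\<Union>((s, t, B), (s', t', B'))\<in>R \<times> S. {max s s'..min t t'} \<times> (B \<inter> B')) \<longleftrightarrow>
      (\<exists>i\<in>R. \<exists>j\<in>S. x \<in> {max (fst i) (fst j)..min (fst (snd i)) (fst (snd j))} \<times> (snd (snd i) \<inter> snd (snd j)))"
      by (simp add: case_prod_beta Bex_def)
    then show "x \<in> K \<inter> L \<longleftrightarrow> x \<in> (\<Union>((s, t, B), (s', t', B'))\<in>R \<times> S. {max s s'..min t t'} \<times> (B \<inter> B'))"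
      unfolding Int_iff K L by (cases x) auto
  qed
  moreover have "foreseen (\<Union>((s, t, B), (s', t', B'))\<in>R \<times> S. {max s s'..min t t'} \<times> (B \<inter> B'))"
  proof (rule foreseen_UN)
    fix i assume "i \<in> R \<times> S"
    then obtain s t B s' t' B' where i: "i = ((s, t, B), (s', t', B'))" "(s, t, B) \<in> R" "(s', t', B') \<in> S"
      by (cases i) auto
    obtain r r' where r: "0 \<le> r" "r < s" "B \<in> sets (F r)" "0 \<le> r'" "r' < s'" "B' \<in> sets (F r')"
      using i R S by fastforce
    have "foreseen ({max s s'..min t t'} \<times> (B \<inter> B'))"
    proof (rule foreseen_rect[of "max r r'"])
      show "B \<inter> B' \<in> sets (F (max r r'))"
        using r F_mono[of r "max r r'"] F_mono[of r' "max r r'"] by (intro sets.Int) auto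
    qed (use r in auto)
    then show "foreseen ((\<lambda>((s, t, B), (s', t', B')). {max s s'..min t t'} \<times> (B \<inter> B')) i)"
      using i by simp
  qed (use R S in auto)
  ultimately show ?thesis by simp
qed

lemma foreseen_INT: "foreseen (\<Inter>i\<le>n. K i)" if "\<And>i. i \<le> n \<Longrightarrow> foreseen (K i)" for n :: nat
  using that by (induction n) (auto simp: atMost_Suc intro!: foreseen_Int)

lemma foreseen_predictable:
  assumes "foreseen K"
  shows "K \<in> sets (predictable_sigma M F)"
proof -
  obtain R where R: "finite R" "K = (\<Union>(s, t, B)\<in>R. {s..t} \<times> B)"
     "\<forall>(s, t, B)\<in>R. \<exists>r. 0 \<le> r \<and> r < s \<and> B \<in> sets (F r)"
    using assms by (auto simp: foreseen_def)
  have "{s..t} \<times> B \<in> sets (predictable_sigma M F)" if i: "(s, t, B) \<in> R" for s t B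
  proof -
    obtain r where r: "0 \<le> r" "r < s" "B \<in> sets (F r)" using bspec[OF R(3) i] by auto
    \<comment> \<open>These times start at \<open>r\<close>, where \<open>B\<close> is known, and
      increase to \<open>s\<close>, so that the half-open generators shrink to the closed
      rectangle.\<close>
    define q where "q n = s - (s - r) / real (Suc n)" for n
    have q: "r \<le> q n" "q n < s" for n
    proof -
      have "(s - r) / real (Suc n) \<le> (s - r) / 1" using r by (intro divide_left_mono) auto
      then show "r \<le> q n" by (simp add: q_def)
      show "q n < s" using r by (simp add: q_def)
    qed
    have "q \<longlonglongrightarrow> s - 0"
      unfolding q_def[abs_def] by (intro tendsto_intros LIMSEQ_Suc[OF lim_const_over_n])
    then have lim: "s \<le> x" if "\<And>n. q n < x" for x
      using that by (intro LIMSEQ_le_const2[of q s x]) (auto intro: less_imp_le)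
    have "{s..t} \<times> B = (\<Inter>n. {q n<..t} \<times> B)"
      using lim by (auto intro: less_le_trans[OF q(2)])
    also have "\<dots> \<in> sets (predictable_sigma M F)"
      using r q F_mono[of r "q _"]
      by (intro sets.countable_INT) (auto intro!: predictable_rect intro: order_trans)
    finally show ?thesis .
  qed
  then show ?thesis unfolding R by (intro sets.finite_UN R(1)) auto
qed

lemma foreseen_compact_section:
  assumes "foreseen K"
  shows "compact {t. (t, \<omega>) \<in> K}"
proof -
  obtain R where R: "finite R" "K = (\<Union>(s, t, B)\<in>R. {s..t} \<times> B)"
    using assms by (auto simp: foreseen_def)
  have "{t. (t, \<omega>) \<in> K} = (\<Union>(s, t, B)\<in>R. if \<omega> \<in> B then {s..t} else {})"
    unfolding R by (auto split: if_splits) fastforce+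
  also have "compact \<dots>"
    using R(1) by (intro compact_UN) auto
  finally show ?thesis .
qed

text \<open>A rectangle is announced at the time \<open>r\<close> at which its base is known,
  strictly before its left endpoint; \<open>\<rho>\<close> is the earliest of these times among the
  rectangles met by the path, with \<open>T\<close> as default. By the last property
  \<open>\<rho>\<close> never fires before \<open>T\<close> on a path that \<open>K\<close> does not
  meet.\<close>

lemma foreseen_announce:
  assumes K: "foreseen K" and T: "0 < T"
  obtains \<rho> where "real_stopping_time \<rho>" "\<And>\<omega>. 0 \<le> \<rho> \<omega> \<and> \<rho> \<omega> \<le> T"
    "\<And>t \<omega>. (t, \<omega>) \<in> K \<Longrightarrow> \<rho> \<omega> < t"
    "\<And>\<omega>. \<rho> \<omega> < T \<Longrightarrow> \<exists>t. (t, \<omega>) \<in> K"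
proof -
  obtain R where R: "finite R" "K = (\<Union>(s, t, B)\<in>R. {s..t} \<times> B)"
     "\<forall>(s, t, B)\<in>R. \<exists>r. 0 \<le> r \<and> r < s \<and> B \<in> sets (F r)"
    using K by (auto simp: foreseen_def)
  have "\<forall>i\<in>R. \<exists>r. 0 \<le> r \<and> r < fst i \<and> snd (snd i) \<in> sets (F r)"
    using R(3) by (simp add: case_prod_beta)
  then obtain r where "\<And>i. i \<in> R \<Longrightarrow> 0 \<le> r i \<and> r i < fst i \<and> snd (snd i) \<in> sets (F (r i))"
    by metis
  then have r: "0 \<le> r (s, t, B) \<and> r (s, t, B) < s \<and> B \<in> sets (F (r (s, t, B)))" if "(s, t, B) \<in> R" for s t B
    using that by fastforce
  \<comment> \<open>Rectangles with an empty time interval are left out, since announcing them would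
    violate the last property.\<close>
  define R' where "R' \<omega> = {(s, t, B) \<in> R. s \<le> t \<and> \<omega> \<in> B}" for \<omega>
  have fin: "finite (R' \<omega>)" for \<omega> using R(1) by (rule rev_finite_subset) (auto simp: R'_def)
  define \<rho> where "\<rho> \<omega> = Min (insert T (r ` R' \<omega>))" for \<omega>
  have \<rho>_le: "\<rho> \<omega> \<le> c \<longleftrightarrow> T \<le> c \<or> (\<exists>i\<in>R' \<omega>. r i \<le> c)" for \<omega> c
    unfolding \<rho>_def using fin[of \<omega>] by (subst Min_le_iff) auto
  have \<rho>_less: "\<rho> \<omega> < c \<longleftrightarrow> T < c \<or> (\<exists>i\<in>R' \<omega>. r i < c)" for \<omega> c
    unfolding \<rho>_def using fin[of \<omega>] by (subst Min_less_iff) auto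
  show ?thesis
  proof
    show "real_stopping_time \<rho>"
      unfolding real_stopping_time_def
    proof (intro allI impI)
      fix c :: real assume c: "0 \<le> c"
      have "{\<omega> \<in> space M. \<rho> \<omega> \<le> c} =
          (if T \<le> c then space (F c) else (\<Union>(s, t, B)\<in>{(s, t, B)\<in>R. s \<le> t \<and> r (s, t, B) \<le> c}. B \<inter> space M))"
        using space_F[OF c] by (auto simp: \<rho>_le R'_def)
      also have "\<dots> \<in> sets (F c)"
      proof -
        have "(\<Union>(s, t, B)\<in>{(s, t, B)\<in>R. s \<le> t \<and> r (s, t, B) \<le> c}. B \<inter> space M) \<in> sets (F c)"
        proof (intro sets.finite_UN)
          show "finite {(s, t, B)\<in>R. s \<le> t \<and> r (s, t, B) \<le> c}"
            using R(1) by (rule rev_finite_subset) auto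
          fix i assume "i \<in> {(s, t, B)\<in>R. s \<le> t \<and> r (s, t, B) \<le> c}"
          then obtain s t B where i: "i = (s, t, B)" "(s, t, B) \<in> R" "r (s, t, B) \<le> c"
            by auto
          have "B \<inter> space M \<in> sets (F c)"
            using r[OF i(2)] i(3) F_mono[of "r (s, t, B)" c] sets.top[of "F c"] space_F[OF c]
            by (intro sets.Int) auto
          then show "(case i of (s, t, B) \<Rightarrow> B \<inter> space M) \<in> sets (F c)" using i by simp
        qed
        then show ?thesis by auto
      qed
      finally show "{\<omega> \<in> space M. \<rho> \<omega> \<le> c} \<in> sets (F c)" .
    qed
    show "0 \<le> \<rho> \<omega> \<and> \<rho> \<omega> \<le> T" for \<omega>
    proof
      show "\<rho> \<omega> \<le> T" by (simp add: \<rho>_le)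
      show "0 \<le> \<rho> \<omega>" using \<rho>_less[of \<omega> 0] r T by (fastforce simp: R'_def not_less[symmetric])
    qed
    show "\<rho> \<omega> < t" if tK: "(t, \<omega>) \<in> K" for t \<omega>
    proof -
      obtain s u B where i: "(s, u, B) \<in> R" "s \<le> t" "t \<le> u" "\<omega> \<in> B" using tK R(2) by auto
      then have "(s, u, B) \<in> R' \<omega>" by (auto simp: R'_def)
      moreover have "r (s, u, B) < t" using r[OF i(1)] i(2) by auto
      ultimately show ?thesis by (auto simp: \<rho>_less)
    qed
    show "\<exists>t. (t, \<omega>) \<in> K" if less: "\<rho> \<omega> < T" for \<omega>
    proof -
      obtain s u B where "(s, u, B) \<in> R" "s \<le> u" "\<omega> \<in> B" using less by (auto simp: \<rho>_less R'_def)
      then show ?thesis unfolding R(2) by (intro exI[of _ s] UN_I[of "(s, u, B)"]) auto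
    qed
  qed
qed

text \<open>These sets play the part of compact sets in an inner regularity argument. The
  approximating sequence decreases so that nested compact sections will have a common point.\<close>

definition foreseen_delta :: "(real \<times> 'a) set \<Rightarrow> bool" where
  "foreseen_delta K \<longleftrightarrow> (\<exists>Kn :: nat \<Rightarrow> _. (\<forall>n. foreseen (Kn n)) \<and> decseq Kn \<and> K = (\<Inter>n. Kn n))"

lemma foreseen_deltaI: "foreseen K \<Longrightarrow> foreseen_delta K"
  unfolding foreseen_delta_def by (intro exI[of _ "\<lambda>_. K"]) auto

lemma foreseen_delta_Un:
  assumes "foreseen_delta K" "foreseen_delta L"
  shows "foreseen_delta (K \<union> L)"
proof -
  obtain A B where A: "\<And>n. foreseen (A n)" "decseq A" "K = (\<Inter>n::nat. A n)"
    and B: "\<And>n. foreseen (B n)" "decseq B" "L = (\<Inter>n::nat. B n)"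
    using assms by (auto simp: foreseen_delta_def)
  have "x \<in> K \<union> L" if *: "\<And>n. x \<in> A n \<union> B n" for x
  proof (rule ccontr)
    assume "x \<notin> K \<union> L"
    then obtain a b where "x \<notin> A a" "x \<notin> B b" using A B by auto
    then show False
      using *[of "max a b"] decseqD[OF A(2), of a "max a b"] decseqD[OF B(2), of b "max a b"] by auto
  qed
  then have "K \<union> L = (\<Inter>n. A n \<union> B n)" using A(3) B(3) by (intro equalityI subsetI) blast+
  moreover have "decseq (\<lambda>n. A n \<union> B n)"
    using A(2) B(2) unfolding decseq_def by blast
  ultimately show ?thesis
    unfolding foreseen_delta_def
    by (intro exI[of _ "\<lambda>n. A n \<union> B n"] conjI allI foreseen_Un A(1) B(1))
qed

lemma foreseen_delta_UN: "foreseen_delta (\<Union>i\<le>n. K i)" if "\<And>i. foreseen_delta (K i)" for n :: nat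
  using that by (induction n) (auto simp: atMost_Suc intro!: foreseen_delta_Un)

lemma foreseen_delta_INT:
  fixes K :: "nat \<Rightarrow> _"
  assumes "\<And>i. foreseen_delta (K i)"
  shows "foreseen_delta (\<Inter>i. K i)"
proof -
  have "\<exists>A. (\<forall>n. foreseen (A n)) \<and> decseq A \<and> K i = (\<Inter>n::nat. A n)" for i
    using assms[of i] by (simp add: foreseen_delta_def)
  then obtain A where A: "\<And>i n. foreseen (A i n)" "\<And>i. decseq (A i)" "\<And>i. K i = (\<Inter>n::nat. A i n)"
    by metis
  \<comment> \<open>Diagonal choice: only finitely many families enter at each stage, so every
    member is foreseen, and the sequence still decreases.\<close>
  define E where "E n = (\<Inter>i\<le>n. A i n)" for n
  have "decseq E"
  proof (rule decseq_SucI)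
    fix n
    have "A i (Suc n) \<subseteq> A i n" for i using decseqD[OF A(2), of n "Suc n" i] by simp
    then show "E (Suc n) \<subseteq> E n" unfolding E_def by (auto simp: subset_iff)
  qed
  moreover have "(\<Inter>i. K i) = (\<Inter>n. E n)"
  proof (intro equalityI subsetI)
    fix x assume x: "x \<in> (\<Inter>n. E n)"
    have "x \<in> A i m" for i m
    proof -
      have "x \<in> A i (max i m)" using x by (auto simp: E_def)
      then show ?thesis using decseqD[OF A(2), of m "max i m" i] by auto
    qed
    then show "x \<in> (\<Inter>i. K i)" by (auto simp: A(3))
  qed (auto simp: E_def A(3))
  ultimately show ?thesis
    unfolding foreseen_delta_def using A(1)
    by (intro exI[of _ E]) (auto simp: E_def intro!: foreseen_INT)
qed

lemma foreseen_delta_predictable: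
  assumes "foreseen_delta K"
  shows "K \<in> sets (predictable_sigma M F)"
proof -
  obtain Kn :: "nat \<Rightarrow> _" where Kn: "\<And>n. foreseen (Kn n)" "K = (\<Inter>n. Kn n)"
    using assms by (auto simp: foreseen_delta_def)
  show ?thesis
    unfolding Kn(2) by (intro sets.countable_INT image_subsetI foreseen_predictable Kn(1)) simp
qed

lemma space_in_F: "0 \<le> t \<Longrightarrow> space M \<in> sets (F t)"
  using sets.top[of "F t"] space_F[of t] by simp

section \<open>Inner regularity with respect to the graph of a random time\<close>

definition hits :: "('a \<Rightarrow> real) \<Rightarrow> 'a set \<Rightarrow> (real \<times> 'a) set \<Rightarrow> 'a set" where
  "hits \<sigma> D K = {\<omega> \<in> D. (\<sigma> \<omega>, \<omega>) \<in> K}"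

text \<open>\<open>measure M (hits \<sigma> D K)\<close> is the measure carried by the graph of
  \<open>\<sigma>\<close> over \<open>D\<close>; the condition is inner regularity of
  \<open>K\<close> for this measure.\<close>

definition inner_approx :: "('a \<Rightarrow> real) \<Rightarrow> 'a set \<Rightarrow> (real \<times> 'a) set \<Rightarrow> bool" where
  "inner_approx \<sigma> D K \<longleftrightarrow> K \<in> sets (predictable_sigma M F) \<and>
     (\<forall>\<epsilon>>0. \<exists>C. foreseen_delta C \<and> C \<subseteq> K \<and> measure M (hits \<sigma> D K - hits \<sigma> D C) < \<epsilon>)"

context
  fixes \<sigma> :: "'a \<Rightarrow> real" and D :: "'a set"
  assumes D: "D \<in> sets M" and \<sigma>_pos: "\<And>\<omega>. \<omega> \<in> D \<Longrightarrow> 0 < \<sigma> \<omega>"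
    and \<sigma>_meas: "\<And>s t. 0 \<le> s \<Longrightarrow> s \<le> t \<Longrightarrow> {\<omega> \<in> D. s < \<sigma> \<omega> \<and> \<sigma> \<omega> \<le> t} \<in> sets M"
begin

lemma hits_sets:
  assumes "K \<in> sets (predictable_sigma M F)"
  shows "hits \<sigma> D K \<in> sets M"
  using assms unfolding sets_predictable
proof (induction rule: sigma_sets.induct)
  case (Basic K)
  then consider (zero) B where "K = {0} \<times> B"
    | (pos) s u B where "K = {s<..u} \<times> B" "0 \<le> s" "s \<le> u" "B \<in> sets (F s)"
    by (auto simp: pred_gen_def)
  then show ?case
  proof cases
    case zero
    then have "hits \<sigma> D K = {}" using \<sigma>_pos by (fastforce simp: hits_def)
    then show ?thesis by simp
  next
    case pos
    then have "hits \<sigma> D K = {\<omega> \<in> D. s < \<sigma> \<omega> \<and> \<sigma> \<omega> \<le> u} \<inter> B" by (auto simp: hits_def)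
    then show ?thesis using pos \<sigma>_meas[of s u] sets_F_subset[of s B] by auto
  qed
next
  case (Compl K)
  have "hits \<sigma> D ({0..} \<times> space M - K) = D - hits \<sigma> D K"
    using \<sigma>_pos sets.sets_into_space[OF D] by (fastforce simp: hits_def intro: less_imp_le)
  then show ?case using Compl D by auto
next
  case (Union K)
  have "hits \<sigma> D (\<Union>i. K i) = (\<Union>i. hits \<sigma> D (K i))" by (auto simp: hits_def)
  then show ?case using Union by auto
qed (simp add: hits_def)

lemma hits_delta: "foreseen_delta C \<Longrightarrow> hits \<sigma> D C \<in> sets M"
  by (intro hits_sets foreseen_delta_predictable)

lemma inner_approx_foreseen: "foreseen K \<Longrightarrow> inner_approx \<sigma> D K"
  unfolding inner_approx_def
  by (auto intro!: exI[of _ K] foreseen_deltaI foreseen_predictable)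

text \<open>Continuity from below reduces the union to finitely many sets, because the approximating
  sets are closed under finite unions only.\<close>

lemma inner_approx_UN:
  fixes K :: "nat \<Rightarrow> _"
  assumes K: "\<And>i. inner_approx \<sigma> D (K i)"
  shows "inner_approx \<sigma> D (\<Union>i. K i)"
  unfolding inner_approx_def
proof (intro conjI allI impI)
  have Ks: "K i \<in> sets (predictable_sigma M F)" for i using K by (simp add: inner_approx_def)
  then show U: "(\<Union>i. K i) \<in> sets (predictable_sigma M F)" by auto
  fix \<epsilon> :: real assume \<epsilon>: "0 < \<epsilon>"
  define P where "P n = (\<Union>i\<le>n. hits \<sigma> D (K i))" for n
  have P: "P n \<in> sets M" for n
    unfolding P_def using hits_sets[OF Ks] by (intro sets.finite_UN) auto
  have "(\<lambda>n. measure M (P n)) \<longlonglongrightarrow> measure M (\<Union>n. P n)"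
    using P by (intro finite_Lim_measure_incseq) (auto simp: incseq_def P_def intro: order_trans)
  also have PU: "(\<Union>n. P n) = hits \<sigma> D (\<Union>i. K i)" by (auto simp: P_def hits_def)
  finally have "\<forall>\<^sub>F n in sequentially. measure M (hits \<sigma> D (\<Union>i. K i)) - \<epsilon> / 2 < measure M (P n)"
    using \<epsilon> by (intro order_tendstoD) auto
  then obtain n where n: "measure M (hits \<sigma> D (\<Union>i. K i)) - \<epsilon> / 2 < measure M (P n)"
    by (auto simp: eventually_sequentially)
  have "\<exists>C. foreseen_delta C \<and> C \<subseteq> K i \<and> measure M (hits \<sigma> D (K i) - hits \<sigma> D C) < \<epsilon> / (2 * real (Suc n))" for i
    using K[of i] \<epsilon> by (simp add: inner_approx_def)
  then obtain C where C: "\<And>i. foreseen_delta (C i)" "\<And>i. C i \<subseteq> K i"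
    "\<And>i. measure M (hits \<sigma> D (K i) - hits \<sigma> D (C i)) < \<epsilon> / (2 * real (Suc n))"
    by metis
  have Cs: "hits \<sigma> D (C i) \<in> sets M" for i using C by (intro hits_delta)
  have sub: "hits \<sigma> D (\<Union>i. K i) - hits \<sigma> D (\<Union>i\<le>n. C i) \<subseteq> (hits \<sigma> D (\<Union>i. K i) - P n) \<union> (\<Union>i\<le>n. hits \<sigma> D (K i) - hits \<sigma> D (C i))"
    by (auto simp: P_def hits_def)
  have "measure M (hits \<sigma> D (\<Union>i. K i) - hits \<sigma> D (\<Union>i\<le>n. C i)) \<le>
      measure M ((hits \<sigma> D (\<Union>i. K i) - P n) \<union> (\<Union>i\<le>n. hits \<sigma> D (K i) - hits \<sigma> D (C i)))"
    using hits_sets[OF U] P Cs hits_sets[OF Ks]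
    by (intro finite_measure_mono sub sets.Un sets.finite_UN sets.Diff) auto
  also have "\<dots> \<le> measure M (hits \<sigma> D (\<Union>i. K i) - P n) + measure M (\<Union>i\<le>n. hits \<sigma> D (K i) - hits \<sigma> D (C i))"
    using hits_sets[OF U] P Cs hits_sets[OF Ks]
    by (intro measure_Un_le sets.finite_UN sets.Diff) auto
  also have "measure M (hits \<sigma> D (\<Union>i. K i) - P n) = measure M (hits \<sigma> D (\<Union>i. K i)) - measure M (P n)"
    using hits_sets[OF U] P PU by (intro finite_measure_Diff) auto
  also have "measure M (\<Union>i\<le>n. hits \<sigma> D (K i) - hits \<sigma> D (C i)) \<le> (\<Sum>i\<le>n. measure M (hits \<sigma> D (K i) - hits \<sigma> D (C i)))"
    using Cs hits_sets[OF Ks] by (intro finite_measure_subadditive_finite) auto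
  also have "\<dots> \<le> (\<Sum>i\<le>n. \<epsilon> / (2 * real (Suc n)))"
    using C(3) by (intro sum_mono less_imp_le)
  also have "\<dots> = \<epsilon> / 2" by (simp add: field_simps)
  finally have "measure M (hits \<sigma> D (\<Union>i. K i) - hits \<sigma> D (\<Union>i\<le>n. C i)) < \<epsilon>" using n by simp
  moreover have "foreseen_delta (\<Union>i\<le>n. C i)" using C(1) by (rule foreseen_delta_UN)
  moreover have "(\<Union>i\<le>n. C i) \<subseteq> (\<Union>i. K i)" using C(2) by blast
  ultimately show "\<exists>C. foreseen_delta C \<and> C \<subseteq> (\<Union>i. K i) \<and> measure M (hits \<sigma> D (\<Union>i. K i) - hits \<sigma> D C) < \<epsilon>"
    by blast
qed

lemma inner_approx_INT:
  fixes K :: "nat \<Rightarrow> _"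
  assumes K: "\<And>i. inner_approx \<sigma> D (K i)"
  shows "inner_approx \<sigma> D (\<Inter>i. K i)"
  unfolding inner_approx_def
proof (intro conjI allI impI)
  have Ks: "K i \<in> sets (predictable_sigma M F)" for i using K by (simp add: inner_approx_def)
  then show U: "(\<Inter>i. K i) \<in> sets (predictable_sigma M F)" by auto
  fix \<epsilon> :: real assume \<epsilon>: "0 < \<epsilon>"
  \<comment> \<open>These errors sum up to \<open>\<epsilon> / 2\<close>, which leaves room for the
    strict inequality.\<close>
  have "\<exists>C. foreseen_delta C \<and> C \<subseteq> K i \<and> measure M (hits \<sigma> D (K i) - hits \<sigma> D C) < \<epsilon> / 4 * (1 / 2) ^ i" for i
  proof -
    have "0 < \<epsilon> / 4 * (1 / 2) ^ i" using \<epsilon> by simp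
    with K[of i] show ?thesis unfolding inner_approx_def by blast
  qed
  then obtain C where C: "\<And>i. foreseen_delta (C i)" "\<And>i. C i \<subseteq> K i"
    "\<And>i. measure M (hits \<sigma> D (K i) - hits \<sigma> D (C i)) < \<epsilon> / 4 * (1 / 2) ^ i"
    by metis
  have Cs: "hits \<sigma> D (C i) \<in> sets M" for i using C by (intro hits_delta)
  have summable: "summable (\<lambda>i. measure M (hits \<sigma> D (K i) - hits \<sigma> D (C i)))"
    by (rule summable_comparison_test'[where g = "\<lambda>i. \<epsilon> / 4 * (1 / 2) ^ i"])
      (use C(3) in \<open>auto intro: less_imp_le intro!: summable_mult summable_geometric\<close>)
  have sub: "hits \<sigma> D (\<Inter>i. K i) - hits \<sigma> D (\<Inter>i. C i) \<subseteq> (\<Union>i. hits \<sigma> D (K i) - hits \<sigma> D (C i))"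
    by (auto simp: hits_def)
  have "measure M (hits \<sigma> D (\<Inter>i. K i) - hits \<sigma> D (\<Inter>i. C i)) \<le> measure M (\<Union>i. hits \<sigma> D (K i) - hits \<sigma> D (C i))"
    using Cs hits_sets[OF Ks] by (intro finite_measure_mono sub sets.countable_UN) auto
  also have "\<dots> \<le> (\<Sum>i. measure M (hits \<sigma> D (K i) - hits \<sigma> D (C i)))"
    using Cs hits_sets[OF Ks] summable by (intro finite_measure_subadditive_countably) auto
  also have "\<dots> \<le> (\<Sum>i. \<epsilon> / 4 * (1 / 2) ^ i)"
    using C(3) by (intro suminf_le summable summable_mult summable_geometric less_imp_le) auto
  also have "\<dots> = \<epsilon> / 2" by (subst suminf_mult) (auto simp: suminf_geometric summable_geometric)
  finally have "measure M (hits \<sigma> D (\<Inter>i. K i) - hits \<sigma> D (\<Inter>i. C i)) < \<epsilon>" using \<epsilon> by simp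
  moreover have "foreseen_delta (\<Inter>i. C i)" using C(1) by (rule foreseen_delta_INT)
  moreover have "(\<Inter>i. C i) \<subseteq> (\<Inter>i. K i)" using C(2) by blast
  ultimately show "\<exists>C. foreseen_delta C \<and> C \<subseteq> (\<Inter>i. K i) \<and> measure M (hits \<sigma> D (\<Inter>i. K i) - hits \<sigma> D C) < \<epsilon>"
    by blast
qed

lemma inner_approx_Un:
  assumes "inner_approx \<sigma> D K" "inner_approx \<sigma> D L"
  shows "inner_approx \<sigma> D (K \<union> L)"
proof -
  have "inner_approx \<sigma> D (\<Union>i :: nat. if i = 0 then K else L)"
    using assms by (intro inner_approx_UN) auto
  also have "(\<Union>i :: nat. if i = 0 then K else L) = K \<union> L"
    by (auto split: if_splits intro: exI[of _ 1])
  finally show ?thesis .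
qed

text \<open>Foreseen rectangles start strictly after time 0 and cannot fill a set at time 0. Since
  \<open>\<sigma>\<close> is positive on \<open>D\<close>, the graph does not meet that set, so the
  empty set is a sufficient approximation.\<close>

lemma inner_approx_zero: "B \<in> sets (F 0) \<Longrightarrow> inner_approx \<sigma> D ({0} \<times> B)"
  unfolding inner_approx_def
proof (intro conjI allI impI)
  fix \<epsilon> :: real assume "0 < \<epsilon>"
  moreover have "hits \<sigma> D ({0} \<times> B) = {}" using \<sigma>_pos by (fastforce simp: hits_def)
  ultimately show "\<exists>C. foreseen_delta C \<and> C \<subseteq> {0} \<times> B \<and> measure M (hits \<sigma> D ({0} \<times> B) - hits \<sigma> D C) < \<epsilon>"
    by (intro exI[of _ "{}"]) (simp add: foreseen_deltaI foreseen_empty)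
qed (rule predictable_rect0)

lemma inner_approx_rect:
  assumes s: "0 \<le> s" and B: "B \<in> sets (F s)"
  shows "inner_approx \<sigma> D ({s<..t} \<times> B)"
proof -
  have "inner_approx \<sigma> D (\<Union>n. {s + 1 / real (Suc n)..t} \<times> B)"
    using s B by (intro inner_approx_UN inner_approx_foreseen foreseen_rect[of s]) auto
  also have "(\<Union>n. {s + 1 / real (Suc n)..t} \<times> B) = {s<..t} \<times> B"
  proof -
    have "\<exists>n. s + 1 / real (Suc n) \<le> x" if sx: "s < x" for x
    proof -
      obtain n where "inverse (real (Suc n)) < x - s" using reals_Archimedean[of "x - s"] sx by auto
      then show ?thesis by (intro exI[of _ n]) (simp add: inverse_eq_divide)
    qed
    moreover have "s < x" if "s + 1 / real (Suc n) \<le> x" for x n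
      using that by (metis less_add_same_cancel1 less_le_trans of_nat_0_less_iff zero_less_Suc zero_less_divide_1_iff)
    ultimately show ?thesis by (auto simp del: of_nat_Suc)
  qed
  finally show ?thesis .
qed

lemma inner_approx_after:
  assumes s: "0 \<le> s"
  shows "inner_approx \<sigma> D ({s<..} \<times> space M)"
proof -
  have "inner_approx \<sigma> D (\<Union>n. {s<..real n} \<times> space M)"
    using s by (intro inner_approx_UN inner_approx_rect space_in_F)
  also have "(\<Union>n. {s<..real n} \<times> space M) = {s<..} \<times> space M"
    using real_arch_simple by auto
  finally show ?thesis .
qed

text \<open>Approximable sets are closed under countable unions and countable intersections, but not
  visibly under complements, so the induction carries a set together with its complement.\<close>

lemma inner_approx_predictable:
  assumes "K \<in> sets (predictable_sigma M F)"
  shows "inner_approx \<sigma> D K"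
proof -
  let ?\<Omega> = "{0..} \<times> space M :: (real \<times> 'a) set"
  have "inner_approx \<sigma> D K \<and> inner_approx \<sigma> D (?\<Omega> - K)"
    using assms unfolding sets_predictable
  proof (induction rule: sigma_sets.induct)
    case (Basic K)
    then consider (zero) B where "K = {0} \<times> B" "B \<in> sets (F 0)"
      | (pos) s u B where "K = {s<..u} \<times> B" "0 \<le> s" "s \<le> u" "B \<in> sets (F s)"
      by (auto simp: pred_gen_def)
    then show ?case
    proof cases
      case zero
      have "?\<Omega> - K = {0} \<times> (space M - B) \<union> {0<..} \<times> space M"
        using zero by auto
      moreover have "space M - B \<in> sets (F 0)" using zero space_in_F[of 0] by auto
      ultimately show ?thesis
        using zero by (auto intro!: inner_approx_Un inner_approx_zero inner_approx_after)
    next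
      case pos
      have "?\<Omega> - K = (({0} \<times> space M \<union> {0<..s} \<times> space M) \<union> {s<..u} \<times> (space M - B)) \<union> {u<..} \<times> space M"
        using pos by auto
      moreover have "space M - B \<in> sets (F s)" using pos space_in_F[of s] by auto
      ultimately show ?thesis
        using pos space_in_F[of 0]
        by (auto intro!: inner_approx_Un inner_approx_zero inner_approx_after inner_approx_rect)
    qed
  next
    case Empty
    have eq: "?\<Omega> - {} = {0} \<times> space M \<union> {0<..} \<times> space M" by auto
    have "inner_approx \<sigma> D (?\<Omega> - {})"
      unfolding eq using space_in_F[of 0]
      by (intro inner_approx_Un inner_approx_zero inner_approx_after) auto
    then show ?case by (simp add: inner_approx_foreseen foreseen_empty)
  next
    case (Compl K)
    have "K \<subseteq> ?\<Omega>" using Compl(1) sets.sets_into_space[of K "predictable_sigma M F"]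
      by (simp add: sets_predictable space_predictable)
    then have "?\<Omega> - (?\<Omega> - K) = K" by auto
    then show ?case using Compl by simp
  next
    case (Union K)
    have "?\<Omega> - (\<Union>i. K i) = (\<Inter>i. ?\<Omega> - K i)" by auto
    then show ?case using Union by (auto intro!: inner_approx_UN inner_approx_INT simp del: INT_simps)
  qed
  then show ?thesis ..
qed

end

lemma real_stopping_time_less_sets:
  assumes \<theta>: "real_stopping_time \<theta>" "\<And>\<omega>. \<omega> \<in> space M \<Longrightarrow> 0 \<le> \<theta> \<omega>" and t: "0 < t"
  shows "{\<omega> \<in> space M. \<theta> \<omega> < t} \<in> sets (F t)"
proof -
  let ?Q = "{q. q \<in> \<rat> \<and> 0 \<le> q \<and> q < t}"
  have "\<exists>q\<in>?Q. \<theta> \<omega> \<le> q" if "\<omega> \<in> space M" "\<theta> \<omega> < t" for \<omega>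
  proof -
    have "\<exists>q. q \<in> \<rat> \<and> \<theta> \<omega> < q \<and> q < t" using Rats_dense_in_real[OF that(2)] by blast
    then show ?thesis using \<theta>(2)[OF that(1)] by force
  qed
  then have "{\<omega> \<in> space M. \<theta> \<omega> < t} = (\<Union>q\<in>?Q. {\<omega> \<in> space M. \<theta> \<omega> \<le> q})" by auto
  also have "\<dots> \<in> sets (F t)"
  proof (rule sets.countable_UN'')
    show "countable ?Q" by (rule countable_subset[OF _ countable_rat]) auto
    fix q assume "q \<in> ?Q"
    then show "{\<omega> \<in> space M. \<theta> \<omega> \<le> q} \<in> sets (F t)"
      using \<theta>(1) F_mono[of q t] by (auto simp: real_stopping_time_def)
  qed
  finally show ?thesis .
qed

text \<open>The random set \<open>{H \<ge> v}\<close> is approximated from inside, with respect to the measure carried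
  by the graph of the crossing time, by decreasing sequences of foreseen sets. This replaces the
  section theorem.\<close>

lemma announce_level:
  assumes H: "predictable_process M F H"
    and H_mono: "\<And>\<omega>. \<omega> \<in> space M \<Longrightarrow> mono_on {0..} (\<lambda>t. H t \<omega>)"
    and H_rc: "\<And>\<omega>. \<omega> \<in> space M \<Longrightarrow> right_continuous_path (\<lambda>t. H t \<omega>)"
    and T: "0 < T" and \<epsilon>: "0 < \<epsilon>"
  obtains \<rho> where "real_stopping_time \<rho>" "\<And>\<omega>. 0 \<le> \<rho> \<omega> \<and> \<rho> \<omega> \<le> T"
    "\<And>\<omega>. v \<le> H 0 \<omega> \<Longrightarrow> \<rho> \<omega> = 0"
    "AE \<omega> in M. H 0 \<omega> < v \<longrightarrow> v \<le> H T \<omega> \<longrightarrow> H (\<rho> \<omega>) \<omega> < v"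
    "measure M {\<omega> \<in> space M. \<rho> \<omega> < T \<and> H T \<omega> < v} \<le> \<epsilon>"
proof -
  have ad: "adapted_process F H" by (rule predictable_adapted[OF H])
  have Hm: "H t \<in> borel_measurable M" if "0 \<le> t" for t
    by (rule adapted_measurable[OF ad that])
  note [measurable] = Hm[OF order_refl] Hm[OF less_imp_le[OF T]]
  have mono: "H s \<omega> \<le> H t \<omega>" if "\<omega> \<in> space M" "0 \<le> s" "s \<le> t" for s t \<omega>
    using mono_onD[OF H_mono[OF that(1)], of s t] that by auto
  \<comment> \<open>The paths that cross the level in \<open>(0, T]\<close>; \<open>\<sigma>\<close>
    below is the time of crossing, attained by right continuity of \<open>H\<close>.\<close>
  define D where "D = {\<omega> \<in> space M. H 0 \<omega> < v \<and> v \<le> H T \<omega>}"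
  have D: "D \<in> sets M" unfolding D_def by measurable
  define \<sigma> where "\<sigma> \<omega> = Inf {t. 0 \<le> t \<and> v \<le> H t \<omega>}" for \<omega>
  have \<sigma>_le: "\<sigma> \<omega> \<le> t \<longleftrightarrow> v \<le> H t \<omega>" if \<omega>: "\<omega> \<in> D" and t: "0 \<le> t" for \<omega> t
  proof
    let ?S = "{t. 0 \<le> t \<and> v \<le> H t \<omega>}"
    have sp: "\<omega> \<in> space M" using \<omega> by (simp add: D_def)
    have ne: "?S \<noteq> {}" using \<omega> T by (auto simp: D_def intro: less_imp_le)
    have bdd: "bdd_below ?S" by (auto intro: bdd_belowI[of _ 0])
    show "v \<le> H t \<omega> \<Longrightarrow> \<sigma> \<omega> \<le> t"
      unfolding \<sigma>_def using t by (intro cInf_lower bdd) auto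
    assume le: "\<sigma> \<omega> \<le> t"
    have gt: "v \<le> H u \<omega>" if "t < u" for u
    proof -
      have "Inf ?S < u" using le that by (simp add: \<sigma>_def)
      then obtain s where "s \<in> ?S" "s < u" using cInf_lessD[OF ne] by blast
      then show ?thesis using mono[OF sp, of s u] by auto
    qed
    have "((\<lambda>u. H u \<omega>) \<longlongrightarrow> H t \<omega>) (at_right t)"
      using H_rc[OF sp] t by (simp add: right_continuous_path_def continuous_within)
    moreover have "\<forall>\<^sub>F u in at_right t. v \<le> H u \<omega>"
      by (rule eventually_mono[OF eventually_at_right_less gt])
    ultimately show "v \<le> H t \<omega>" by (rule tendsto_lowerbound) simp
  qed
  have \<sigma>_pos: "0 < \<sigma> \<omega>" if "\<omega> \<in> D" for \<omega>
    using \<sigma>_le[OF that, of 0] that by (auto simp: D_def)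
  have \<sigma>_T: "\<sigma> \<omega> \<le> T" if "\<omega> \<in> D" for \<omega>
    using \<sigma>_le[OF that, of T] that T by (auto simp: D_def)
  have H_\<sigma>: "v \<le> H (\<sigma> \<omega>) \<omega>" if "\<omega> \<in> D" for \<omega>
    using \<sigma>_le[OF that, of "\<sigma> \<omega>"] \<sigma>_pos[OF that] by simp
  have \<sigma>_meas: "{\<omega> \<in> D. s < \<sigma> \<omega> \<and> \<sigma> \<omega> \<le> t} \<in> sets M" if "0 \<le> s" "s \<le> t" for s t
  proof -
    have "{\<omega> \<in> D. s < \<sigma> \<omega> \<and> \<sigma> \<omega> \<le> t} = D \<inter> {\<omega> \<in> space M. H s \<omega> < v \<and> v \<le> H t \<omega>}"
    proof -
      have "s < \<sigma> \<omega> \<and> \<sigma> \<omega> \<le> t \<longleftrightarrow> H s \<omega> < v \<and> v \<le> H t \<omega>" if "\<omega> \<in> D" for \<omega>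
        using \<sigma>_le[OF that, of s] \<sigma>_le[OF that, of t] \<open>0 \<le> s\<close> \<open>s \<le> t\<close> by linarith
      moreover have "D \<subseteq> space M" by (auto simp: D_def)
      ultimately show ?thesis by blast
    qed
    also have "\<dots> \<in> sets M"
    proof -
      have [measurable]: "H s \<in> borel_measurable M" "H t \<in> borel_measurable M"
        using that by (auto intro: Hm)
      show ?thesis by (intro sets.Int D) measurable
    qed
    finally show ?thesis .
  qed
  note ctx = D \<sigma>_pos \<sigma>_meas
  \<comment> \<open>With times restricted to \<open>[0, T]\<close>, a single point of
    \<open>C\<close> on a path certifies that \<open>H T\<close> has reached the level.\<close>
  define C where "C = {(t, \<omega>). 0 \<le> t \<and> t \<le> T \<and> \<omega> \<in> space M \<and> v \<le> H t \<omega>}"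
  have "(\<lambda>(t, \<omega>). H t \<omega>) -` {v..} \<inter> space (predictable_sigma M F) \<in> sets (predictable_sigma M F)"
    using H by (intro measurable_sets[where A = borel]) (auto simp: predictable_process_def)
  moreover have "{0} \<times> space M \<union> {0<..T} \<times> space M \<in> sets (predictable_sigma M F)"
    by (intro sets.Un predictable_rect predictable_rect0 space_in_F) auto
  moreover have "C = ((\<lambda>(t, \<omega>). H t \<omega>) -` {v..} \<inter> space (predictable_sigma M F)) \<inter>
      ({0} \<times> space M \<union> {0<..T} \<times> space M)"
    using T by (auto simp: C_def space_predictable)
  ultimately have C: "C \<in> sets (predictable_sigma M F)" by auto
  have "(\<sigma> \<omega>, \<omega>) \<in> C" if "\<omega> \<in> D" for \<omega>
    unfolding C_def using less_imp_le[OF \<sigma>_pos[OF that]] \<sigma>_T[OF that] H_\<sigma>[OF that] that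
    by (simp add: D_def)
  then have hitsC: "hits \<sigma> D C = D"
    unfolding hits_def by blast
  have "\<exists>K. foreseen_delta K \<and> K \<subseteq> C \<and> measure M (hits \<sigma> D C - hits \<sigma> D K) < (1 / 2) ^ k" for k
  proof -
    have "(0::real) < (1 / 2) ^ k" by simp
    with inner_approx_predictable[OF ctx C] show ?thesis
      unfolding inner_approx_def by blast
  qed
  then obtain K where K: "\<And>k. foreseen_delta (K k)" "\<And>k. K k \<subseteq> C"
      "\<And>k. measure M (hits \<sigma> D C - hits \<sigma> D (K k)) < (1 / 2) ^ (k::nat)"
    by metis
  \<comment> \<open>\<open>\<rho>\<close> announces \<open>K k\<close>, and the probability that it
    fires in vain, without \<open>H\<close> reaching \<open>v\<close> by time \<open>T\<close>, is
    below a share of \<open>\<epsilon>\<close>. The shares sum up to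
    \<open>\<epsilon>\<close>.\<close>
  define good where "good k \<rho> \<longleftrightarrow>
      real_stopping_time \<rho> \<and> (\<forall>\<omega>. 0 \<le> \<rho> \<omega> \<and> \<rho> \<omega> \<le> T) \<and> (\<forall>t \<omega>. (t, \<omega>) \<in> K k \<longrightarrow> \<rho> \<omega> < t) \<and>
      measure M {\<omega> \<in> space M. \<rho> \<omega> < T \<and> H T \<omega> < v} < \<epsilon> / 2 * (1 / 2) ^ k" for k \<rho>
  have "\<exists>\<rho>. good k \<rho>" for k
  proof -
    obtain A :: "nat \<Rightarrow> _" where A: "\<And>n. foreseen (A n)" "decseq A" "K k = (\<Inter>n. A n)"
      using K(1)[of k] by (auto simp: foreseen_delta_def)
    have "\<exists>\<rho>. real_stopping_time \<rho> \<and> (\<forall>\<omega>. 0 \<le> \<rho> \<omega> \<and> \<rho> \<omega> \<le> T) \<and> (\<forall>t \<omega>. (t, \<omega>) \<in> A n \<longrightarrow> \<rho> \<omega> < t) \<and>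
        (\<forall>\<omega>. \<rho> \<omega> < T \<longrightarrow> (\<exists>t. (t, \<omega>) \<in> A n))" for n
      using foreseen_announce[OF A(1)[of n] T] by metis
    then obtain \<rho> where \<rho>: "\<And>n. real_stopping_time (\<rho> n)" "\<And>n \<omega>. 0 \<le> \<rho> n \<omega> \<and> \<rho> n \<omega> \<le> T"
        "\<And>n t \<omega>. (t, \<omega>) \<in> A n \<Longrightarrow> \<rho> n \<omega> < t" "\<And>n \<omega>. \<rho> n \<omega> < T \<Longrightarrow> \<exists>t. (t, \<omega>) \<in> A n"
      by metis
    define E where "E n = {\<omega> \<in> space M. \<rho> n \<omega> < T \<and> H T \<omega> < v}" for n
    have E: "E n \<in> sets M" for n
    proof -
      have "E n = {\<omega> \<in> space M. \<rho> n \<omega> < T} \<inter> {\<omega> \<in> space M. H T \<omega> < v}" by (auto simp: E_def)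
      also have "{\<omega> \<in> space M. \<rho> n \<omega> < T} \<in> sets M"
        using \<rho> T by (intro sets_F_subset[of T] real_stopping_time_less_sets) auto
      then have "{\<omega> \<in> space M. \<rho> n \<omega> < T} \<inter> {\<omega> \<in> space M. H T \<omega> < v} \<in> sets M"
        by (rule sets.Int) measurable
      finally show ?thesis .
    qed
    \<comment> \<open>Were the path in \<open>E n\<close> for infinitely many \<open>n\<close>, all
      sections of the decreasing sets \<open>A n\<close> would be nonempty. Being compact and nested
      they would share a time, which gives a point of \<open>C\<close> on the path and contradicts
      \<open>H T \<omega> < v\<close>.\<close>
    have out: "\<exists>n0. \<forall>n\<ge>n0. \<omega> \<notin> E n" for \<omega>
    proof (rule ccontr)
      assume "\<not> (\<exists>n0. \<forall>n\<ge>n0. \<omega> \<notin> E n)"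
      then have inf: "\<exists>n\<ge>n0. \<omega> \<in> E n" for n0 by blast
      have ne: "{t. (t, \<omega>) \<in> A m} \<noteq> {}" for m
      proof -
        obtain n where n: "m \<le> n" "\<omega> \<in> E n" using inf by blast
        then obtain t where "(t, \<omega>) \<in> A n" using \<rho>(4)[of n \<omega>] by (auto simp: E_def)
        then show ?thesis using decseqD[OF A(2) n(1)] by auto
      qed
      have "(\<Inter>n. {t. (t, \<omega>) \<in> A n}) \<noteq> {}"
      proof (rule compact_nest)
        show "{t. (t, \<omega>) \<in> A n} \<subseteq> {t. (t, \<omega>) \<in> A m}" if "m \<le> n" for m n
          using decseqD[OF A(2) that] by auto
      qed (use ne foreseen_compact_section[OF A(1)] in auto)
      then obtain t where "(t, \<omega>) \<in> K k" using A(3) by auto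
      then have "(t, \<omega>) \<in> C" using K(2) by auto
      then have "v \<le> H T \<omega>" using mono[of \<omega> t T] by (auto simp: C_def)
      then show False using inf[of 0] by (auto simp: E_def)
    qed
    have "(\<lambda>n. \<integral>\<omega>. indicator (E n) \<omega> \<partial>M) \<longlonglongrightarrow> (\<integral>\<omega>. (0::real) \<partial>M)"
    proof (rule integral_dominated_convergence[where w = "\<lambda>_. 1"])
      show "AE \<omega> in M. (\<lambda>n. indicator (E n) \<omega> :: real) \<longlonglongrightarrow> 0"
      proof (rule AE_I2)
        fix \<omega>
        obtain n0 where "\<forall>n\<ge>n0. \<omega> \<notin> E n" using out by blast
        then have "\<forall>\<^sub>F n in sequentially. 0 = (indicator (E n) \<omega> :: real)"
          by (auto simp: eventually_sequentially indicator_def)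
        then show "(\<lambda>n. indicator (E n) \<omega> :: real) \<longlonglongrightarrow> 0"
          by (rule Lim_transform_eventually[OF tendsto_const])
      qed
    qed (use E in \<open>auto simp: indicator_def\<close>)
    then have "(\<lambda>n. measure M (E n)) \<longlonglongrightarrow> 0" using E by simp
    then have "\<forall>\<^sub>F n in sequentially. measure M (E n) < \<epsilon> / 2 * (1 / 2) ^ k"
      using \<epsilon> by (intro order_tendstoD) auto
    then obtain n where "measure M (E n) < \<epsilon> / 2 * (1 / 2) ^ k"
      by (auto simp: eventually_sequentially)
    then show ?thesis
      using \<rho>(1)[of n] \<rho>(2)[of n] \<rho>(3)[of _ _ n] A(3) unfolding E_def good_def by (intro exI[of _ "\<rho> n"]) simp
  qed
  then obtain \<rho> where "\<And>k. good k (\<rho> k)" by metis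
  then have \<rho>: "\<And>k. real_stopping_time (\<rho> k)" "\<And>k \<omega>. 0 \<le> \<rho> k \<omega> \<and> \<rho> k \<omega> \<le> T"
      "\<And>k t \<omega>. (t, \<omega>) \<in> K k \<Longrightarrow> \<rho> k \<omega> < t"
      "\<And>k. measure M {\<omega> \<in> space M. \<rho> k \<omega> < T \<and> H T \<omega> < v} < \<epsilon> / 2 * (1 / 2) ^ k"
    by (simp_all add: good_def)
  \<comment> \<open>No single \<open>K k\<close> has to catch almost every crossing; together they
    do. The infimum is again a stopping time by right continuity of the filtration.\<close>
  define \<rho>' where "\<rho>' \<omega> = (if v \<le> H 0 \<omega> then 0 else INF k. \<rho> k \<omega>)" for \<omega>
  have bdd: "bdd_below (range (\<lambda>k. \<rho> k \<omega>))" for \<omega>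
    using \<rho>(2) by (auto intro!: bdd_belowI[of _ 0])
  have INF_less: "(INF k. \<rho> k \<omega>) < t \<longleftrightarrow> (\<exists>k. \<rho> k \<omega> < t)" for \<omega> t
    by (subst cINF_less_iff) (auto simp: bdd)
  show ?thesis
  proof
    show "real_stopping_time \<rho>'"
    proof (rule real_stopping_time_lessI)
      fix t :: real assume t: "0 < t"
      have "{\<omega> \<in> space M. \<rho>' \<omega> < t} =
        {\<omega> \<in> space M. v \<le> H 0 \<omega>} \<union> ((space M - {\<omega> \<in> space M. v \<le> H 0 \<omega>}) \<inter> (\<Union>k. {\<omega> \<in> space M. \<rho> k \<omega> < t}))"
        using t by (auto simp: \<rho>'_def INF_less split: if_splits)
      also have "\<dots> \<in> sets (F t)"
      proof -
        have "H 0 -` {v..} \<inter> space (F 0) \<in> sets (F 0)"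
          using ad by (intro measurable_sets[where A = borel]) (auto simp: adapted_process_def)
        also have "H 0 -` {v..} \<inter> space (F 0) = {\<omega> \<in> space M. v \<le> H 0 \<omega>}"
          using space_F[of 0] by auto
        finally have "{\<omega> \<in> space M. v \<le> H 0 \<omega>} \<in> sets (F t)" using F_mono[of 0 t] t by auto
        moreover have "{\<omega> \<in> space M. \<rho> k \<omega> < t} \<in> sets (F t)" for k
          using \<rho> t by (intro real_stopping_time_less_sets) auto
        ultimately show ?thesis
          using space_in_F[of t] t by (intro sets.Un sets.Int sets.Diff sets.countable_UN) auto
      qed
      finally show "{\<omega> \<in> space M. \<rho>' \<omega> < t} \<in> sets (F t)" .
    qed
    show "0 \<le> \<rho>' \<omega> \<and> \<rho>' \<omega> \<le> T" for \<omega>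
      using \<rho>(2) T cINF_lower2[OF bdd, of 0 \<omega> T] by (auto simp: \<rho>'_def intro!: cINF_greatest)
    show "\<rho>' \<omega> = 0" if "v \<le> H 0 \<omega>" for \<omega> using that by (simp add: \<rho>'_def)
    \<comment> \<open>The crossings missed by every \<open>K k\<close>. The \<open>k\<close>-th set
      misses a part of measure less than \<open>(1 / 2) ^ k\<close>, so they form a null
      set.\<close>
    define Z where "Z = (\<Inter>k. D - hits \<sigma> D (K k))"
    have hK: "hits \<sigma> D (K k) \<in> sets M" for k by (rule hits_delta[OF ctx K(1)])
    have Z: "Z \<in> sets M" unfolding Z_def using hK D by auto
    have "measure M Z \<le> (1 / 2) ^ k" for k
    proof -
      have "measure M Z \<le> measure M (D - hits \<sigma> D (K k))"
        using hK D by (intro finite_measure_mono) (auto simp: Z_def)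
      then show ?thesis using K(3)[of k] hitsC by simp
    qed
    then have "measure M Z \<le> 0"
      by (intro LIMSEQ_le_const[OF LIMSEQ_power_zero[of "1 / 2 :: real"]]) auto
    then have "measure M Z = 0" using measure_nonneg[of M Z] by linarith
    then have "emeasure M Z = 0" by (simp add: emeasure_eq_measure)
    then have "AE \<omega> in M. \<omega> \<notin> Z" using Z by (intro AE_not_in) (auto simp: null_sets_def)
    then show "AE \<omega> in M. H 0 \<omega> < v \<longrightarrow> v \<le> H T \<omega> \<longrightarrow> H (\<rho>' \<omega>) \<omega> < v"
      using AE_space
    proof eventually_elim
      case (elim \<omega>)
      show ?case
      proof (intro impI)
        assume *: "H 0 \<omega> < v" "v \<le> H T \<omega>"
        then have \<omega>: "\<omega> \<in> D" using elim by (simp add: D_def)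
        then obtain k where "(\<sigma> \<omega>, \<omega>) \<in> K k" using elim by (auto simp: Z_def hits_def)
        then have "\<rho>' \<omega> < \<sigma> \<omega>" using \<rho>(3) * by (auto simp: \<rho>'_def INF_less)
        moreover have "0 \<le> \<rho>' \<omega>" using \<rho>(2) by (auto simp: \<rho>'_def intro!: cINF_greatest)
        ultimately show "H (\<rho>' \<omega>) \<omega> < v" using \<sigma>_le[OF \<omega>, of "\<rho>' \<omega>"] by auto
      qed
    qed
    let ?E = "\<lambda>k. {\<omega> \<in> space M. \<rho> k \<omega> < T \<and> H T \<omega> < v}"
    have E: "?E k \<in> sets M" for k
    proof -
      have "?E k = {\<omega> \<in> space M. \<rho> k \<omega> < T} \<inter> {\<omega> \<in> space M. H T \<omega> < v}" by auto
      also have "{\<omega> \<in> space M. \<rho> k \<omega> < T} \<in> sets M"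
        using \<rho> T by (intro sets_F_subset[of T] real_stopping_time_less_sets) auto
      then have "{\<omega> \<in> space M. \<rho> k \<omega> < T} \<inter> {\<omega> \<in> space M. H T \<omega> < v} \<in> sets M"
        by (rule sets.Int) measurable
      finally show ?thesis .
    qed
    have summable: "summable (\<lambda>k. measure M (?E k))"
      by (rule summable_comparison_test'[where g = "\<lambda>k. \<epsilon> / 2 * (1 / 2) ^ k"])
        (use \<rho>(4) in \<open>auto intro: less_imp_le intro!: summable_mult summable_geometric\<close>)
    have "measure M {\<omega> \<in> space M. \<rho>' \<omega> < T \<and> H T \<omega> < v} \<le> measure M (\<Union>k. ?E k)"
    proof (rule finite_measure_mono)
      show "{\<omega> \<in> space M. \<rho>' \<omega> < T \<and> H T \<omega> < v} \<subseteq> (\<Union>k. ?E k)"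
        using mono[of _ 0 T] T by (fastforce simp: \<rho>'_def INF_less split: if_splits)
    qed (use E in auto)
    also have "\<dots> \<le> (\<Sum>k. measure M (?E k))"
      using E summable by (intro finite_measure_subadditive_countably) auto
    also have "\<dots> \<le> (\<Sum>k. \<epsilon> / 2 * (1 / 2) ^ k)"
      using \<rho>(4) by (intro suminf_le summable summable_mult summable_geometric less_imp_le) auto
    also have "\<dots> = \<epsilon>" by (subst suminf_mult) (auto simp: suminf_geometric summable_geometric)
    finally show "measure M {\<omega> \<in> space M. \<rho>' \<omega> < T \<and> H T \<omega> < v} \<le> \<epsilon>" .
  qed
qed

end

section \<open>The weak type inequality\<close>

lemma right_continuous_rational_gt:
  fixes f :: "real \<Rightarrow> real"
  assumes f: "right_continuous_path f" and t: "0 \<le> t" "t < b" and c: "c < f t"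
  obtains q where "q \<in> \<rat>" "t < q" "q < b" "c < f q"
proof -
  have "(f \<longlongrightarrow> f t) (at_right t)"
    using f t by (simp add: right_continuous_path_def continuous_within)
  then have "\<forall>\<^sub>F x in at_right t. c < f x" using c by (rule order_tendstoD)
  then obtain d where d: "t < d" "\<And>x. t < x \<Longrightarrow> x < d \<Longrightarrow> c < f x"
    by (auto simp: eventually_at_right_field)
  obtain q where "q \<in> \<rat>" "t < q" "q < min b d"
    using Rats_dense_in_real[of t "min b d"] t d by auto
  then show ?thesis using that d by auto
qed

locale bihari_power_setting = bihari_lasalle_setting M F p X A H N \<eta>
  for M :: "'a measure" and F p X A H N \<eta> +
  assumes p_pos: "0 < p" and p_less_1: "p < 1"

sublocale bihari_power_setting \<subseteq> eta: bihari_eta p \<eta>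
  by unfold_locales
    (use p_pos p_less_1 eta_nonneg eta_continuous eta_mono eta_pos eta_p_concave eta_p_mono in auto)

context bihari_power_setting
begin

section \<open>The integrator and the drift below a level\<close>

abbreviation \<nu> :: "real measure" where
  "\<nu> \<equiv> interval_measure (\<lambda>s. A (max 0 s))"

lemma A_le: "0 \<le> s \<Longrightarrow> s \<le> t \<Longrightarrow> A s \<le> A t"
  using mono_onD[OF A_mono, of s t] by auto

lemma A_nonneg: "0 \<le> t \<Longrightarrow> 0 \<le> A t"
  using A_le[of 0 t] A_zero by simp

lemma A_right_continuous: "0 \<le> t \<Longrightarrow> (A \<longlongrightarrow> A t) (at_right t)"
  using A_cadlag by (auto simp: cadlag_path_def right_continuous_path_def continuous_within)

lemma A_max_right_continuous: "continuous (at_right t) (\<lambda>s. A (max 0 s))"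
proof (cases "0 \<le> t")
  case True
  have "\<forall>\<^sub>F s in at_right t. A s = A (max 0 s)"
    by (rule eventually_mono[OF eventually_at_right_less[of t]]) (use True in auto)
  from Lim_transform_eventually[OF A_right_continuous[OF True] this] True
  show ?thesis by (simp add: continuous_within)
next
  case False
  then have "\<forall>\<^sub>F s in at_right t. A 0 = A (max 0 s)"
    by (auto simp: eventually_at_right_field intro!: exI[of _ 0])
  from Lim_transform_eventually[OF tendsto_const this] False
  show ?thesis by (simp add: continuous_within)
qed

lemma emeasure_\<nu>: "0 \<le> s \<Longrightarrow> s \<le> t \<Longrightarrow> emeasure \<nu> {s<..t} = ennreal (A t - A s)"
  by (subst emeasure_interval_measure_Ioc)
    (auto intro: A_le A_max_right_continuous simp: ennreal_minus A_nonneg)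

sublocale nu: sigma_finite_measure \<nu>
  by (intro sigma_finite_interval_measure A_le A_max_right_continuous) auto

lemma X_measurable: "0 \<le> t \<Longrightarrow> X t \<in> borel_measurable M"
  by (rule adapted_measurable[OF X_adapted])

text \<open>A version of the left running supremum that is jointly measurable in time and path, as
  Fubini's theorem requires.\<close>

definition sup_rat :: "real \<Rightarrow> 'a \<Rightarrow> ennreal" where
  "sup_rat s \<omega> = (SUP q\<in>{q \<in> \<rat>. 0 \<le> q}. if q < s then ennreal (X q \<omega>) else 0)"

lemma sup_rat_measurable [measurable]:
  "(\<lambda>(s, \<omega>). sup_rat s \<omega>) \<in> borel_measurable (borel \<Otimes>\<^sub>M M)"
proof -
  have c: "countable {q \<in> \<rat>. (0::real) \<le> q}" by (rule countable_subset[OF _ countable_rat]) auto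
  have "(\<lambda>x. if q < fst x then ennreal (X q (snd x)) else 0) \<in> borel_measurable (borel \<Otimes>\<^sub>M M)"
    if "0 \<le> q" for q
  proof -
    have [measurable]: "X q \<in> borel_measurable M" using that by (rule X_measurable)
    show ?thesis by measurable
  qed
  then show ?thesis unfolding sup_rat_def case_prod_beta
    by (intro borel_measurable_SUP c) auto
qed

text \<open>By right continuity a value at \<open>u < s\<close> is nearly exceeded at slightly later
  rational times, still before \<open>s\<close>.\<close>

lemma running_sup_left_eq_sup_rat:
  assumes s: "0 < s" and \<omega>: "\<omega> \<in> space M"
  shows "running_sup_left X s \<omega> = sup_rat s \<omega>"
proof (rule antisym)
  have "ennreal (X u \<omega>) \<le> sup_rat s \<omega>" if u: "0 \<le> u" "u < s" for u
  proof (rule ccontr)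
    assume "\<not> ennreal (X u \<omega>) \<le> sup_rat s \<omega>"
    then have lt: "sup_rat s \<omega> < ennreal (X u \<omega>)" by simp
    then obtain r where r: "sup_rat s \<omega> = ennreal r" "0 \<le> r" by (cases "sup_rat s \<omega>") auto
    then have "r < X u \<omega>" using lt by (simp add: ennreal_less_iff)
    from right_continuous_rational_gt[OF X_right_continuous[OF \<omega>] u(1) u(2) this]
    obtain q where q: "q \<in> \<rat>" "u < q" "q < s" "r < X q \<omega>" .
    then have "(if q < s then ennreal (X q \<omega>) else 0) \<le> sup_rat s \<omega>"
      unfolding sup_rat_def using u by (intro SUP_upper) auto
    then have "ennreal (X q \<omega>) \<le> ennreal r" using q r by simp
    then show False using q r by simp
  qed
  then show "running_sup_left X s \<omega> \<le> sup_rat s \<omega>"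
    using s by (auto simp: running_sup_left_def intro!: SUP_least)
  show "sup_rat s \<omega> \<le> running_sup_left X s \<omega>"
    using s unfolding sup_rat_def running_sup_left_def
    by (intro SUP_least) (auto intro!: SUP_upper)
qed

lemma running_sup_left_le_iff:
  assumes "0 < s" "0 \<le> c" "\<omega> \<in> space M"
  shows "running_sup_left X s \<omega> \<le> ennreal c \<longleftrightarrow> (\<forall>r. 0 \<le> r \<and> r < s \<longrightarrow> X r \<omega> \<le> c)"
  using assms by (auto simp: running_sup_left_def SUP_le_iff)

text \<open>The integrand as long as the running supremum does not exceed \<open>u\<close>. Unlike
  \<open>extend_eta\<close> it is bounded, by \<open>\<eta> u\<close>, so the resulting integrals
  are finite whatever \<open>X\<close> does.\<close>

definition eta_level :: "real \<Rightarrow> ennreal \<Rightarrow> ennreal" where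
  "eta_level u x = (if x \<le> ennreal u then ennreal (\<eta> (enn2real x)) else 0)"

lemma eta_measurable: "(\<lambda>x. \<eta> (enn2real x)) \<in> borel_measurable borel"
proof -
  have "(\<lambda>x. indicator {0..} x *\<^sub>R \<eta> x) \<in> borel_measurable borel"
    by (rule borel_measurable_continuous_on_indicator) (auto intro: eta_continuous)
  then have "(\<lambda>x :: ennreal. indicator {0..} (enn2real x) *\<^sub>R \<eta> (enn2real x)) \<in> borel_measurable borel"
    by measurable
  then show ?thesis by simp
qed

lemma eta_level_measurable [measurable]: "eta_level u \<in> borel_measurable borel"
  unfolding eta_level_def[abs_def] using eta_measurable by measurable

lemma eta_le: "0 \<le> x \<Longrightarrow> x \<le> y \<Longrightarrow> \<eta> x \<le> \<eta> y"
  using mono_onD[OF eta_mono, of x y] by auto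

lemma eta_level_le:
  assumes "0 \<le> u"
  shows "eta_level u x \<le> ennreal (\<eta> u)"
proof (cases "x \<le> ennreal u")
  case True
  then have "enn2real x \<le> u" using assms by (simp add: enn2real_leI)
  then show ?thesis using True by (auto simp: eta_level_def intro!: ennreal_leI eta_le)
qed (simp add: eta_level_def)

definition level_integral :: "real \<Rightarrow> real \<Rightarrow> 'a \<Rightarrow> ennreal" where
  "level_integral u t \<omega> = (\<integral>\<^sup>+ s\<in>{0<..t}. eta_level u (running_sup_left X s \<omega>) \<partial>\<nu>)"

lemma level_integral_eq_rat:
  "\<omega> \<in> space M \<Longrightarrow> level_integral u t \<omega> = (\<integral>\<^sup>+ s\<in>{0<..t}. eta_level u (sup_rat s \<omega>) \<partial>\<nu>)"
  unfolding level_integral_def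
  by (intro nn_integral_cong) (auto simp: indicator_def running_sup_left_eq_sup_rat)

lemma level_integral_measurable [measurable]: "level_integral u t \<in> borel_measurable M"
proof (subst measurable_cong[OF level_integral_eq_rat])
  have "(\<lambda>(\<omega>, s). eta_level u (sup_rat s \<omega>) * indicator {0<..t} s) \<in> borel_measurable (M \<Otimes>\<^sub>M \<nu>)"
  proof -
    have [measurable]: "(\<lambda>x. sup_rat (snd x) (fst x)) \<in> borel_measurable (M \<Otimes>\<^sub>M \<nu>)"
      using measurable_compose[OF measurable_pair_swap'[of M borel] sup_rat_measurable]
      by (simp add: case_prod_beta' measurable_cong_sets[OF sets_pair_measure_cong[OF refl sets_interval_measure] refl])
    show ?thesis by measurable
  qed
  then show "(\<lambda>\<omega>. \<integral>\<^sup>+ s\<in>{0<..t}. eta_level u (sup_rat s \<omega>) \<partial>\<nu>) \<in> borel_measurable M"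
    by (rule nu.borel_measurable_nn_integral)
qed simp

lemma level_integral_mono: "s \<le> t \<Longrightarrow> level_integral u s \<omega> \<le> level_integral u t \<omega>"
  unfolding level_integral_def by (intro nn_integral_mono) (auto simp: indicator_def)

lemma level_integral_le:
  assumes "0 \<le> u" "0 \<le> t"
  shows "level_integral u t \<omega> \<le> ennreal (\<eta> u * A t)"
proof -
  have "level_integral u t \<omega> \<le> (\<integral>\<^sup>+ s. ennreal (\<eta> u) * indicator {0<..t} s \<partial>\<nu>)"
    unfolding level_integral_def using eta_level_le[OF assms(1)]
    by (intro nn_integral_mono mult_right_mono) auto
  also have "\<dots> = ennreal (\<eta> u) * emeasure \<nu> {0<..t}"
    by (subst nn_integral_cmult_indicator) auto
  also have "\<dots> = ennreal (\<eta> u * A t)"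
    using assms by (simp add: emeasure_\<nu> A_zero ennreal_mult A_nonneg eta_nonneg)
  finally show ?thesis .
qed

text \<open>The integrand sees the supremum over strictly earlier times only, so a jump of
  \<open>X\<close> above \<open>u\<close> at \<open>t\<close> itself is harmless.\<close>

lemma eta_integral_eq_level_integral:
  assumes \<omega>: "\<omega> \<in> space M" and u: "0 \<le> u" and le: "\<And>r. 0 \<le> r \<Longrightarrow> r < t \<Longrightarrow> X r \<omega> \<le> u"
  shows "eta_integral \<eta> A X t \<omega> = level_integral u t \<omega>"
  unfolding eta_integral_def level_integral_def
proof (intro nn_integral_cong)
  fix s
  have "extend_eta \<eta> (running_sup_left X s \<omega>) = eta_level u (running_sup_left X s \<omega>)" if s: "s \<in> {0<..t}"
  proof -
    have "running_sup_left X s \<omega> \<le> ennreal u"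
      using s u \<omega> le by (subst running_sup_left_le_iff) auto
    moreover from this have "running_sup_left X s \<omega> \<noteq> \<infinity>" by (auto simp: top_unique)
    ultimately show ?thesis by (simp add: extend_eta_def eta_level_def)
  qed
  then show "extend_eta \<eta> (running_sup_left X s \<omega>) * indicator {0<..t} s =
      eta_level u (running_sup_left X s \<omega>) * indicator {0<..t} s"
    by (auto simp: indicator_def)
qed

lemma level_integral_split:
  assumes \<omega>: "\<omega> \<in> space M" and st: "0 \<le> s" "s \<le> t" and u: "0 \<le> u"
  shows "level_integral u t \<omega> \<le> level_integral u s \<omega> + ennreal (\<eta> u * (A t - A s))"
proof -
  have m: "(\<lambda>s. eta_level u (sup_rat s \<omega>)) \<in> borel_measurable \<nu>"
    using measurable_compose[OF measurable_Pair2'[OF \<omega>, of borel] sup_rat_measurable] \<omega> by simp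
  have "level_integral u t \<omega> = (\<integral>\<^sup>+ r. eta_level u (sup_rat r \<omega>) * indicator {0<..s} r
      + eta_level u (sup_rat r \<omega>) * indicator {s<..t} r \<partial>\<nu>)"
    unfolding level_integral_eq_rat[OF \<omega>] using st by (intro nn_integral_cong) (auto simp: indicator_def)
  also have "\<dots> = level_integral u s \<omega> + (\<integral>\<^sup>+ r\<in>{s<..t}. eta_level u (sup_rat r \<omega>) \<partial>\<nu>)"
    unfolding level_integral_eq_rat[OF \<omega>] using m by (intro nn_integral_add) auto
  also have "(\<integral>\<^sup>+ r\<in>{s<..t}. eta_level u (sup_rat r \<omega>) \<partial>\<nu>) \<le> (\<integral>\<^sup>+ r. ennreal (\<eta> u) * indicator {s<..t} r \<partial>\<nu>)"
    using eta_level_le[OF u] by (intro nn_integral_mono mult_right_mono) auto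
  also have "\<dots> = ennreal (\<eta> u) * emeasure \<nu> {s<..t}"
    by (subst nn_integral_cmult_indicator) auto
  also have "\<dots> = ennreal (\<eta> u * (A t - A s))"
    using st u by (simp add: emeasure_\<nu> ennreal_mult A_le eta_nonneg)
  finally show ?thesis by (simp add: add_left_mono)
qed

end

lemma right_continuous_path_diff:
  "right_continuous_path f \<Longrightarrow> right_continuous_path g \<Longrightarrow> right_continuous_path (\<lambda>t. f t - g t)"
  by (auto simp: right_continuous_path_def intro: continuous_intros)

context bihari_power_setting
begin

lemma N_right_continuous: "\<omega> \<in> space M \<Longrightarrow> right_continuous_path (\<lambda>t. N t \<omega>)"
  using N_cadlag[of \<omega>] by (simp add: cadlag_path_def)

lemma H_right_continuous: "\<omega> \<in> space M \<Longrightarrow> right_continuous_path (\<lambda>t. H t \<omega>)"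
  using H_cadlag[of \<omega>] by (simp add: cadlag_path_def)

lemma H_le: "\<omega> \<in> space M \<Longrightarrow> 0 \<le> s \<Longrightarrow> s \<le> t \<Longrightarrow> H s \<omega> \<le> H t \<omega>"
  using mono_onD[OF H_mono[of \<omega>], of s t] by auto

lemma H_measurable: "0 \<le> t \<Longrightarrow> H t \<in> borel_measurable M"
  by (intro adapted_measurable predictable_adapted H_predictable)

lemma level_integral_real:
  "0 \<le> u \<Longrightarrow> 0 \<le> t \<Longrightarrow> ennreal (enn2real (level_integral u t \<omega>)) = level_integral u t \<omega>"
  by (intro ennreal_enn2real le_less_trans[OF level_integral_le]) auto

text \<open>The hypothesis on \<open>X\<close> holds at each time outside a null set that depends on
  that time. It is collected over rational times and carried to all times by right
  continuity.\<close>

lemma X_le_level_integral: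
  "AE \<omega> in M. \<forall>t u. 0 \<le> t \<longrightarrow> 0 \<le> u \<longrightarrow> (\<forall>r. 0 \<le> r \<and> r < t \<longrightarrow> X r \<omega> \<le> u) \<longrightarrow>
     X t \<omega> \<le> enn2real (level_integral u t \<omega>) + N t \<omega> + H t \<omega>"
proof -
  have "countable {q \<in> \<rat>. (0::real) \<le> q}" by (rule countable_subset[OF _ countable_rat]) auto
  then have "AE \<omega> in M. \<forall>q\<in>{q \<in> \<rat>. 0 \<le> q}.
      ereal (X q \<omega>) \<le> enn2ereal (eta_integral \<eta> A X q \<omega>) + ereal (N q \<omega>) + ereal (H q \<omega>)"
    by (subst AE_ball_countable) (auto intro: X_le)
  then show ?thesis
    using AE_space
  proof eventually_elim
    case (elim \<omega>)
    note \<omega> = elim(2)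
    show ?case
    proof (intro allI impI)
      fix t u assume t: "0 \<le> t" and u: "0 \<le> u" and le: "\<forall>r. 0 \<le> r \<and> r < t \<longrightarrow> X r \<omega> \<le> u"
      define L where "L = enn2real (level_integral u t \<omega>)"
      \<comment> \<open>Just after \<open>t\<close> the path may exceed \<open>u\<close>, but for a
        while it does not exceed \<open>C\<close>. Up to \<open>t\<close> the levels
        \<open>u\<close> and \<open>C\<close> give the same integral, and between \<open>t\<close>
        and \<open>q\<close> the level \<open>C\<close> costs at most
        \<open>\<eta> C * (A q - A t)\<close>, which vanishes as \<open>q\<close> decreases to
        \<open>t\<close>.\<close>
      define C where "C = max u (X t \<omega> + 1)"
      have C: "0 \<le> C" using u by (simp add: C_def)
      have "((\<lambda>r. X r \<omega>) \<longlongrightarrow> X t \<omega>) (at_right t)"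
        using X_right_continuous[OF \<omega>] t by (simp add: right_continuous_path_def continuous_within)
      then have "\<forall>\<^sub>F r in at_right t. X r \<omega> < X t \<omega> + 1"
        by (rule order_tendstoD) simp
      then obtain d where d: "t < d" "\<And>r. t < r \<Longrightarrow> r < d \<Longrightarrow> X r \<omega> < X t \<omega> + 1"
        by (auto simp: eventually_at_right_field)
      have XC: "X r \<omega> \<le> C" if "0 \<le> r" "r < d" for r
        using le d(2)[of r] that by (cases r t rule: linorder_cases) (auto simp: C_def)
      have eqt: "level_integral C t \<omega> = level_integral u t \<omega>"
        using eta_integral_eq_level_integral[OF \<omega> C, of t] eta_integral_eq_level_integral[OF \<omega> u, of t]
          XC le d(1) by auto
      have q: "X q \<omega> - N q \<omega> - H q \<omega> - \<eta> C * A q \<le> L - \<eta> C * A t" if "q \<in> \<rat>" "t < q" "q < d" for q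
      proof -
        have "eta_integral \<eta> A X q \<omega> = level_integral C q \<omega>"
          using that XC t by (intro eta_integral_eq_level_integral[OF \<omega> C]) auto
        also have "\<dots> \<le> level_integral C t \<omega> + ennreal (\<eta> C * (A q - A t))"
          using that t C by (intro level_integral_split[OF \<omega>]) auto
        also have "\<dots> = ennreal (L + \<eta> C * (A q - A t))"
          using level_integral_real[OF u t, of \<omega>] C A_le[of t q] that t
          by (subst ennreal_plus) (auto simp: L_def eqt eta_nonneg)
        finally have "enn2ereal (eta_integral \<eta> A X q \<omega>) \<le> enn2ereal (ennreal (L + \<eta> C * (A q - A t)))"
          by (simp add: less_eq_ennreal.rep_eq)
        also have "\<dots> = ereal (L + \<eta> C * (A q - A t))"
          using C A_le[of t q] that t by (intro enn2ereal_ennreal) (auto simp: L_def eta_nonneg)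
        finally have I: "enn2ereal (eta_integral \<eta> A X q \<omega>) \<le> ereal (L + \<eta> C * (A q - A t))" .
        have "ereal (X q \<omega>) \<le> enn2ereal (eta_integral \<eta> A X q \<omega>) + ereal (N q \<omega>) + ereal (H q \<omega>)"
          using elim(1) that t by auto
        also have "\<dots> \<le> ereal (L + \<eta> C * (A q - A t)) + ereal (N q \<omega>) + ereal (H q \<omega>)"
          by (intro add_right_mono I)
        finally show ?thesis by (simp add: algebra_simps)
      qed
      have "X t \<omega> - N t \<omega> - H t \<omega> - \<eta> C * A t \<le> L - \<eta> C * A t"
      proof (rule ccontr)
        assume "\<not> ?thesis"
        moreover have "right_continuous_path (\<lambda>t. X t \<omega> - N t \<omega> - H t \<omega> - \<eta> C * A t)"
        proof (intro right_continuous_path_diff X_right_continuous N_right_continuous H_right_continuous \<omega>)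
          show "right_continuous_path (\<lambda>t. \<eta> C * A t)"
            using A_cadlag unfolding cadlag_path_def right_continuous_path_def
            by (auto intro: continuous_intros)
        qed
        ultimately obtain q where "q \<in> \<rat>" "t < q" "q < d" "L - \<eta> C * A t < X q \<omega> - N q \<omega> - H q \<omega> - \<eta> C * A q"
          using right_continuous_rational_gt[of "\<lambda>t. X t \<omega> - N t \<omega> - H t \<omega> - \<eta> C * A t" t d "L - \<eta> C * A t"] t d(1)
          by (auto simp: not_le)
        then show False using q[of q] by simp
      qed
      then show "X t \<omega> \<le> enn2real (level_integral u t \<omega>) + N t \<omega> + H t \<omega>"
        by (simp add: L_def)
    qed
  qed
qed

text \<open>The default \<open>T + 1\<close> keeps the set nonempty and remains distinguishable from
  a passage at or before \<open>T\<close>.\<close>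

definition debut :: "real \<Rightarrow> real \<Rightarrow> 'a \<Rightarrow> real" where
  "debut T u \<omega> = Inf (insert (T + 1) {t. 0 \<le> t \<and> u < X t \<omega>})"

context
  fixes T u :: real
  assumes T: "0 < T" and u: "0 < u"
begin

lemma debut_less_iff: "debut T u \<omega> < t \<longleftrightarrow> T + 1 < t \<or> (\<exists>s. 0 \<le> s \<and> s < t \<and> u < X s \<omega>)"
proof -
  have "bdd_below (insert (T + 1) {t. 0 \<le> t \<and> u < X t \<omega>})"
    using T by (intro bdd_belowI[of _ 0]) auto
  then show ?thesis unfolding debut_def by (subst cInf_less_iff) auto
qed

lemma debut_nonneg: "0 \<le> debut T u \<omega>"
  using debut_less_iff[of \<omega> 0] T by (auto simp: not_less[symmetric])

lemma debut_stopping_time: "real_stopping_time (debut T u)"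
proof (rule real_stopping_time_lessI)
  fix t :: real assume t: "0 < t"
  let ?Q = "{q \<in> \<rat>. 0 \<le> q \<and> q < t}"
  have "(\<exists>s. 0 \<le> s \<and> s < t \<and> u < X s \<omega>) \<longleftrightarrow> (\<exists>q\<in>?Q. u < X q \<omega>)" if \<omega>: "\<omega> \<in> space M" for \<omega>
  proof
    assume "\<exists>s. 0 \<le> s \<and> s < t \<and> u < X s \<omega>"
    then obtain s where s: "0 \<le> s" "s < t" "u < X s \<omega>" by blast
    from right_continuous_rational_gt[OF X_right_continuous[OF \<omega>] this]
    obtain q where "q \<in> \<rat>" "s < q" "q < t" "u < X q \<omega>" .
    then show "\<exists>q\<in>?Q. u < X q \<omega>" using s by auto
  qed auto
  then have "{\<omega> \<in> space M. debut T u \<omega> < t} =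
      (if T + 1 < t then space M else (\<Union>q\<in>?Q. {\<omega> \<in> space M. u < X q \<omega>}))"
    by (auto simp: debut_less_iff)
  also have "\<dots> \<in> sets (F t)"
  proof -
    have "{\<omega> \<in> space M. u < X q \<omega>} \<in> sets (F t)" if "q \<in> ?Q" for q
    proof -
      have "X q -` {u<..} \<inter> space (F q) \<in> sets (F q)"
        using X_adapted that by (intro measurable_sets[where A = borel]) (auto simp: adapted_process_def)
      also have "X q -` {u<..} \<inter> space (F q) = {\<omega> \<in> space M. u < X q \<omega>}"
        using that space_F[of q] by auto
      finally show ?thesis using that F_mono[of q t] by auto
    qed
    moreover have "countable ?Q" by (rule countable_subset[OF _ countable_rat]) auto
    ultimately show ?thesis
      using space_in_F[of t] t by (auto intro!: sets.countable_UN'')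
  qed
  finally show "{\<omega> \<in> space M. debut T u \<omega> < t} \<in> sets (F t)" .
qed

lemma X_before_debut: "0 \<le> s \<Longrightarrow> s < debut T u \<omega> \<Longrightarrow> X s \<omega> \<le> u"
  using debut_less_iff[of \<omega> "debut T u \<omega>"] by (auto simp: not_less[symmetric])

text \<open>At the infimum \<open>X\<close> need not exceed \<open>u\<close>, but right continuity
  rules out a value below \<open>u\<close>.\<close>

lemma X_at_debut:
  assumes \<omega>: "\<omega> \<in> space M" and "debut T u \<omega> \<le> T"
  shows "u \<le> X (debut T u \<omega>) \<omega>"
proof (rule ccontr)
  assume "\<not> ?thesis"
  then have lt: "X (debut T u \<omega>) \<omega> < u" by simp
  let ?d = "debut T u \<omega>"
  have "((\<lambda>r. X r \<omega>) \<longlongrightarrow> X ?d \<omega>) (at_right ?d)"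
    using X_right_continuous[OF \<omega>] debut_nonneg by (simp add: right_continuous_path_def continuous_within)
  then have "\<forall>\<^sub>F r in at_right ?d. X r \<omega> < u" using lt by (rule order_tendstoD)
  then obtain b where b: "?d < b" "\<And>r. ?d < r \<Longrightarrow> r < b \<Longrightarrow> X r \<omega> < u"
    by (auto simp: eventually_at_right_field)
  have "?d < min b (T + 1)" using b assms by auto
  then obtain s where "0 \<le> s" "s < min b (T + 1)" "u < X s \<omega>"
    using debut_less_iff[of \<omega> "min b (T + 1)"] by auto
  then show False using X_before_debut[of s \<omega>] b(2)[of s] lt by (cases s ?d rule: linorder_cases) auto
qed

lemma debut_le:
  assumes "t \<in> {0..T}" "u < X t \<omega>"
  shows "debut T u \<omega> \<le> T"
proof -
  have "debut T u \<omega> \<le> t" using X_before_debut[of t \<omega>] assms by (auto simp: not_less[symmetric])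
  then show ?thesis using assms by simp
qed

text \<open>The time \<open>T\<close> has to be added to the rational times, because a value above
  \<open>u\<close> that is taken at \<open>T\<close> only would be missed.\<close>

lemma exceeds_sets: "{\<omega> \<in> space M. \<exists>t\<in>{0..T}. u < X t \<omega>} \<in> sets M"
proof -
  let ?Q = "insert T {q \<in> \<rat>. 0 \<le> q \<and> q < T}"
  have "(\<exists>t\<in>{0..T}. u < X t \<omega>) \<longleftrightarrow> (\<exists>q\<in>?Q. u < X q \<omega>)" if \<omega>: "\<omega> \<in> space M" for \<omega>
  proof
    assume "\<exists>t\<in>{0..T}. u < X t \<omega>"
    then obtain s where s: "0 \<le> s" "s \<le> T" "u < X s \<omega>" by auto
    show "\<exists>q\<in>?Q. u < X q \<omega>"
    proof (cases "s = T")
      case False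
      then obtain q where "q \<in> \<rat>" "s < q" "q < T" "u < X q \<omega>"
        using right_continuous_rational_gt[OF X_right_continuous[OF \<omega>], of s T u] s by auto
      then show ?thesis using s by auto
    qed (use s in auto)
  qed (use T in auto)
  then have "{\<omega> \<in> space M. \<exists>t\<in>{0..T}. u < X t \<omega>} = (\<Union>q\<in>?Q. {\<omega> \<in> space M. u < X q \<omega>})"
    by auto
  also have "\<dots> \<in> sets M"
  proof (rule sets.countable_UN'')
    show "countable ?Q" by (intro countable_insert countable_subset[OF _ countable_rat]) auto
    fix q assume "q \<in> ?Q"
    then have [measurable]: "X q \<in> borel_measurable M" using T by (intro X_measurable) auto
    show "{\<omega> \<in> space M. u < X q \<omega>} \<in> sets M" by measurable
  qed
  finally show ?thesis .
qed

text \<open>On paths with \<open>H 0 < v\<close>, the process \<open>H\<close> stays at most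
  \<open>min (H T) v\<close> up to the smaller of the debut and of a time announcing
  \<open>H \<ge> v\<close>. Stopping there loses only the paths with \<open>H T \<ge> v\<close> and
  rare false announcements.\<close>

lemma weak_type_inequality:
  assumes v: "0 < v"
  shows "ennreal u * emeasure M {\<omega> \<in> space M. \<exists>t\<in>{0..T}. u < X t \<omega>} \<le>
    (\<integral>\<^sup>+ \<omega>. level_integral u T \<omega> \<partial>M) + (\<integral>\<^sup>+ \<omega>. ennreal (min (H T \<omega>) v) \<partial>M) +
    ennreal u * emeasure M {\<omega> \<in> space M. v \<le> H T \<omega>}"
proof (rule ennreal_le_epsilon)
  fix e :: real assume "0 < e"
  \<comment> \<open>The probability of a false announcement is multiplied by \<open>u\<close> at the
    end, hence the budget \<open>e / u\<close>.\<close>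
  then have e': "0 < e / u" using u by simp
  obtain \<rho> where \<rho>: "real_stopping_time \<rho>" "\<And>\<omega>. 0 \<le> \<rho> \<omega> \<and> \<rho> \<omega> \<le> T"
    and \<rho>0: "\<And>\<omega>. v \<le> H 0 \<omega> \<Longrightarrow> \<rho> \<omega> = 0"
    and \<rho>H: "AE \<omega> in M. H 0 \<omega> < v \<longrightarrow> v \<le> H T \<omega> \<longrightarrow> H (\<rho> \<omega>) \<omega> < v"
    and \<rho>e: "measure M {\<omega> \<in> space M. \<rho> \<omega> < T \<and> H T \<omega> < v} \<le> e / u"
    using announce_level[OF H_predictable H_mono H_right_continuous T e', of v] by blast
  define \<theta> where "\<theta> \<omega> = min (debut T u \<omega>) (\<rho> \<omega>)" for \<omega>
  have \<theta>: "real_stopping_time \<theta>"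
    unfolding \<theta>_def[abs_def] by (intro real_stopping_time_min debut_stopping_time \<rho>(1))
  have \<theta>_bounds: "0 \<le> \<theta> \<omega> \<and> \<theta> \<omega> \<le> T" for \<omega>
    using debut_nonneg[of \<omega>] \<rho>(2)[of \<omega>] by (auto simp: \<theta>_def)
  note [measurable] = H_measurable[OF order_refl] H_measurable[OF less_imp_le[OF T]]
  \<comment> \<open>Since \<open>X \<ge> 0\<close>, before stopping \<open>N\<close> cannot fall
    below minus the bound for the drift plus \<open>H\<close>.\<close>
  define c where "c = \<eta> u * A T + v"
  have c: "0 \<le> c" using u v T by (simp add: c_def eta_nonneg A_nonneg)
  have level_le: "enn2real (level_integral u s \<omega>) \<le> \<eta> u * A T" if "0 \<le> s" "s \<le> T" for s \<omega>
  proof -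
    have "level_integral u s \<omega> \<le> ennreal (\<eta> u * A T)"
      using level_integral_mono[OF that(2)] level_integral_le[of u T] u T by (meson less_imp_le order_trans)
    then show ?thesis using u T by (intro enn2real_leI) (auto simp: eta_nonneg A_nonneg)
  qed
  have bounds: "AE \<omega> in M. H 0 \<omega> < v \<longrightarrow> (\<forall>s. 0 \<le> s \<and> s \<le> \<theta> \<omega> \<longrightarrow>
      X s \<omega> \<le> enn2real (level_integral u s \<omega>) + N s \<omega> + H s \<omega> \<and> H s \<omega> \<le> min (H T \<omega>) v)"
    using X_le_level_integral \<rho>H AE_space
  proof eventually_elim
    case (elim \<omega>)
    show ?case
    proof (intro allI impI)
      fix s assume H0: "H 0 \<omega> < v" and s: "0 \<le> s \<and> s \<le> \<theta> \<omega>"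
      have "X s \<omega> \<le> enn2real (level_integral u s \<omega>) + N s \<omega> + H s \<omega>"
        using elim(1) s u X_before_debut[of _ \<omega>] by (auto simp: \<theta>_def)
      moreover have "H s \<omega> \<le> H T \<omega>" using s \<theta>_bounds[of \<omega>] elim(3) by (intro H_le) auto
      moreover have "H s \<omega> \<le> v"
      proof (cases "v \<le> H T \<omega>")
        case True
        have "H s \<omega> \<le> H (\<rho> \<omega>) \<omega>" using s elim(3) by (intro H_le) (auto simp: \<theta>_def)
        then show ?thesis using True H0 elim(2) by simp
      qed (use \<open>H s \<omega> \<le> H T \<omega>\<close> in simp)
      ultimately show "X s \<omega> \<le> enn2real (level_integral u s \<omega>) + N s \<omega> + H s \<omega> \<and> H s \<omega> \<le> min (H T \<omega>) v"
        by simp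
    qed
  qed
  have lower: "AE \<omega> in M. \<forall>s. 0 \<le> s \<and> s \<le> \<theta> \<omega> \<longrightarrow> - c \<le> N s \<omega>"
    using bounds AE_space
  proof eventually_elim
    case (elim \<omega>)
    show ?case
    proof (intro allI impI)
      fix s assume s: "0 \<le> s \<and> s \<le> \<theta> \<omega>"
      show "- c \<le> N s \<omega>"
      proof (cases "H 0 \<omega> < v")
        case True
        then have "X s \<omega> \<le> enn2real (level_integral u s \<omega>) + N s \<omega> + H s \<omega>" "H s \<omega> \<le> v"
          using elim(1) s by auto
        then show ?thesis
          using X_nonneg[of s \<omega>] level_le[of s \<omega>] s \<theta>_bounds[of \<omega>] elim(2) unfolding c_def by linarith
      next
        case False
        \<comment> \<open>For \<open>v \<le> H 0\<close> the announcement is immediate, and only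
          \<open>N 0 = 0\<close> is looked at.\<close>
        then have "s = 0" using s \<rho>0[of \<omega>] debut_nonneg[of \<omega>] by (simp add: \<theta>_def)
        then show ?thesis using N_zero[OF elim(2)] c by simp
      qed
    qed
  qed
  have stop: "(\<integral>\<^sup>+ \<omega>. ennreal (N (\<theta> \<omega>) \<omega> + c + 1) \<partial>M) \<le> ennreal (c + 1)"
    by (rule optional_stopping_local_martingale[OF \<theta> \<theta>_bounds T N_local_martingale N_right_continuous N_zero lower])
  have [measurable]: "(\<lambda>\<omega>. N (\<theta> \<omega>) \<omega>) \<in> borel_measurable M"
    using N_local_martingale
    by (intro process_at_stopping_time_measurable[OF \<theta> \<theta>_bounds T] N_right_continuous)
      (auto simp: local_martingale_def)
  \<comment> \<open>The paths that exceed \<open>u\<close> and are not stopped early: there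
    \<open>\<rho> = T\<close>, so \<open>\<theta>\<close> is the debut, where \<open>X\<close> is at
    least \<open>u\<close>.\<close>
  define G where "G = {\<omega> \<in> space M. H 0 \<omega> < v \<and> H T \<omega> < v \<and> (\<exists>t\<in>{0..T}. u < X t \<omega>) \<and> \<not> (\<rho> \<omega> < T)}"
  have \<rho>T: "{\<omega> \<in> space M. \<rho> \<omega> < T} \<in> sets M"
    using \<rho> T by (intro sets_F_subset[of T] real_stopping_time_less_sets) auto
  have G: "G \<in> sets M"
  proof -
    have "G = ({\<omega> \<in> space M. H 0 \<omega> < v \<and> H T \<omega> < v} \<inter> {\<omega> \<in> space M. \<exists>t\<in>{0..T}. u < X t \<omega>}) - {\<omega> \<in> space M. \<rho> \<omega> < T}"
      by (auto simp: G_def)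
    also have "\<dots> \<in> sets M"
      by (intro sets.Diff sets.Int exceeds_sets \<rho>T) measurable
    finally show ?thesis .
  qed
  \<comment> \<open>Adding \<open>c + 1\<close> on both sides makes the martingale term nonnegative;
    the constant is cancelled after integration.\<close>
  have "AE \<omega> in M. ennreal u * indicator G \<omega> + ennreal (c + 1) \<le>
      level_integral u T \<omega> + ennreal (min (H T \<omega>) v) + ennreal (N (\<theta> \<omega>) \<omega> + c + 1)"
    using bounds lower AE_space
  proof eventually_elim
    case (elim \<omega>)
    let ?L = "enn2real (level_integral u T \<omega>)"
    have N: "0 \<le> N (\<theta> \<omega>) \<omega> + c + 1" using elim(2) \<theta>_bounds[of \<omega>] by (auto dest: spec[of _ "\<theta> \<omega>"])
    have Hn: "0 \<le> min (H T \<omega>) v" using H_nonneg[of T \<omega>] v T elim(3) by simp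
    have "u * indicator G \<omega> + (c + 1) \<le> ?L + min (H T \<omega>) v + (N (\<theta> \<omega>) \<omega> + c + 1)"
    proof (cases "H 0 \<omega> < v")
      case True
      then have *: "X (\<theta> \<omega>) \<omega> \<le> enn2real (level_integral u (\<theta> \<omega>) \<omega>) + N (\<theta> \<omega>) \<omega> + H (\<theta> \<omega>) \<omega>"
        "H (\<theta> \<omega>) \<omega> \<le> min (H T \<omega>) v"
        using elim(1) \<theta>_bounds[of \<omega>] by auto
      have "level_integral u T \<omega> < \<infinity>" using u T by (intro le_less_trans[OF level_integral_le]) auto
      then have L: "enn2real (level_integral u (\<theta> \<omega>) \<omega>) \<le> ?L"
        using \<theta>_bounds[of \<omega>] by (intro enn2real_mono level_integral_mono) (auto simp: less_top)
      have "u * indicator G \<omega> \<le> X (\<theta> \<omega>) \<omega>"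
      proof (cases "\<omega> \<in> G")
        case True
        then have "debut T u \<omega> \<le> T" "\<rho> \<omega> = T" using debut_le[of _ \<omega>] \<rho>(2)[of \<omega>] by (auto simp: G_def)
        then show ?thesis using True X_at_debut[OF elim(3)] by (simp add: \<theta>_def)
      next
        case False
        then show ?thesis using X_nonneg[of "\<theta> \<omega>" \<omega>] \<theta>_bounds[of \<omega>] elim(3) by simp
      qed
      then show ?thesis using * L by linarith
    next
      case False
      then have "\<theta> \<omega> = 0" using \<rho>0[of \<omega>] debut_nonneg[of \<omega>] by (simp add: \<theta>_def)
      then show ?thesis using N_zero[OF elim(3)] Hn False by (simp add: G_def)
    qed
    then have "ennreal (u * indicator G \<omega> + (c + 1)) \<le> ennreal (?L + min (H T \<omega>) v + (N (\<theta> \<omega>) \<omega> + c + 1))"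
      by (rule ennreal_leI)
    moreover have "ennreal (u * indicator G \<omega> + (c + 1)) = ennreal u * indicator G \<omega> + ennreal (c + 1)"
      using u c by (auto simp: ennreal_plus indicator_def)
    moreover have "ennreal (?L + min (H T \<omega>) v + (N (\<theta> \<omega>) \<omega> + c + 1)) =
        ennreal ?L + ennreal (min (H T \<omega>) v) + ennreal (N (\<theta> \<omega>) \<omega> + c + 1)"
      using N Hn by (subst ennreal_plus; simp add: ennreal_plus)+
    moreover have "ennreal ?L = level_integral u T \<omega>" using u T by (intro level_integral_real) auto
    ultimately show ?case by simp
  qed
  then have "(\<integral>\<^sup>+ \<omega>. ennreal u * indicator G \<omega> + ennreal (c + 1) \<partial>M) \<le>
      (\<integral>\<^sup>+ \<omega>. level_integral u T \<omega> + ennreal (min (H T \<omega>) v) + ennreal (N (\<theta> \<omega>) \<omega> + c + 1) \<partial>M)"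
    by (rule nn_integral_mono_AE)
  also have "(\<integral>\<^sup>+ \<omega>. ennreal u * indicator G \<omega> + ennreal (c + 1) \<partial>M) = ennreal u * emeasure M G + ennreal (c + 1)"
    using G by (subst nn_integral_add) (auto simp: nn_integral_cmult_indicator emeasure_space_1)
  also have "(\<integral>\<^sup>+ \<omega>. level_integral u T \<omega> + ennreal (min (H T \<omega>) v) + ennreal (N (\<theta> \<omega>) \<omega> + c + 1) \<partial>M) =
      (\<integral>\<^sup>+ \<omega>. level_integral u T \<omega> \<partial>M) + (\<integral>\<^sup>+ \<omega>. ennreal (min (H T \<omega>) v) \<partial>M) + (\<integral>\<^sup>+ \<omega>. ennreal (N (\<theta> \<omega>) \<omega> + c + 1) \<partial>M)"
    by (subst nn_integral_add; (subst nn_integral_add)?; simp)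
  also have "\<dots> \<le> (\<integral>\<^sup>+ \<omega>. level_integral u T \<omega> \<partial>M) + (\<integral>\<^sup>+ \<omega>. ennreal (min (H T \<omega>) v) \<partial>M) + ennreal (c + 1)"
    by (intro add_left_mono stop)
  finally have uG: "ennreal u * emeasure M G \<le> (\<integral>\<^sup>+ \<omega>. level_integral u T \<omega> \<partial>M) + (\<integral>\<^sup>+ \<omega>. ennreal (min (H T \<omega>) v) \<partial>M)"
    by (simp add: ennreal_add_left_cancel_le add.commute[of _ "ennreal (c + 1)"])
  let ?B = "{\<omega> \<in> space M. v \<le> H T \<omega>}" and ?E = "{\<omega> \<in> space M. \<rho> \<omega> < T \<and> H T \<omega> < v}"
  have E: "?E \<in> sets M"
  proof -
    have "?E = {\<omega> \<in> space M. \<rho> \<omega> < T} \<inter> {\<omega> \<in> space M. H T \<omega> < v}" by auto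
    also have "\<dots> \<in> sets M" by (intro sets.Int \<rho>T) measurable
    finally show ?thesis .
  qed
  have "emeasure M {\<omega> \<in> space M. \<exists>t\<in>{0..T}. u < X t \<omega>} \<le> emeasure M ((G \<union> ?B) \<union> ?E)"
  proof (rule emeasure_mono)
    show "{\<omega> \<in> space M. \<exists>t\<in>{0..T}. u < X t \<omega>} \<subseteq> (G \<union> ?B) \<union> ?E"
      using H_le[of _ 0 T] T by (fastforce simp: G_def)
    show "(G \<union> ?B) \<union> ?E \<in> sets M" by (intro sets.Un G E) measurable
  qed
  also have "\<dots> \<le> emeasure M (G \<union> ?B) + emeasure M ?E"
    by (intro emeasure_subadditive sets.Un G E) measurable
  also have "\<dots> \<le> (emeasure M G + emeasure M ?B) + ennreal (e / u)"
    using \<rho>e by (intro add_mono emeasure_subadditive G) (auto simp: emeasure_eq_measure ennreal_leI)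
  finally have "ennreal u * emeasure M {\<omega> \<in> space M. \<exists>t\<in>{0..T}. u < X t \<omega>} \<le>
      ennreal u * ((emeasure M G + emeasure M ?B) + ennreal (e / u))"
    by (rule mult_left_mono) simp
  also have "\<dots> = ennreal u * emeasure M G + ennreal u * emeasure M ?B + ennreal e"
    using u \<open>0 < e\<close> by (simp add: distrib_left ennreal_mult[symmetric])
  also have "\<dots> \<le> ((\<integral>\<^sup>+ \<omega>. level_integral u T \<omega> \<partial>M) + (\<integral>\<^sup>+ \<omega>. ennreal (min (H T \<omega>) v) \<partial>M)) + ennreal u * emeasure M ?B + ennreal e"
    by (intro add_right_mono uG)
  finally show "ennreal u * emeasure M {\<omega> \<in> space M. \<exists>t\<in>{0..T}. u < X t \<omega>} \<le>
    (\<integral>\<^sup>+ \<omega>. level_integral u T \<omega> \<partial>M) + (\<integral>\<^sup>+ \<omega>. ennreal (min (H T \<omega>) v) \<partial>M) + ennreal u * emeasure M ?B + ennreal e" .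
qed

end

end

section \<open>Moments\<close>

lemma nn_integral_powr_below:
  fixes p z :: real
  assumes p: "0 < p" and z: "0 \<le> z"
  shows "(\<integral>\<^sup>+ u. ennreal (p * u powr (p - 1)) * indicator {0..z} u \<partial>lborel) = ennreal (z powr p)"
proof -
  have "((\<lambda>u. p * u powr (p - 1)) has_integral p * (z powr (p - 1 + 1) / (p - 1 + 1))) {0..z}"
    using p z by (intro has_integral_mult_right has_integral_powr_from_0) auto
  from nn_integral_has_integral_lebesgue'[OF _ this] p show ?thesis by simp
qed

lemma nn_integral_powr_above:
  fixes p z :: real
  assumes p: "0 < p" "p < 1" and z: "0 < z"
  shows "(\<integral>\<^sup>+ u. ennreal (p * u powr (p - 2)) * indicator {z..} u \<partial>lborel) = ennreal (p / (1 - p) * z powr (p - 1))"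
proof -
  have "((\<lambda>u. p * u powr (p - 2)) has_integral p * (- (z powr (p - 2 + 1)) / (p - 2 + 1))) {z..}"
    using p z by (intro has_integral_mult_right has_integral_powr_to_inf) auto
  from nn_integral_has_integral_lebesgue'[OF _ this] p
  have "(\<integral>\<^sup>+ u. ennreal (p * u powr (p - 2)) * indicator {z..} u \<partial>lborel) = ennreal (p * (- (z powr (p - 2 + 1)) / (p - 2 + 1)))"
    by simp
  also have "p * (- (z powr (p - 2 + 1)) / (p - 2 + 1)) = p / (1 - p) * z powr (p - 1)"
  proof -
    have "p - 2 + 1 = p - 1" by simp
    then show ?thesis using p by (simp add: field_simps)
  qed
  finally show ?thesis .
qed

text \<open>The threshold \<open>p * u\<close> for the dominating variable is the one that minimises the constant.\<close>

lemma nn_integral_threshold_le: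
  fixes p h :: real
  assumes p: "0 < p" "p < 1" and h: "0 \<le> h"
  shows "(\<integral>\<^sup>+ u. (ennreal (p * u powr (p - 2) * min h (p * u)) + ennreal (p * u powr (p - 1)) * indicator {p * u..} h)
      * indicator {0<..} u \<partial>lborel) \<le> ennreal (p powr (- p) / (1 - p) * h powr p)"
proof (cases "h = 0")
  case True
  have eq: "(ennreal (p * u powr (p - 2) * min h (p * u)) + ennreal (p * u powr (p - 1)) * indicator {p * u..} h)
      * indicator {0<..} u = 0" for u
    using True p by (auto simp: indicator_def mult_le_0_iff)
  show ?thesis unfolding eq by simp
next
  case False
  then have h: "0 < h" using h by simp
  \<comment> \<open>The threshold \<open>p * u\<close> passes \<open>h\<close> at this point. To its
    left the minimum is \<open>p * u\<close> and the indicator is 1; to its right the minimum is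
    \<open>h\<close> and the indicator is 0.\<close>
  let ?z = "h / p"
  have z: "0 < ?z" using h p by simp
  have le: "(ennreal (p * u powr (p - 2) * min h (p * u)) + ennreal (p * u powr (p - 1)) * indicator {p * u..} h) * indicator {0<..} u
      \<le> ennreal (p + 1) * (ennreal (p * u powr (p - 1)) * indicator {0..?z} u) +
        ennreal h * (ennreal (p * u powr (p - 2)) * indicator {?z..} u)" (is "?l \<le> ?r") for u
  proof (cases "0 < u")
    case u: True
    have pw: "u powr (p - 2) * u = u powr (p - 1)"
      using powr_mult_base[of u "p - 2"] u by (simp add: mult.commute)
    show ?thesis
    proof (cases "p * u \<le> h")
      case True
      have e: "p * u powr (p - 2) * min h (p * u) = p * (p * u powr (p - 1))"
        unfolding pw[symmetric] using True by (simp add: min_absorb2)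
      have "?l = ennreal (p * (p * u powr (p - 1))) + ennreal (p * u powr (p - 1))"
        unfolding e using True u by simp
      also have "\<dots> = ennreal (p * (p * u powr (p - 1)) + p * u powr (p - 1))"
        using p by (intro ennreal_plus[symmetric]) auto
      also have "\<dots> = ennreal (p + 1) * ennreal (p * u powr (p - 1))"
        using p by (simp add: ennreal_mult[symmetric] algebra_simps)
      also have "\<dots> \<le> ?r" using True u p by (simp add: pos_le_divide_eq mult.commute)
      finally show ?thesis .
    next
      case False
      then have "?l = ennreal (h * (p * u powr (p - 2)))"
        using u by (simp add: min_absorb1 mult_ac)
      also have "\<dots> = ennreal h * ennreal (p * u powr (p - 2))"
        using h p by (intro ennreal_mult) auto
      also have "\<dots> \<le> ?r" using False u p by (simp add: pos_divide_le_eq mult.commute)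
      finally show ?thesis .
    qed
  qed simp
  have "(\<integral>\<^sup>+ u. (ennreal (p * u powr (p - 2) * min h (p * u)) + ennreal (p * u powr (p - 1)) * indicator {p * u..} h)
      * indicator {0<..} u \<partial>lborel) \<le> (\<integral>\<^sup>+ u. ennreal (p + 1) * (ennreal (p * u powr (p - 1)) * indicator {0..?z} u) +
        ennreal h * (ennreal (p * u powr (p - 2)) * indicator {?z..} u) \<partial>lborel)"
    by (intro nn_integral_mono le)
  also have "\<dots> = ennreal (p + 1) * ennreal (?z powr p) + ennreal h * ennreal (p / (1 - p) * ?z powr (p - 1))"
    using nn_integral_powr_below[of p ?z] nn_integral_powr_above[of p ?z] p z
    by (simp add: nn_integral_add nn_integral_cmult)
  also have "\<dots> = ennreal ((p + 1) * ?z powr p + h * (p / (1 - p) * ?z powr (p - 1)))"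
  proof -
    have "ennreal (p + 1) * ennreal (?z powr p) = ennreal ((p + 1) * ?z powr p)"
      using p by (intro ennreal_mult[symmetric]) auto
    moreover have "ennreal h * ennreal (p / (1 - p) * ?z powr (p - 1)) = ennreal (h * (p / (1 - p) * ?z powr (p - 1)))"
      using p h by (intro ennreal_mult[symmetric]) auto
    moreover have "0 \<le> (p + 1) * ?z powr p" "0 \<le> h * (p / (1 - p) * ?z powr (p - 1))"
      using p h by auto
    ultimately show ?thesis by (simp only: ennreal_plus)
  qed
  also have "h * (p / (1 - p) * ?z powr (p - 1)) = p * p / (1 - p) * (?z powr (p - 1) * ?z)"
    using p by (simp add: field_simps)
  also have "?z powr (p - 1) * ?z = ?z powr p"
    using powr_mult_base[of ?z "p - 1"] z by (simp add: mult.commute)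
  also have "(p + 1) * ?z powr p + p * p / (1 - p) * ?z powr p = 1 / (1 - p) * ?z powr p"
  proof -
    have "(p + 1) + p * p / (1 - p) = 1 / (1 - p)" using p by (simp add: field_simps)
    then show ?thesis by (metis distrib_right)
  qed
  also have "\<dots> = p powr (- p) / (1 - p) * h powr p"
    using p h by (simp add: powr_divide powr_minus field_simps)
  finally show ?thesis .
qed

text \<open>Real-valued even at \<infinity>, where it equals \<open>b\<close> for
  \<open>b \<ge> 0\<close>, so that p-th powers have finite integrals.\<close>

definition trunc :: "real \<Rightarrow> ennreal \<Rightarrow> real" where
  "trunc b x = enn2real (min (ennreal b) x)"

lemma trunc_measurable [measurable]: "trunc b \<in> borel_measurable borel"
  unfolding trunc_def[abs_def] by measurable

lemma trunc_bounds: "0 \<le> b \<Longrightarrow> 0 \<le> trunc b x \<and> trunc b x \<le> b"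
  by (auto simp: trunc_def intro!: enn2real_leI)

lemma ennreal_trunc: "ennreal (trunc b x) = min (ennreal b) x"
  by (simp add: trunc_def min_less_iff_disj)

lemma less_trunc_iff: "0 \<le> u \<Longrightarrow> 0 \<le> b \<Longrightarrow> u < trunc b x \<longleftrightarrow> u < b \<and> ennreal u < x"
  using ennreal_less_iff[of u "trunc b x"] by (simp add: ennreal_trunc ennreal_less_iff)

context bihari_power_setting
begin

definition Xmax :: "real \<Rightarrow> 'a \<Rightarrow> ennreal" where
  "Xmax T \<omega> = (SUP t\<in>{0..T}. ennreal (X t \<omega>))"

lemma Xmax_eq:
  assumes T: "0 < T" and \<omega>: "\<omega> \<in> space M"
  shows "Xmax T \<omega> = max (sup_rat T \<omega>) (ennreal (X T \<omega>))"
proof -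
  have "{0..T} = insert T {0..<T}" using T by auto
  then have "Xmax T \<omega> = max (ennreal (X T \<omega>)) (SUP t\<in>{0..<T}. ennreal (X t \<omega>))"
    by (simp add: Xmax_def sup_max)
  then show ?thesis
    using running_sup_left_eq_sup_rat[OF assms] T by (simp add: running_sup_left_def max.commute)
qed

lemma sup_rat_measurable' [measurable (raw)]:
  assumes [measurable]: "f \<in> borel_measurable L" "g \<in> L \<rightarrow>\<^sub>M M"
  shows "(\<lambda>x. sup_rat (f x) (g x)) \<in> borel_measurable L"
  using measurable_compose[OF measurable_Pair[OF assms] sup_rat_measurable] by simp

lemma eta_level_measurable' [measurable (raw)]:
  assumes [measurable]: "f \<in> borel_measurable L" "g \<in> borel_measurable L"
  shows "(\<lambda>x. eta_level (f x) (g x)) \<in> borel_measurable L"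
proof -
  have [measurable]: "(\<lambda>x. \<eta> (enn2real (g x))) \<in> borel_measurable L"
    by (rule measurable_compose[OF assms(2) eta_measurable])
  show ?thesis unfolding eta_level_def by measurable
qed

lemma Xmax_measurable: "0 < T \<Longrightarrow> Xmax T \<in> borel_measurable M"
proof (subst measurable_cong[OF Xmax_eq], assumption)
  assume T: "0 < T"
  have [measurable]: "X T \<in> borel_measurable M" using T by (intro X_measurable) auto
  show "(\<lambda>\<omega>. max (sup_rat T \<omega>) (ennreal (X T \<omega>))) \<in> borel_measurable M" by measurable
qed

text \<open>For \<open>0 < x < b\<close> the range of \<open>u\<close> is enlarged from
  \<open>[x, b)\<close> to \<open>[x, \<infinity>)\<close>, where the integral is explicit. For
  \<open>x \<ge> b\<close> the integrand vanishes at all levels below \<open>b\<close>.\<close>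

lemma nn_integral_eta_level_le:
  assumes b: "0 < b"
  shows "(\<integral>\<^sup>+ u. ennreal (p * u powr (p - 2)) * indicator {0<..<b} u * eta_level u x \<partial>lborel) \<le>
    ennreal (eta.ep (trunc b x powr p))"
proof (cases "x < ennreal b \<and> x \<noteq> 0")
  case True
  then obtain r where x: "x = ennreal r" and r: "0 < r" "r < b"
    by (cases x) (auto simp: ennreal_less_iff)
  have "(\<integral>\<^sup>+ u. ennreal (p * u powr (p - 2)) * indicator {0<..<b} u * eta_level u x \<partial>lborel) \<le>
      (\<integral>\<^sup>+ u. ennreal (\<eta> r) * (ennreal (p * u powr (p - 2)) * indicator {r..} u) \<partial>lborel)"
    using r by (intro nn_integral_mono) (auto simp: eta_level_def x indicator_def mult_ac)
  also have "\<dots> = ennreal (\<eta> r) * ennreal (p / (1 - p) * r powr (p - 1))"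
    using p_pos p_less_1 r by (subst nn_integral_cmult) (auto simp: nn_integral_powr_above)
  also have "\<dots> = ennreal (\<eta> r * (p / (1 - p) * r powr (p - 1)))"
    using p_pos p_less_1 r eta_nonneg[of r] by (intro ennreal_mult[symmetric]) auto
  also have "\<eta> r * (p / (1 - p) * r powr (p - 1)) = eta.ep (r powr p)"
  proof -
    have "(r powr p) powr (1 / p) = r" "(r powr p) powr (1 - 1 / p) = r powr (p - 1)"
      using r p_pos by (simp_all add: powr_powr algebra_simps)
    then show ?thesis by (simp add: eta_p_def)
  qed
  also have "r = trunc b x" using r by (simp add: trunc_def x min_def)
  finally show ?thesis .
next
  case False
  have eq: "ennreal (p * u powr (p - 2)) * indicator {0<..<b} u * eta_level u x = 0" for u
  proof (cases "x = 0")
    case True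
    then show ?thesis using eta.eta_0 by (simp add: eta_level_def)
  next
    case neq: False
    have "\<not> x \<le> ennreal u" if "u < b" "0 < u"
    proof
      assume "x \<le> ennreal u"
      also have "\<dots> < ennreal b" using that by (simp add: ennreal_less_iff)
      finally show False using False neq by simp
    qed
    then show ?thesis by (auto simp: eta_level_def indicator_def)
  qed
  show ?thesis unfolding eq by simp
qed

text \<open>Layer-cake formula, with the weak type inequality used at \<open>v = p * u\<close> for
  each level \<open>u < b\<close>. The exchanges of integrals move \<open>u\<close> to the innermost
  place, where both terms can be evaluated path by path.\<close>

lemma truncated_moment_le:
  assumes T: "0 < T" and b: "0 < b"
  shows "(\<integral>\<^sup>+ \<omega>. ennreal (trunc b (Xmax T \<omega>) powr p) \<partial>M) \<le>
    (\<integral>\<^sup>+ \<omega>. ennreal (p powr (- p) / (1 - p) * H T \<omega> powr p) \<partial>M) +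
    (\<integral>\<^sup>+ s\<in>{0<..T}. (\<integral>\<^sup>+ \<omega>. ennreal (eta.ep (trunc b (sup_rat s \<omega>) powr p)) \<partial>M) \<partial>\<nu>)"
proof -
  interpret pl: pair_sigma_finite M lborel
    by (intro pair_sigma_finite.intro sigma_finite_measure_axioms sigma_finite_lborel)
  interpret pn: pair_sigma_finite M \<nu>
    by (intro pair_sigma_finite.intro sigma_finite_measure_axioms nu.sigma_finite_measure_axioms)
  interpret nl: pair_sigma_finite \<nu> lborel
    by (intro pair_sigma_finite.intro nu.sigma_finite_measure_axioms sigma_finite_lborel)
  have [measurable]: "H T \<in> borel_measurable M" using T by (intro H_measurable) auto
  have [measurable]: "Xmax T \<in> borel_measurable M" by (rule Xmax_measurable[OF T])
  define I where "I u = (indicator {0<..<b} u :: ennreal)" for u :: real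
  have [measurable]: "I \<in> borel_measurable borel" unfolding I_def[abs_def] by simp
  define c where "c u = ennreal (p * u powr (p - 2))" for u
  have [measurable]: "c \<in> borel_measurable borel" unfolding c_def[abs_def] by simp
  have cu: "c u * ennreal u = ennreal (p * u powr (p - 1))" if "0 < u" for u
  proof -
    have "p * u powr (p - 2) * u = p * u powr (p - 1)"
      using powr_mult_base[of u "p - 2"] that by (simp add: mult.commute mult.left_commute)
    then show ?thesis using p_pos that by (simp add: c_def ennreal_mult[symmetric])
  qed
  let ?P = "\<lambda>u. emeasure M {\<omega> \<in> space M. \<exists>t\<in>{0..T}. u < X t \<omega>}"
  have ex_iff: "(\<exists>t\<in>{0..T}. u < X t \<omega>) \<longleftrightarrow> ennreal u < Xmax T \<omega>" if "0 \<le> u" for u \<omega>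
    using that by (auto simp: Xmax_def less_SUP_iff ennreal_less_iff)
  have "(\<integral>\<^sup>+ \<omega>. ennreal (trunc b (Xmax T \<omega>) powr p) \<partial>M) =
      (\<integral>\<^sup>+ \<omega>. (\<integral>\<^sup>+ u. I u * ennreal (p * u powr (p - 1)) * (if ennreal u < Xmax T \<omega> then 1 else 0) \<partial>lborel) \<partial>M)"
  proof (intro nn_integral_cong)
    fix \<omega>
    let ?z = "trunc b (Xmax T \<omega>)"
    have "ennreal (?z powr p) = (\<integral>\<^sup>+ u. ennreal (p * u powr (p - 1)) * indicator {0..?z} u \<partial>lborel)"
      using p_pos b trunc_bounds[of b "Xmax T \<omega>"] by (intro nn_integral_powr_below[symmetric]) auto
    also have "\<dots> = (\<integral>\<^sup>+ u. I u * ennreal (p * u powr (p - 1)) * (if ennreal u < Xmax T \<omega> then 1 else 0) \<partial>lborel)"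
    proof (rule nn_integral_cong_AE)
      show "AE u in lborel. ennreal (p * u powr (p - 1)) * indicator {0..?z} u =
          I u * ennreal (p * u powr (p - 1)) * (if ennreal u < Xmax T \<omega> then 1 else 0)"
        using AE_lborel_singleton[of 0] AE_lborel_singleton[of ?z]
      proof eventually_elim
        case (elim u)
        then have "u \<in> {0..?z} \<longleftrightarrow> 0 < u \<and> u < ?z" by auto
        also have "\<dots> \<longleftrightarrow> 0 < u \<and> u < b \<and> ennreal u < Xmax T \<omega>"
          using less_trunc_iff[of u b "Xmax T \<omega>"] b by auto
        finally show ?case by (simp add: I_def indicator_def)
      qed
    qed
    finally show "ennreal (?z powr p) = (\<integral>\<^sup>+ u. I u * ennreal (p * u powr (p - 1)) * (if ennreal u < Xmax T \<omega> then 1 else 0) \<partial>lborel)" .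
  qed
  also have "\<dots> = (\<integral>\<^sup>+ u. (\<integral>\<^sup>+ \<omega>. I u * ennreal (p * u powr (p - 1)) * (if ennreal u < Xmax T \<omega> then 1 else 0) \<partial>M) \<partial>lborel)"
    by (rule pl.Fubini'[symmetric]) measurable
  also have "\<dots> \<le> (\<integral>\<^sup>+ u. I u * c u * (\<integral>\<^sup>+ \<omega>. level_integral u T \<omega> \<partial>M) +
      (\<integral>\<^sup>+ \<omega>. (ennreal (p * u powr (p - 2) * min (H T \<omega>) (p * u)) + ennreal (p * u powr (p - 1)) * indicator {p * u..} (H T \<omega>))
      * indicator {0<..} u \<partial>M) \<partial>lborel)"
  proof (rule nn_integral_mono)
    fix u :: real
    let ?B = "{\<omega> \<in> space M. p * u \<le> H T \<omega>}"
    show "(\<integral>\<^sup>+ \<omega>. I u * ennreal (p * u powr (p - 1)) * (if ennreal u < Xmax T \<omega> then 1 else 0) \<partial>M) \<le>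
      I u * c u * (\<integral>\<^sup>+ \<omega>. level_integral u T \<omega> \<partial>M) +
      (\<integral>\<^sup>+ \<omega>. (ennreal (p * u powr (p - 2) * min (H T \<omega>) (p * u)) + ennreal (p * u powr (p - 1)) * indicator {p * u..} (H T \<omega>))
      * indicator {0<..} u \<partial>M)"
    proof (cases "0 < u \<and> u < b")
      case True
      then have u: "0 < u" and Iu: "I u = 1" by (auto simp: I_def)
      have "(\<integral>\<^sup>+ \<omega>. I u * ennreal (p * u powr (p - 1)) * (if ennreal u < Xmax T \<omega> then 1 else 0) \<partial>M) =
          (\<integral>\<^sup>+ \<omega>. ennreal (p * u powr (p - 1)) * indicator {\<omega> \<in> space M. \<exists>t\<in>{0..T}. u < X t \<omega>} \<omega> \<partial>M)"
        using ex_iff[of u] u Iu by (intro nn_integral_cong) (auto simp: indicator_def)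
      also have "\<dots> = ennreal (p * u powr (p - 1)) * ?P u"
        by (rule nn_integral_cmult_indicator[OF exceeds_sets[OF T u]])
      also have "\<dots> = c u * (ennreal u * ?P u)" by (simp add: cu[OF u, symmetric] mult.assoc)
      also have "\<dots> \<le> c u * ((\<integral>\<^sup>+ \<omega>. level_integral u T \<omega> \<partial>M) + (\<integral>\<^sup>+ \<omega>. ennreal (min (H T \<omega>) (p * u)) \<partial>M) +
          ennreal u * emeasure M ?B)"
        using u p_pos by (intro mult_left_mono weak_type_inequality T) auto
      also have "\<dots> = c u * (\<integral>\<^sup>+ \<omega>. level_integral u T \<omega> \<partial>M) +
          ((\<integral>\<^sup>+ \<omega>. c u * ennreal (min (H T \<omega>) (p * u)) \<partial>M) + ennreal (p * u powr (p - 1)) * emeasure M ?B)"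
        by (simp add: distrib_left nn_integral_cmult cu[OF u, symmetric] mult.assoc add.assoc)
      also have "ennreal (p * u powr (p - 1)) * emeasure M ?B = (\<integral>\<^sup>+ \<omega>. ennreal (p * u powr (p - 1)) * indicator ?B \<omega> \<partial>M)"
        by (rule nn_integral_cmult_indicator[symmetric]) measurable
      also have "(\<integral>\<^sup>+ \<omega>. c u * ennreal (min (H T \<omega>) (p * u)) \<partial>M) + (\<integral>\<^sup>+ \<omega>. ennreal (p * u powr (p - 1)) * indicator ?B \<omega> \<partial>M) =
          (\<integral>\<^sup>+ \<omega>. c u * ennreal (min (H T \<omega>) (p * u)) + ennreal (p * u powr (p - 1)) * indicator ?B \<omega> \<partial>M)"
        by (rule nn_integral_add[symmetric]) measurable
      also have "\<dots> = (\<integral>\<^sup>+ \<omega>. (ennreal (p * u powr (p - 2) * min (H T \<omega>) (p * u)) + ennreal (p * u powr (p - 1)) * indicator {p * u..} (H T \<omega>))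
          * indicator {0<..} u \<partial>M)"
      proof (rule nn_integral_cong)
        fix \<omega> assume \<omega>: "\<omega> \<in> space M"
        have "c u * ennreal (min (H T \<omega>) (p * u)) = ennreal (p * u powr (p - 2) * min (H T \<omega>) (p * u))"
          unfolding c_def using u p_pos H_nonneg[of T \<omega>] T \<omega> by (intro ennreal_mult[symmetric]) auto
        then show "c u * ennreal (min (H T \<omega>) (p * u)) + ennreal (p * u powr (p - 1)) * indicator ?B \<omega> =
            (ennreal (p * u powr (p - 2) * min (H T \<omega>) (p * u)) + ennreal (p * u powr (p - 1)) * indicator {p * u..} (H T \<omega>))
            * indicator {0<..} u"
          using u \<omega> by (simp add: indicator_def)
      qed
      finally show ?thesis by (simp add: Iu)
    qed (auto simp: I_def)
  qed
  also have "\<dots> = (\<integral>\<^sup>+ u. I u * c u * (\<integral>\<^sup>+ \<omega>. level_integral u T \<omega> \<partial>M) \<partial>lborel) +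
      (\<integral>\<^sup>+ u. (\<integral>\<^sup>+ \<omega>. (ennreal (p * u powr (p - 2) * min (H T \<omega>) (p * u)) + ennreal (p * u powr (p - 1)) * indicator {p * u..} (H T \<omega>))
      * indicator {0<..} u \<partial>M) \<partial>lborel)"
  proof (rule nn_integral_add)
    have "(\<lambda>u. I u * c u * (\<integral>\<^sup>+ \<omega>. (\<integral>\<^sup>+ s. eta_level u (sup_rat s \<omega>) * indicator {0<..T} s \<partial>\<nu>) \<partial>M)) \<in> borel_measurable lborel"
      by measurable
    then show "(\<lambda>u. I u * c u * (\<integral>\<^sup>+ \<omega>. level_integral u T \<omega> \<partial>M)) \<in> borel_measurable lborel"
      by (simp add: level_integral_eq_rat cong: nn_integral_cong)
    have ind: "indicator {p * u..} (H T \<omega>) = (if p * u \<le> H T \<omega> then 1 else 0 :: ennreal)" for u \<omega>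
      by (simp add: indicator_def)
    show "(\<lambda>u. \<integral>\<^sup>+ \<omega>. (ennreal (p * u powr (p - 2) * min (H T \<omega>) (p * u)) + ennreal (p * u powr (p - 1)) * indicator {p * u..} (H T \<omega>))
      * indicator {0<..} u \<partial>M) \<in> borel_measurable lborel"
      unfolding ind by measurable
  qed
  also have "(\<integral>\<^sup>+ u. (\<integral>\<^sup>+ \<omega>. (ennreal (p * u powr (p - 2) * min (H T \<omega>) (p * u)) + ennreal (p * u powr (p - 1)) * indicator {p * u..} (H T \<omega>))
      * indicator {0<..} u \<partial>M) \<partial>lborel) \<le> (\<integral>\<^sup>+ \<omega>. ennreal (p powr (- p) / (1 - p) * H T \<omega> powr p) \<partial>M)"
  proof -
    have ind: "indicator {p * u..} (H T \<omega>) = (if p * u \<le> H T \<omega> then 1 else 0 :: ennreal)" for u \<omega>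
      by (simp add: indicator_def)
    have "(\<integral>\<^sup>+ u. (\<integral>\<^sup>+ \<omega>. (ennreal (p * u powr (p - 2) * min (H T \<omega>) (p * u)) + ennreal (p * u powr (p - 1)) * indicator {p * u..} (H T \<omega>))
      * indicator {0<..} u \<partial>M) \<partial>lborel) =
      (\<integral>\<^sup>+ \<omega>. (\<integral>\<^sup>+ u. (ennreal (p * u powr (p - 2) * min (H T \<omega>) (p * u)) + ennreal (p * u powr (p - 1)) * indicator {p * u..} (H T \<omega>))
      * indicator {0<..} u \<partial>lborel) \<partial>M)"
      unfolding ind by (rule pl.Fubini') measurable
    also have "\<dots> \<le> (\<integral>\<^sup>+ \<omega>. ennreal (p powr (- p) / (1 - p) * H T \<omega> powr p) \<partial>M)"
      using T by (intro nn_integral_mono nn_integral_threshold_le p_pos p_less_1 H_nonneg) auto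
    finally show ?thesis .
  qed
  also have "(\<integral>\<^sup>+ u. I u * c u * (\<integral>\<^sup>+ \<omega>. level_integral u T \<omega> \<partial>M) \<partial>lborel) \<le>
      (\<integral>\<^sup>+ s\<in>{0<..T}. (\<integral>\<^sup>+ \<omega>. ennreal (eta.ep (trunc b (sup_rat s \<omega>) powr p)) \<partial>M) \<partial>\<nu>)"
  proof -
    have "(\<integral>\<^sup>+ u. I u * c u * (\<integral>\<^sup>+ \<omega>. level_integral u T \<omega> \<partial>M) \<partial>lborel) =
        (\<integral>\<^sup>+ u. I u * c u * (\<integral>\<^sup>+ \<omega>. (\<integral>\<^sup>+ s. eta_level u (sup_rat s \<omega>) * indicator {0<..T} s \<partial>\<nu>) \<partial>M) \<partial>lborel)"
      by (simp add: level_integral_eq_rat cong: nn_integral_cong)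
    also have "\<dots> = (\<integral>\<^sup>+ u. (\<integral>\<^sup>+ s. (\<integral>\<^sup>+ \<omega>. I u * c u * (eta_level u (sup_rat s \<omega>) * indicator {0<..T} s) \<partial>M) \<partial>\<nu>) \<partial>lborel)"
    proof (rule nn_integral_cong)
      fix u :: real
      have "(\<integral>\<^sup>+ \<omega>. (\<integral>\<^sup>+ s. eta_level u (sup_rat s \<omega>) * indicator {0<..T} s \<partial>\<nu>) \<partial>M) =
          (\<integral>\<^sup>+ s. (\<integral>\<^sup>+ \<omega>. eta_level u (sup_rat s \<omega>) * indicator {0<..T} s \<partial>M) \<partial>\<nu>)"
        by (rule pn.Fubini'[symmetric]) measurable
      then show "I u * c u * (\<integral>\<^sup>+ \<omega>. (\<integral>\<^sup>+ s. eta_level u (sup_rat s \<omega>) * indicator {0<..T} s \<partial>\<nu>) \<partial>M) =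
          (\<integral>\<^sup>+ s. (\<integral>\<^sup>+ \<omega>. I u * c u * (eta_level u (sup_rat s \<omega>) * indicator {0<..T} s) \<partial>M) \<partial>\<nu>)"
        by (simp add: nn_integral_cmult)
    qed
    also have "\<dots> = (\<integral>\<^sup>+ s. (\<integral>\<^sup>+ u. (\<integral>\<^sup>+ \<omega>. I u * c u * (eta_level u (sup_rat s \<omega>) * indicator {0<..T} s) \<partial>M) \<partial>lborel) \<partial>\<nu>)"
      by (rule nl.Fubini') measurable
    also have "\<dots> = (\<integral>\<^sup>+ s. (\<integral>\<^sup>+ \<omega>. (\<integral>\<^sup>+ u. I u * c u * (eta_level u (sup_rat s \<omega>) * indicator {0<..T} s) \<partial>lborel) \<partial>M) \<partial>\<nu>)"
      by (intro nn_integral_cong pl.Fubini') measurable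
    also have "\<dots> \<le> (\<integral>\<^sup>+ s. (\<integral>\<^sup>+ \<omega>. ennreal (eta.ep (trunc b (sup_rat s \<omega>) powr p)) * indicator {0<..T} s \<partial>M) \<partial>\<nu>)"
    proof (intro nn_integral_mono)
      fix s \<omega>
      show "(\<integral>\<^sup>+ u. I u * c u * (eta_level u (sup_rat s \<omega>) * indicator {0<..T} s) \<partial>lborel) \<le>
          ennreal (eta.ep (trunc b (sup_rat s \<omega>) powr p)) * indicator {0<..T} s"
        using nn_integral_eta_level_le[OF b, of "sup_rat s \<omega>"]
        by (cases "s \<in> {0<..T}") (auto simp: I_def c_def mult_ac)
    qed
    also have "\<dots> = (\<integral>\<^sup>+ s\<in>{0<..T}. (\<integral>\<^sup>+ \<omega>. ennreal (eta.ep (trunc b (sup_rat s \<omega>) powr p)) \<partial>M) \<partial>\<nu>)"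
      by (intro nn_integral_cong) (auto simp: indicator_def)
    finally show ?thesis .
  qed
  finally show ?thesis by (simp add: add.commute add_mono)
qed

end

lemma tendsto_trunc:
  assumes "(f \<longlongrightarrow> x) G" and "0 \<le> b"
  shows "((\<lambda>k. trunc b (f k)) \<longlongrightarrow> trunc b x) G"
  unfolding trunc_def[of b "f _"]
proof (rule tendsto_enn2real)
  show "((\<lambda>k. min (ennreal b) (f k)) \<longlongrightarrow> ennreal (trunc b x)) G"
    unfolding ennreal_trunc by (intro tendsto_min assms tendsto_const)
qed (use trunc_bounds[OF assms(2)] in simp)

section \<open>Jensen's inequality and removal of the truncation\<close>

context bihari_power_setting
begin

lemma ep_measurable: "eta.ep \<in> borel_measurable borel"
proof -
  have "(\<lambda>x. indicator {0..} x *\<^sub>R \<eta> x) \<in> borel_measurable borel"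
    by (rule borel_measurable_continuous_on_indicator) (auto intro: eta_continuous)
  then have "(\<lambda>x. p / (1 - p) * (indicator {0..} (x powr (1 / p)) *\<^sub>R \<eta> (x powr (1 / p))) * x powr (1 - 1 / p))
      \<in> borel_measurable borel"
    by measurable
  then show ?thesis by (simp add: eta_p_def[abs_def])
qed

text \<open>The supporting line at the mean is integrated. Mean 0 is treated separately, because
  supporting lines are available at positive points only; in that case \<open>Z\<close> vanishes
  almost surely.\<close>

lemma jensen_ep:
  assumes Z: "Z \<in> borel_measurable M" and bounds: "\<And>\<omega>. \<omega> \<in> space M \<Longrightarrow> 0 \<le> Z \<omega> \<and> Z \<omega> \<le> B"
  shows "(\<integral>\<^sup>+ \<omega>. ennreal (eta.ep (Z \<omega>)) \<partial>M) \<le> ennreal (eta.ep (\<integral>\<omega>. Z \<omega> \<partial>M))"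
proof -
  have int: "integrable M Z"
    using bounds by (intro integrable_const_bound[of _ B] Z) auto
  define z where "z = (\<integral>\<omega>. Z \<omega> \<partial>M)"
  have "0 \<le> z" unfolding z_def using bounds by (intro integral_nonneg_AE) auto
  show ?thesis
  proof (cases "z = 0")
    case True
    then have "AE \<omega> in M. Z \<omega> = 0"
      using integral_nonneg_eq_0_iff_AE[OF int] bounds by (auto simp: z_def)
    then have "(\<integral>\<^sup>+ \<omega>. ennreal (eta.ep (Z \<omega>)) \<partial>M) = (\<integral>\<^sup>+ \<omega>. 0 \<partial>M)"
      by (intro nn_integral_cong_AE) auto
    then show ?thesis by simp
  next
    case False
    then have z: "0 < z" using \<open>0 \<le> z\<close> by simp
    obtain m where m: "\<And>x. 0 \<le> x \<Longrightarrow> eta.ep x \<le> eta.ep z + m * (x - z)"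
      using eta.ep_supporting_line[OF z] by blast
    have "(\<integral>\<^sup>+ \<omega>. ennreal (eta.ep (Z \<omega>)) \<partial>M) \<le> (\<integral>\<^sup>+ \<omega>. ennreal (eta.ep z + m * (Z \<omega> - z)) \<partial>M)"
      using bounds m by (intro nn_integral_mono ennreal_leI) auto
    also have "\<dots> = ennreal (\<integral>\<omega>. eta.ep z + m * (Z \<omega> - z) \<partial>M)"
    proof (rule nn_integral_eq_integral)
      show "AE \<omega> in M. 0 \<le> eta.ep z + m * (Z \<omega> - z)"
        using bounds m eta.ep_nonneg by (intro AE_I2) (meson order_trans)
    qed (use int in auto)
    also have "(\<integral>\<omega>. eta.ep z + m * (Z \<omega> - z) \<partial>M) = eta.ep z + m * (z - z)"
      using int prob_space by (simp add: z_def)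
    finally show ?thesis by (simp add: z_def)
  qed
qed

context
  fixes T b :: real
  assumes T: "0 < T" and b: "0 < b" and EH: "(\<integral>\<^sup>+ \<omega>. ennreal (H T \<omega> powr p) \<partial>M) < \<infinity>"
begin

definition \<phi> :: "real \<Rightarrow> real" where
  "\<phi> s = (\<integral>\<omega>. trunc b (sup_rat s \<omega>) powr p \<partial>M)"

lemma \<phi>_measurable [measurable]: "\<phi> \<in> borel_measurable borel"
  unfolding \<phi>_def[abs_def] by measurable

lemma trunc_powr_bounds: "0 \<le> trunc b x powr p \<and> trunc b x powr p \<le> b powr p"
  using trunc_bounds[of b x] b p_pos by (auto intro: powr_mono2)

lemma trunc_sup_rat_measurable: "(\<lambda>\<omega>. trunc b (sup_rat s \<omega>) powr p) \<in> borel_measurable M"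
  by measurable

lemma \<phi>_bounds: "0 \<le> \<phi> s \<and> \<phi> s \<le> b powr p"
proof
  show "0 \<le> \<phi> s" unfolding \<phi>_def by (intro integral_nonneg_AE) auto
  have "integrable M (\<lambda>\<omega>. trunc b (sup_rat s \<omega>) powr p)"
    using trunc_powr_bounds by (intro integrable_const_bound[of _ "b powr p"] trunc_sup_rat_measurable) auto
  then have "\<phi> s \<le> (\<integral>\<omega>. b powr p \<partial>M)"
    unfolding \<phi>_def using trunc_powr_bounds by (intro integral_mono) auto
  then show "\<phi> s \<le> b powr p" using prob_space by simp
qed

text \<open>By Jensen's inequality this dominates the drift term in the bound for the truncated
  moment, with an integrand that depends on time alone.\<close>

definition S :: "real \<Rightarrow> ennreal" where
  "S t = (\<integral>\<^sup>+ s\<in>{0<..t}. ennreal (eta.ep (\<phi> s)) \<partial>\<nu>)"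

lemma ep_\<phi>_measurable: "(\<lambda>s. ennreal (eta.ep (\<phi> s))) \<in> borel_measurable \<nu>"
  using measurable_compose[OF \<phi>_measurable ep_measurable] by simp

lemma S_split:
  assumes st: "0 \<le> s" "s \<le> t" and C: "0 \<le> C" "\<And>r. s < r \<Longrightarrow> r \<le> t \<Longrightarrow> \<phi> r \<le> C"
  shows "S t \<le> S s + ennreal (eta.ep C * (A t - A s))"
proof -
  have "S t = (\<integral>\<^sup>+ r. ennreal (eta.ep (\<phi> r)) * indicator {0<..s} r + ennreal (eta.ep (\<phi> r)) * indicator {s<..t} r \<partial>\<nu>)"
    unfolding S_def using st by (intro nn_integral_cong) (auto simp: indicator_def)
  also have "\<dots> = S s + (\<integral>\<^sup>+ r\<in>{s<..t}. ennreal (eta.ep (\<phi> r)) \<partial>\<nu>)"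
    unfolding S_def using ep_\<phi>_measurable by (intro nn_integral_add) auto
  finally have eq: "S t = S s + (\<integral>\<^sup>+ r\<in>{s<..t}. ennreal (eta.ep (\<phi> r)) \<partial>\<nu>)" .
  have "(\<integral>\<^sup>+ r\<in>{s<..t}. ennreal (eta.ep (\<phi> r)) \<partial>\<nu>) \<le> (\<integral>\<^sup>+ r. ennreal (eta.ep C) * indicator {s<..t} r \<partial>\<nu>)"
    using C(2) \<phi>_bounds by (intro nn_integral_mono) (auto simp: indicator_def intro!: ennreal_leI eta.ep_le)
  also have "\<dots> = ennreal (eta.ep C) * emeasure \<nu> {s<..t}"
    by (subst nn_integral_cmult_indicator) auto
  also have "\<dots> = ennreal (eta.ep C * (A t - A s))"
    using st C by (simp add: emeasure_\<nu> ennreal_mult A_le eta.ep_nonneg)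
  finally show ?thesis unfolding eq by (rule add_left_mono)
qed

lemma S_0: "S 0 = 0"
  by (simp add: S_def)

lemma S_finite: "0 \<le> t \<Longrightarrow> S t < \<infinity>"
  using S_split[of 0 t "b powr p"] \<phi>_bounds by (auto simp: S_0 intro: le_less_trans)

lemma S_mono: "s \<le> t \<Longrightarrow> S s \<le> S t"
  unfolding S_def by (intro nn_integral_mono) (auto simp: indicator_def)

text \<open>The increment condition of \<open>bihari_deterministic\<close> is verified not for the
  moment \<open>f\<close> but for its majorant \<open>F\<close>, which contains the integral itself.
  Working with \<open>k > 0\<close> keeps \<open>F\<close> away from 0, where \<open>G\<close> may
  be infinite.\<close>

lemma truncated_bihari:
  assumes k: "0 < k"
    and k_le: "(1 - p) powr (- 1 / p) * p powr (- 1) * (\<integral>\<omega>. H T \<omega> powr p \<partial>M) powr (1 / p) \<le> k"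
    and D: "0 < (\<integral>\<omega>. trunc b (Xmax T \<omega>) powr p \<partial>M)"
  shows "eta.Gr ((\<integral>\<omega>. trunc b (Xmax T \<omega>) powr p \<partial>M) powr (1 / p)) \<le> eta.Gr k + (1 - p) powr (- 1) * A T"
proof -
  note [measurable] = H_measurable[OF less_imp_le[OF T]]
  define F where "F t = k powr p + enn2real (S t)" for t
  define f where "f t = (\<integral>\<omega>. trunc b (Xmax t \<omega>) powr p \<partial>M)" for t
  have f_meas: "(\<lambda>\<omega>. trunc b (Xmax t \<omega>) powr p) \<in> borel_measurable M" if "0 < t" for t
  proof -
    have [measurable]: "Xmax t \<in> borel_measurable M" by (rule Xmax_measurable[OF that])
    show ?thesis by measurable
  qed
  define E where "E = (\<integral>\<omega>. H T \<omega> powr p \<partial>M)"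
  have E: "0 \<le> E" unfolding E_def by (intro integral_nonneg_AE) auto
  have EH': "(\<integral>\<^sup>+ \<omega>. ennreal (H T \<omega> powr p) \<partial>M) = ennreal E"
    unfolding E_def using EH by (intro nn_integral_eq_integral integrableI_nonneg) auto
  have const: "ennreal (p powr (- p) / (1 - p)) * ennreal E \<le> ennreal (k powr p)"
  proof -
    \<comment> \<open>\<open>p powr (- p) / (1 - p)\<close> is the p-th power of the constant
      \<alpha>.\<close>
    have "p powr (- p) / (1 - p) * E = ((1 - p) powr (- 1 / p) * p powr (- 1) * E powr (1 / p)) powr p"
      using p_pos p_less_1 E by (simp add: powr_mult powr_divide powr_powr powr_minus_divide)
    also have "\<dots> \<le> k powr p"
      using k_le p_pos E unfolding E_def[symmetric] by (intro powr_mono2) auto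
    finally show ?thesis using p_pos p_less_1 E by (simp add: ennreal_mult[symmetric] ennreal_leI)
  qed
  have fF: "f t \<le> F t" if t: "0 < t" "t \<le> T" for t
  proof -
    have "integrable M (\<lambda>\<omega>. trunc b (Xmax t \<omega>) powr p)"
      using trunc_powr_bounds by (intro integrable_const_bound[of _ "b powr p"] f_meas t) auto
    then have "ennreal (f t) = (\<integral>\<^sup>+ \<omega>. ennreal (trunc b (Xmax t \<omega>) powr p) \<partial>M)"
      unfolding f_def by (intro nn_integral_eq_integral[symmetric]) auto
    also have "\<dots> \<le> (\<integral>\<^sup>+ \<omega>. ennreal (p powr (- p) / (1 - p) * H t \<omega> powr p) \<partial>M) +
        (\<integral>\<^sup>+ s\<in>{0<..t}. (\<integral>\<^sup>+ \<omega>. ennreal (eta.ep (trunc b (sup_rat s \<omega>) powr p)) \<partial>M) \<partial>\<nu>)"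
      by (rule truncated_moment_le[OF t(1) b])
    also have "\<dots> \<le> ennreal (k powr p) + S t"
    proof (rule add_mono)
      have "(\<integral>\<^sup>+ \<omega>. ennreal (p powr (- p) / (1 - p) * H t \<omega> powr p) \<partial>M) \<le>
          (\<integral>\<^sup>+ \<omega>. ennreal (p powr (- p) / (1 - p)) * ennreal (H T \<omega> powr p) \<partial>M)"
      proof (rule nn_integral_mono)
        fix \<omega> assume \<omega>: "\<omega> \<in> space M"
        have "p powr (- p) / (1 - p) * H t \<omega> powr p \<le> p powr (- p) / (1 - p) * H T \<omega> powr p"
          using t p_pos p_less_1 \<omega> H_nonneg[of t \<omega>] H_le[of \<omega> t T] by (intro mult_left_mono powr_mono2) auto
        also have "ennreal \<dots> = ennreal (p powr (- p) / (1 - p)) * ennreal (H T \<omega> powr p)"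
          using p_less_1 by (intro ennreal_mult) auto
        finally show "ennreal (p powr (- p) / (1 - p) * H t \<omega> powr p) \<le>
            ennreal (p powr (- p) / (1 - p)) * ennreal (H T \<omega> powr p)"
          by (simp add: ennreal_leI)
      qed
      also have "\<dots> = ennreal (p powr (- p) / (1 - p)) * ennreal E"
        by (subst nn_integral_cmult) (auto simp: EH')
      also note const
      finally show "(\<integral>\<^sup>+ \<omega>. ennreal (p powr (- p) / (1 - p) * H t \<omega> powr p) \<partial>M) \<le> ennreal (k powr p)" .
      show "(\<integral>\<^sup>+ s\<in>{0<..t}. (\<integral>\<^sup>+ \<omega>. ennreal (eta.ep (trunc b (sup_rat s \<omega>) powr p)) \<partial>M) \<partial>\<nu>) \<le> S t"
        unfolding S_def \<phi>_def using trunc_powr_bounds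
        by (intro nn_integral_mono mult_right_mono jensen_ep[where B = "b powr p"] trunc_sup_rat_measurable) auto
    qed
    also have "\<dots> = ennreal (F t)"
      using S_finite[of t] t by (simp add: F_def ennreal_plus)
    finally show ?thesis
      by (subst (asm) ennreal_le_iff) (auto simp: F_def)
  qed
  have F_mono: "F s \<le> F t" if "0 \<le> s" "s \<le> t" for s t
    using S_mono[of s t] S_finite[of t] that by (auto simp: F_def intro!: enn2real_mono)
  have F_pos: "0 < F t" for t using k by (simp add: F_def add_pos_nonneg)
  \<comment> \<open>\<open>\<phi> s\<close> is the limit of the moments \<open>f r\<close> as
    \<open>r\<close> increases to \<open>s\<close>. Hence it obeys a bound on \<open>F\<close> that
    is known strictly before \<open>s\<close> only, and this is the kind of bound that
    \<open>bihari_deterministic\<close> supplies.\<close>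
  have \<phi>_le: "\<phi> s \<le> C" if s: "0 < s" "s \<le> T" and C: "\<And>r. 0 \<le> r \<Longrightarrow> r < s \<Longrightarrow> F r \<le> C" for s C
  proof -
    \<comment> \<open>The shift by 2 keeps \<open>r n\<close> strictly positive, as
      \<open>fF\<close> requires.\<close>
    define r where "r n = s * (1 - 1 / real (Suc (Suc n)))" for n
    have r: "0 < r n" "r n < s" for n using s by (auto simp: r_def)
    have "r \<longlonglongrightarrow> s * (1 - 0)"
      unfolding r_def[abs_def]
      by (intro tendsto_intros LIMSEQ_Suc[OF LIMSEQ_Suc[OF lim_const_over_n]])
    then have r_lim: "r \<longlonglongrightarrow> s" by simp
    have "(\<lambda>n. f (r n)) \<longlonglongrightarrow> \<phi> s"
      unfolding f_def \<phi>_def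
    proof (rule integral_dominated_convergence[where w = "\<lambda>_. b powr p"])
      show "AE \<omega> in M. (\<lambda>n. trunc b (Xmax (r n) \<omega>) powr p) \<longlonglongrightarrow> trunc b (sup_rat s \<omega>) powr p"
      proof (rule AE_I2)
        fix \<omega> assume \<omega>: "\<omega> \<in> space M"
        have sup: "sup_rat s \<omega> = (SUP t\<in>{0..<s}. ennreal (X t \<omega>))"
          using running_sup_left_eq_sup_rat[OF s(1) \<omega>] s by (simp add: running_sup_left_def)
        have "(\<lambda>n. Xmax (r n) \<omega>) \<longlonglongrightarrow> sup_rat s \<omega>"
        proof (rule order_tendstoI)
          fix a assume "a < sup_rat s \<omega>"
          then obtain t where t: "0 \<le> t" "t < s" "a < ennreal (X t \<omega>)" by (auto simp: sup less_SUP_iff)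
          have "\<forall>\<^sub>F n in sequentially. t < r n" using r_lim t by (intro order_tendstoD)
          then show "\<forall>\<^sub>F n in sequentially. a < Xmax (r n) \<omega>"
          proof eventually_elim
            case (elim n)
            then have "ennreal (X t \<omega>) \<le> Xmax (r n) \<omega>"
              unfolding Xmax_def using t by (intro SUP_upper) auto
            then show ?case using t by simp
          qed
        next
          fix a assume a: "sup_rat s \<omega> < a"
          have "Xmax (r n) \<omega> \<le> sup_rat s \<omega>" for n
            unfolding Xmax_def sup using r[of n] by (intro SUP_subset_mono) auto
          then show "\<forall>\<^sub>F n in sequentially. Xmax (r n) \<omega> < a"
            using a by (intro always_eventually allI) (rule le_less_trans)
        qed
        then have "(\<lambda>n. trunc b (Xmax (r n) \<omega>)) \<longlonglongrightarrow> trunc b (sup_rat s \<omega>)"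
          using b by (intro tendsto_trunc) auto
        then show "(\<lambda>n. trunc b (Xmax (r n) \<omega>) powr p) \<longlonglongrightarrow> trunc b (sup_rat s \<omega>) powr p"
          using p_pos b trunc_bounds[of b] by (intro tendsto_powr' tendsto_const) auto
      qed
    qed (use trunc_powr_bounds f_meas r in auto)
    then show "\<phi> s \<le> C"
    proof (rule LIMSEQ_le_const2)
      have "f (r n) \<le> C" for n
        using fF[of "r n"] C[of "r n"] r[of n] s by (auto intro: order_trans)
      then show "\<exists>N. \<forall>n\<ge>N. f (r n) \<le> C" by blast
    qed
  qed
  have "eta.Phi (F T) \<le> eta.Phi (F 0) + (A T - A 0) / (1 - p)"
  proof (rule eta.bihari_deterministic)
    show "0 < F 0" by (rule F_pos)
    show "0 \<le> T" using T by simp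
    show "mono_on {0..T} F" using F_mono by (auto intro!: mono_onI)
    show "mono_on {0..T} A" using A_le by (auto intro!: mono_onI)
    show "continuous (at_right t) A" if "0 \<le> t" "t < T" for t
      using A_right_continuous[OF that(1)] by (simp add: continuous_within)
    fix s t C assume st: "0 \<le> s" "s \<le> t" "t \<le> T" and C: "0 \<le> C" "\<And>r. s \<le> r \<Longrightarrow> r < t \<Longrightarrow> F r \<le> C"
    show "F t - F s \<le> eta.ep C * (A t - A s)"
    proof (cases "s = t")
      case False
      then have "s < t" using st by simp
      have FC: "F r \<le> C" if "0 \<le> r" "r < t" for r
        using C(2)[of r] C(2)[of s] F_mono[of r s] that \<open>s < t\<close> by (cases "s \<le> r") auto
      have "S t \<le> S s + ennreal (eta.ep C * (A t - A s))"
        using st C(1) FC by (intro S_split \<phi>_le) auto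
      then have "ennreal (enn2real (S t)) \<le> ennreal (enn2real (S s) + eta.ep C * (A t - A s))"
        using S_finite[of t] S_finite[of s] st C(1) A_le[of s t] eta.ep_nonneg
        by (simp add: ennreal_plus)
      then have "enn2real (S t) \<le> enn2real (S s) + eta.ep C * (A t - A s)"
        using st C(1) A_le[of s t] eta.ep_nonneg by (subst (asm) ennreal_le_iff) auto
      then show ?thesis by (simp add: F_def)
    qed simp
  qed
  moreover have "eta.Phi (F 0) = eta.Gr k"
    using k p_pos by (simp add: F_def S_0 eta.Phi_def powr_powr)
  moreover have "eta.Gr (f T powr (1 / p)) \<le> eta.Phi (F T)"
    unfolding eta.Phi_def using D fF[of T] T p_pos
    by (intro eta.Gr_le powr_mono2) (auto simp: f_def[symmetric])
  ultimately show ?thesis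
    using p_less_1 by (simp add: f_def A_zero powr_minus_divide)
qed

end

text \<open>The bound \<open>w\<close> does not depend on the truncation level \<open>b\<close>,
  which is sent to infinity with Fatou's lemma.\<close>

theorem bihari_upper_bound:
  assumes T: "0 < T" and EH: "(\<integral>\<^sup>+ \<omega>. ennreal (H T \<omega> powr p) \<partial>M) < \<infinity>"
  shows "bihari_estimate p ((1 - p) powr (- 1 / p) * p powr (- 1)) ((1 - p) powr (- 1)) M X A H \<eta> T"
proof -
  define c where "c = (1 - p) powr (- 1 / p) * p powr (- 1) * (\<integral>\<omega>. H T \<omega> powr p \<partial>M) powr (1 / p)"
  define a where "a = (1 - p) powr (- 1) * A T"
  define w where "w = bihari_G_inv \<eta> (bihari_G \<eta> c + ereal a)"
  have c: "0 \<le> c" by (simp add: c_def)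
  have a: "0 \<le> a" using A_nonneg[of T] T by (simp add: a_def)
  have w: "0 \<le> w"
    unfolding w_def by (rule eta.le_bihari_G_inv[OF order_refl c a]) simp
  have le: "(\<integral>\<omega>. trunc b (Xmax T \<omega>) powr p \<partial>M) powr (1 / p) \<le> w" if b: "0 < b" for b
    unfolding w_def
  proof (rule eta.le_bihari_G_inv[OF _ c a])
    let ?D = "\<integral>\<omega>. trunc b (Xmax T \<omega>) powr p \<partial>M"
    show "0 \<le> ?D powr (1 / p)" by simp
    fix k assume "0 < k" "c \<le> k" "0 < ?D powr (1 / p)"
    moreover from this have "0 < ?D"
      using integral_nonneg_AE[of "\<lambda>\<omega>. trunc b (Xmax T \<omega>) powr p" M] by (cases "?D = 0") (auto simp: less_le)
    ultimately show "eta.Gr (?D powr (1 / p)) \<le> eta.Gr k + a"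
      unfolding a_def c_def by (intro truncated_bihari T b EH)
  qed
  have [measurable]: "Xmax T \<in> borel_measurable M" by (rule Xmax_measurable[OF T])
  have le': "(\<integral>\<^sup>+ \<omega>. ennreal (trunc b (Xmax T \<omega>) powr p) \<partial>M) \<le> ennreal (w powr p)" if b: "0 < b" for b
  proof -
    let ?D = "\<integral>\<omega>. trunc b (Xmax T \<omega>) powr p \<partial>M"
    have "0 \<le> ?D" by (intro integral_nonneg_AE) auto
    have "integrable M (\<lambda>\<omega>. trunc b (Xmax T \<omega>) powr p)"
    proof (rule integrable_const_bound[of _ "b powr p"])
      show "AE \<omega> in M. norm (trunc b (Xmax T \<omega>) powr p) \<le> b powr p"
        using trunc_bounds[of b] b p_pos by (auto intro!: powr_mono2)
    qed measurable
    then have "(\<integral>\<^sup>+ \<omega>. ennreal (trunc b (Xmax T \<omega>) powr p) \<partial>M) = ennreal ?D"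
      by (intro nn_integral_eq_integral) auto
    also have "?D = (?D powr (1 / p)) powr p"
      using \<open>0 \<le> ?D\<close> p_pos by (simp add: powr_powr)
    also have "\<dots> \<le> w powr p" using le[OF b] p_pos by (intro powr_mono2) auto
    finally show ?thesis by (simp add: ennreal_leI)
  qed
  have "(\<integral>\<^sup>+ \<omega>. (SUP t\<in>{0..T}. ennreal (X t \<omega> powr p)) \<partial>M) \<le>
      (\<integral>\<^sup>+ \<omega>. liminf (\<lambda>n. ennreal (trunc (real (Suc n)) (Xmax T \<omega>) powr p)) \<partial>M)"
  proof (intro nn_integral_mono SUP_least)
    fix \<omega> t assume \<omega>: "\<omega> \<in> space M" and t: "t \<in> {0..T}"
    obtain n0 where n0: "X t \<omega> \<le> real n0" using real_arch_simple by blast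
    show "ennreal (X t \<omega> powr p) \<le> liminf (\<lambda>n. ennreal (trunc (real (Suc n)) (Xmax T \<omega>) powr p))"
    proof (rule Liminf_bounded)
      show "\<forall>\<^sub>F n in sequentially. ennreal (X t \<omega> powr p) \<le> ennreal (trunc (real (Suc n)) (Xmax T \<omega>) powr p)"
        unfolding eventually_sequentially
      proof (intro exI[of _ n0] allI impI)
        fix n assume n: "n0 \<le> n"
        have "ennreal (X t \<omega>) \<le> Xmax T \<omega>" unfolding Xmax_def using t by (rule SUP_upper)
        moreover have "ennreal (X t \<omega>) \<le> ennreal (real (Suc n))" using n n0 by (intro ennreal_leI) simp
        ultimately have "ennreal (X t \<omega>) \<le> ennreal (trunc (real (Suc n)) (Xmax T \<omega>))"
          by (simp add: ennreal_trunc)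
        then have "X t \<omega> \<le> trunc (real (Suc n)) (Xmax T \<omega>)"
          using trunc_bounds[of "real (Suc n)" "Xmax T \<omega>"] by (subst (asm) ennreal_le_iff) auto
        then show "ennreal (X t \<omega> powr p) \<le> ennreal (trunc (real (Suc n)) (Xmax T \<omega>) powr p)"
          using X_nonneg[of t \<omega>] t \<omega> p_pos by (intro ennreal_leI powr_mono2) auto
      qed
    qed
  qed
  also have "\<dots> \<le> liminf (\<lambda>n. \<integral>\<^sup>+ \<omega>. ennreal (trunc (real (Suc n)) (Xmax T \<omega>) powr p) \<partial>M)"
    by (rule nn_integral_liminf) measurable
  also have "\<dots> \<le> ennreal (w powr p)"
    using le' by (intro Liminf_le) auto
  finally have *: "(\<integral>\<^sup>+ \<omega>. (SUP t\<in>{0..T}. ennreal (X t \<omega> powr p)) \<partial>M) \<le> ennreal (w powr p)" .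
  then obtain I where I: "(\<integral>\<^sup>+ \<omega>. (SUP t\<in>{0..T}. ennreal (X t \<omega> powr p)) \<partial>M) = ennreal I" "0 \<le> I"
    by (cases "\<integral>\<^sup>+ \<omega>. (SUP t\<in>{0..T}. ennreal (X t \<omega> powr p)) \<partial>M") (auto simp: top_unique)
  have "I \<le> w powr p" using * I by simp
  then have "I powr (1 / p) \<le> (w powr p) powr (1 / p)" using I p_pos by (intro powr_mono2) auto
  also have "\<dots> = w" using w p_pos by (simp add: powr_powr)
  finally have "ennreal_powr (\<integral>\<^sup>+ \<omega>. (SUP t\<in>{0..T}. ennreal (X t \<omega> powr p)) \<partial>M) (1 / p) \<le> ennreal w"
    using I by (simp add: ennreal_powr_def ennreal_leI)
  moreover have "bihari_G \<eta> c + ereal a \<in> bihari_G \<eta> ` {0..}"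
    by (rule eta.bihari_G_surj[OF c a])
  ultimately show ?thesis
    using c unfolding bihari_estimate_def Let_def c_def[symmetric] a_def[symmetric] w_def[symmetric] by simp
qed

end

section \<open>Coin tossing trees\<close>

lemma nat_floor_right: "\<forall>\<^sub>F s in at_right t. nat \<lfloor>s\<rfloor> = nat \<lfloor>t\<rfloor>"
proof -
  have "nat \<lfloor>s\<rfloor> = nat \<lfloor>t\<rfloor>" if "t < s" "s < of_int \<lfloor>t\<rfloor> + 1" for s
  proof -
    have "\<lfloor>s\<rfloor> = \<lfloor>t\<rfloor>" using that by (intro floor_unique) linarith+
    then show ?thesis by simp
  qed
  moreover have "t < of_int \<lfloor>t\<rfloor> + 1" by linarith
  ultimately show ?thesis by (intro eventually_at_rightI[of t "of_int \<lfloor>t\<rfloor> + 1"]) auto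
qed

lemma cadlag_step: "cadlag_path (\<lambda>t. f (nat \<lfloor>t\<rfloor>))"
  unfolding cadlag_path_def right_continuous_path_def
proof (intro conjI allI impI)
  fix t :: real
  have "\<forall>\<^sub>F s in at_right t. f (nat \<lfloor>t\<rfloor>) = f (nat \<lfloor>s\<rfloor>)"
    using nat_floor_right by eventually_elim simp
  then show "continuous (at_right t) (\<lambda>t. f (nat \<lfloor>t\<rfloor>))"
    unfolding continuous_within by (rule Lim_transform_eventually[OF tendsto_const])
next
  fix t :: real
  have "\<lfloor>s\<rfloor> = \<lceil>t\<rceil> - 1" if "of_int (\<lceil>t\<rceil> - 1) < s" "s < t" for s
    using that by (intro floor_unique) linarith+
  moreover have "of_int (\<lceil>t\<rceil> - 1) < t" by linarith
  ultimately have "\<forall>\<^sub>F s in at_left t. f (nat (\<lceil>t\<rceil> - 1)) = f (nat \<lfloor>s\<rfloor>)"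
    unfolding eventually_at_left_field by (intro exI[of _ "of_int (\<lceil>t\<rceil> - 1)"]) auto
  then show "\<exists>l. ((\<lambda>t. f (nat \<lfloor>t\<rfloor>)) \<longlongrightarrow> l) (at_left t)"
    by (intro exI[of _ "f (nat (\<lceil>t\<rceil> - 1))"]) (rule Lim_transform_eventually[OF tendsto_const])
qed

text \<open>A finite tree of coin tosses. A node is the list of its tosses, the most recent one first;
  \<open>\<pi> h\<close> is the probability of \<open>True\<close> after the history \<open>h\<close>. The leaves at depth \<open>R\<close> are encoded
  as reals.\<close>

locale coin_tree =
  fixes \<pi> :: "bool list \<Rightarrow> real" and R :: nat
  assumes pi_pos: "\<And>h. 0 < \<pi> h" and pi_less_1: "\<And>h. \<pi> h < 1"
begin

fun weight :: "bool list \<Rightarrow> real" where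
  "weight [] = 1"
| "weight (b # h) = weight h * (if b then \<pi> h else 1 - \<pi> h)"

lemma weight_pos: "0 < weight h"
  using pi_pos pi_less_1 by (induction h) (auto intro!: mult_pos_pos)

definition expect :: "nat \<Rightarrow> (bool list \<Rightarrow> real) \<Rightarrow> real" where
  "expect n f = (\<Sum>h | length h = n. weight h * f h)"

lemma finite_nodes: "finite {h :: bool list. length h = n}"
  using finite_lists_length_eq[of "UNIV :: bool set" n] by simp

lemma expect_0: "expect 0 f = f []"
  by (simp add: expect_def)

text \<open>Conditioning on the latest toss, which is the head of the list.\<close>

lemma expect_Suc: "expect (Suc n) f = expect n (\<lambda>h. \<pi> h * f (True # h) + (1 - \<pi> h) * f (False # h))"
proof -
  have "{h :: bool list. length h = Suc n} = Cons True ` {h. length h = n} \<union> Cons False ` {h. length h = n}"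
    by (force simp: length_Suc_conv)
  then have "expect (Suc n) f = (\<Sum>h\<in>Cons True ` {h. length h = n}. weight h * f h) +
      (\<Sum>h\<in>Cons False ` {h. length h = n}. weight h * f h)"
    unfolding expect_def using finite_nodes[of n] by (subst sum.union_disjoint[symmetric]) auto
  also have "\<dots> = expect n (\<lambda>h. \<pi> h * f (True # h) + (1 - \<pi> h) * f (False # h))"
    by (simp add: expect_def sum.reindex sum.distrib[symmetric] algebra_simps)
  finally show ?thesis .
qed

lemma expect_mono: "(\<And>h. length h = n \<Longrightarrow> f h \<le> g h) \<Longrightarrow> expect n f \<le> expect n g"
  unfolding expect_def using weight_pos by (intro sum_mono mult_left_mono) (auto intro: less_imp_le)

lemma expect_cong: "(\<And>h. length h = n \<Longrightarrow> f h = g h) \<Longrightarrow> expect n f = expect n g"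
  unfolding expect_def by (intro sum.cong) auto

lemma expect_add: "expect n (\<lambda>h. f h + g h) = expect n f + expect n g"
  by (simp add: expect_def distrib_left sum.distrib)

lemma expect_cmult: "expect n (\<lambda>h. c * f h) = c * expect n f"
  by (simp add: expect_def sum_distrib_left mult_ac)

lemma expect_const: "expect n (\<lambda>_. c) = c"
  by (induction n) (simp_all add: expect_0 expect_Suc algebra_simps)

lemma expect_drop: "expect (k + j) (\<lambda>h. f (drop j h)) = expect k f"
  by (induction j) (simp_all add: expect_Suc algebra_simps)

definition leaf :: "real \<Rightarrow> bool list" where
  "leaf \<omega> = from_nat (nat \<lfloor>\<omega>\<rfloor>)"

definition enc :: "bool list \<Rightarrow> real" where
  "enc h = real (to_nat h)"

lemma leaf_enc [simp]: "leaf (enc h) = h"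
  by (simp add: leaf_def enc_def)

definition \<Omega> :: "real set" where
  "\<Omega> = enc ` {h. length h = R}"

lemma length_leaf: "\<omega> \<in> \<Omega> \<Longrightarrow> length (leaf \<omega>) = R"
  by (auto simp: \<Omega>_def)

lemma finite_\<Omega>: "finite \<Omega>"
  unfolding \<Omega>_def by (intro finite_imageI finite_nodes)

text \<open>Every leaf has positive mass, so the empty set is the only null set: completeness is
  trivial, and almost sure statements hold at all leaves.\<close>

definition P :: "real measure" where
  "P = point_measure \<Omega> (\<lambda>\<omega>. ennreal (weight (leaf \<omega>)))"

lemma space_P [simp]: "space P = \<Omega>"
  by (simp add: P_def space_point_measure)

lemma sets_P [simp]: "sets P = Pow \<Omega>"
  by (simp add: P_def sets_point_measure)

lemma sum_\<Omega>: "(\<Sum>\<omega>\<in>\<Omega>. g (leaf \<omega>)) = (\<Sum>h | length h = R. g h)"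
  unfolding \<Omega>_def by (subst sum.reindex) (auto intro: inj_on_inverseI[of _ leaf])

lemma integral_P: "(\<integral>\<omega>. f (leaf \<omega>) \<partial>P) = expect R f"
proof -
  have "(\<integral>\<omega>. f (leaf \<omega>) \<partial>P) = (\<Sum>\<omega>\<in>\<Omega>. weight (leaf \<omega>) *\<^sub>R f (leaf \<omega>))"
    unfolding P_def using weight_pos
    by (intro lebesgue_integral_point_measure_finite finite_\<Omega>) (auto intro: less_imp_le)
  also have "\<dots> = expect R f"
    using sum_\<Omega>[of "\<lambda>h. weight h *\<^sub>R f h"] by (simp add: expect_def)
  finally show ?thesis .
qed

lemma nn_integral_P:
  assumes "\<And>h. 0 \<le> f h"
  shows "(\<integral>\<^sup>+ \<omega>. ennreal (f (leaf \<omega>)) \<partial>P) = ennreal (expect R f)"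
proof -
  have "(\<integral>\<^sup>+ \<omega>. ennreal (f (leaf \<omega>)) \<partial>P) = (\<Sum>\<omega>\<in>\<Omega>. ennreal (weight (leaf \<omega>) * f (leaf \<omega>)))"
    unfolding P_def using assms weight_pos
    by (subst nn_integral_point_measure_finite[OF finite_\<Omega>]) (simp add: ennreal_mult less_imp_le)
  also have "\<dots> = ennreal (\<Sum>\<omega>\<in>\<Omega>. weight (leaf \<omega>) * f (leaf \<omega>))"
    using assms weight_pos by (intro sum_ennreal) (simp add: less_imp_le)
  also have "\<dots> = ennreal (expect R f)"
    using sum_\<Omega>[of "\<lambda>h. weight h * f h"] by (simp add: expect_def)
  finally show ?thesis .
qed

lemma integrable_P: "integrable P (f :: real \<Rightarrow> real)"
  unfolding P_def using finite_\<Omega> weight_pos by (intro integrable_point_measure_finite) (auto intro: less_imp_le)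

lemma AE_P: "(AE \<omega> in P. Q \<omega>) \<longleftrightarrow> (\<forall>\<omega>\<in>\<Omega>. Q \<omega>)"
  unfolding P_def AE_point_measure using weight_pos by auto

text \<open>As the latest toss comes first in the list, dropping \<open>R - n\<close> entries leaves
  the first \<open>n\<close> tosses; for \<open>n \<ge> R\<close> truncated subtraction leaves the
  whole leaf.\<close>

definition hist :: "nat \<Rightarrow> real \<Rightarrow> bool list" where
  "hist n \<omega> = drop (R - n) (leaf \<omega>)"

lemma hist_drop: "m \<le> n \<Longrightarrow> hist m \<omega> = drop (min R n - min R m) (hist n \<omega>)"
  by (auto simp: hist_def min_def)

lemma hist_ge: "R \<le> n \<Longrightarrow> hist n \<omega> = leaf \<omega>"
  by (simp add: hist_def)

lemma hist_0: "\<omega> \<in> \<Omega> \<Longrightarrow> hist 0 \<omega> = []"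
  by (simp add: hist_def length_leaf)

lemma hist_Suc:
  assumes "\<omega> \<in> \<Omega>" "n < R"
  shows "\<exists>b. hist (Suc n) \<omega> = b # hist n \<omega>"
proof -
  have "R - Suc n < length (leaf \<omega>)" using assms length_leaf by simp
  from Cons_nth_drop_Suc[OF this, symmetric] assms show ?thesis
    by (simp add: hist_def Suc_diff_Suc)
qed

text \<open>The sigma-algebra changes at integer times only and is constant on
  \<open>[n, n + 1)\<close>, which makes the filtration right continuous.\<close>

definition Ft :: "real \<Rightarrow> real measure" where
  "Ft t = vimage_algebra \<Omega> (hist (nat \<lfloor>t\<rfloor>)) (count_space UNIV)"

lemma space_Ft [simp]: "space (Ft t) = \<Omega>"
  by (simp add: Ft_def)

lemma sets_Ft: "sets (Ft t) = {hist (nat \<lfloor>t\<rfloor>) -` S \<inter> \<Omega> | S. True}"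
  unfolding Ft_def by (subst sets_vimage_algebra2) auto

lemma hist_measurable:
  fixes f :: "bool list \<Rightarrow> real"
  shows "(\<lambda>\<omega>. f (hist (nat \<lfloor>t\<rfloor>) \<omega>)) \<in> borel_measurable (Ft t)"
proof (rule measurableI)
  fix B :: "real set"
  have "(\<lambda>\<omega>. f (hist (nat \<lfloor>t\<rfloor>) \<omega>)) -` B \<inter> \<Omega> = hist (nat \<lfloor>t\<rfloor>) -` (f -` B) \<inter> \<Omega>" by auto
  then show "(\<lambda>\<omega>. f (hist (nat \<lfloor>t\<rfloor>) \<omega>)) -` B \<inter> space (Ft t) \<in> sets (Ft t)"
    unfolding sets_Ft space_Ft by blast
qed simp

lemma Ft_mono:
  assumes "s \<le> t"
  shows "sets (Ft s) \<subseteq> sets (Ft t)"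
proof
  fix B assume "B \<in> sets (Ft s)"
  then obtain S where B: "B = hist (nat \<lfloor>s\<rfloor>) -` S \<inter> \<Omega>" by (auto simp: sets_Ft)
  have le: "nat \<lfloor>s\<rfloor> \<le> nat \<lfloor>t\<rfloor>" using assms by (intro nat_mono floor_mono)
  have "B = hist (nat \<lfloor>t\<rfloor>) -` {h. drop (min R (nat \<lfloor>t\<rfloor>) - min R (nat \<lfloor>s\<rfloor>)) h \<in> S} \<inter> \<Omega>"
    unfolding B by (simp add: hist_drop[OF le] vimage_def)
  then show "B \<in> sets (Ft t)" unfolding sets_Ft by blast
qed

lemma filtered: "usual_filtered_prob_space P Ft"
proof (intro usual_filtered_prob_space.intro prob_spaceI complete_measure.intro usual_filtered_prob_space_axioms.intro)
  have "emeasure P (space P) = (\<integral>\<^sup>+ \<omega>. ennreal ((\<lambda>_. 1) (leaf \<omega>)) \<partial>P)" by simp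
  also have "\<dots> = 1" by (subst nn_integral_P) (simp_all add: expect_const)
  finally show "emeasure P (space P) = 1" .
  show "A \<in> sets P" if "A \<subseteq> B" "B \<in> null_sets P" for A B
    using that by (auto simp: null_sets_def)
  show "subalgebra P (Ft t)" for t
    by (auto simp: subalgebra_def sets_Ft)
  show "sets (Ft s) \<subseteq> sets (Ft t)" if "s \<le> t" for s t by (rule Ft_mono[OF that])
  show "null_sets P \<subseteq> sets (Ft 0)"
  proof
    fix B assume "B \<in> null_sets P"
    then have "weight (leaf x) \<le> 0" if "x \<in> B" for x
      unfolding P_def null_sets_point_measure_iff using that by (auto simp: ennreal_eq_0_iff)
    then have "B = {}" using weight_pos not_le by blast
    then show "B \<in> sets (Ft 0)" by simp
  qed
  show "sets (Ft t) = (\<Inter>s\<in>{t<..}. sets (Ft s))" for t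
  proof
    show "sets (Ft t) \<subseteq> (\<Inter>s\<in>{t<..}. sets (Ft s))" by (intro INT_greatest Ft_mono) simp
    have "t < of_int \<lfloor>t\<rfloor> + 1" by linarith
    from dense[OF this] obtain s where s: "t < s" "s < of_int \<lfloor>t\<rfloor> + 1" by blast
    then have "\<lfloor>s\<rfloor> = \<lfloor>t\<rfloor>" by (intro floor_unique) linarith+
    then have "Ft s = Ft t" by (simp add: Ft_def)
    moreover have "(\<Inter>s\<in>{t<..}. sets (Ft s)) \<subseteq> sets (Ft s)" using s(1) by (intro INT_lower) simp
    ultimately show "(\<Inter>s\<in>{t<..}. sets (Ft s)) \<subseteq> sets (Ft t)" by simp
  qed
qed

definition proc :: "(bool list \<Rightarrow> real) \<Rightarrow> real \<Rightarrow> real \<Rightarrow> real" where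
  "proc f t \<omega> = f (hist (nat \<lfloor>t\<rfloor>) \<omega>)"

lemma proc_adapted: "adapted_process Ft (proc f)"
  unfolding adapted_process_def proc_def[abs_def] using hist_measurable by blast

lemma proc_cadlag: "cadlag_path (\<lambda>t. proc f t \<omega>)"
  unfolding proc_def by (rule cadlag_step)

text \<open>The averaging condition is the martingale property for one toss. The tree is finite, so
  integrability is automatic and the infinite stopping time localizes.\<close>

lemma proc_martingale:
  assumes f: "\<And>h. \<pi> h * f (True # h) + (1 - \<pi> h) * f (False # h) = f h"
  shows "local_martingale P Ft (proc f)"
proof -
  interpret usual_filtered_prob_space P Ft by (rule filtered)
  \<comment> \<open>The tosses after depth \<open>m\<close> are averaged out one at a time, against
    a weight that depends on the first \<open>m\<close> tosses only.\<close>
  have avg: "expect (m + j) (\<lambda>h. g (drop j h) * f h) = expect m (\<lambda>h. g h * f h)" for m j g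
  proof (induction j)
    case (Suc j)
    have "expect (m + Suc j) (\<lambda>h. g (drop (Suc j) h) * f h) =
        expect (m + j) (\<lambda>h. g (drop j h) * (\<pi> h * f (True # h) + (1 - \<pi> h) * f (False # h)))"
      by (simp add: expect_Suc algebra_simps)
    then show ?case using Suc.IH by (simp add: f)
  qed simp
  have level: "(\<integral>\<omega>. g (hist m \<omega>) * f (hist n \<omega>) \<partial>P) = expect (min R m) (\<lambda>h. g h * f h)" if mn: "m \<le> n" for m n g
  proof -
    let ?m = "min R m" and ?n = "min R n"
    have le: "?m \<le> ?n" using mn by simp
    have "(\<integral>\<omega>. g (hist m \<omega>) * f (hist n \<omega>) \<partial>P) =
        (\<integral>\<omega>. (\<lambda>h. g (drop (?n - ?m) (drop (R - ?n) h)) * f (drop (R - ?n) h)) (leaf \<omega>) \<partial>P)"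
      using mn by (intro Bochner_Integration.integral_cong) (auto simp: hist_drop[OF mn] hist_def min_def)
    also have "\<dots> = expect (?n + (R - ?n)) (\<lambda>h. g (drop (?n - ?m) (drop (R - ?n) h)) * f (drop (R - ?n) h))"
      by (subst integral_P) simp
    also have "\<dots> = expect ?n (\<lambda>h. g (drop (?n - ?m) h) * f h)"
      using expect_drop[of ?n "R - ?n" "\<lambda>h. g (drop (?n - ?m) h) * f h"] by simp
    also have "\<dots> = expect ?m (\<lambda>h. g h * f h)"
      using avg[of ?m "?n - ?m" g] le by simp
    finally show ?thesis .
  qed
  have "martingale P Ft (stopped_process (proc f) (\<lambda>_. \<infinity>))"
    unfolding martingale_def
  proof (intro conjI allI impI)
    have eq: "stopped_process (proc f) (\<lambda>_. \<infinity>) t = proc f t" if "0 \<le> t" for t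
      using that by (simp add: stopped_process_def fun_eq_iff)
    show "adapted_process Ft (stopped_process (proc f) (\<lambda>_. \<infinity>))"
      using proc_adapted[of f] eq by (simp add: adapted_process_def)
    show "integrable P (stopped_process (proc f) (\<lambda>_. \<infinity>) t)" for t by (rule integrable_P)
    fix s t :: real assume st: "0 \<le> s" "s \<le> t"
    interpret sub: finite_measure_subalgebra P "Ft s" by unfold_locales (rule subalgebra_F[OF st(1)])
    have "AE \<omega> in P. real_cond_exp P (Ft s) (proc f t) \<omega> = proc f s \<omega>"
    proof (rule sub.real_cond_exp_charact)
      fix B assume "B \<in> sets (Ft s)"
      then obtain S where B: "B = hist (nat \<lfloor>s\<rfloor>) -` S \<inter> \<Omega>" by (auto simp: sets_Ft)
      let ?g = "indicator S :: bool list \<Rightarrow> real"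
      have set: "(\<integral>\<omega>\<in>B. proc f r \<omega> \<partial>P) = (\<integral>\<omega>. ?g (hist (nat \<lfloor>s\<rfloor>) \<omega>) * f (hist (nat \<lfloor>r\<rfloor>) \<omega>) \<partial>P)" for r
        unfolding set_lebesgue_integral_def proc_def
        by (intro Bochner_Integration.integral_cong) (auto simp: B indicator_def)
      have "nat \<lfloor>s\<rfloor> \<le> nat \<lfloor>t\<rfloor>" using st by (intro nat_mono floor_mono)
      then show "(\<integral>\<omega>\<in>B. proc f t \<omega> \<partial>P) = (\<integral>\<omega>\<in>B. proc f s \<omega> \<partial>P)"
        unfolding set by (simp add: level)
    next
      show "proc f s \<in> borel_measurable (Ft s)"
        using proc_adapted[of f] st(1) unfolding adapted_process_def by blast
    qed (rule integrable_P)+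
    then show "AE \<omega> in P. real_cond_exp P (Ft s) (stopped_process (proc f) (\<lambda>_. \<infinity>) t) \<omega> =
        stopped_process (proc f) (\<lambda>_. \<infinity>) s \<omega>"
      using eq st by simp
  qed
  moreover have "random_stopping_time P Ft (\<lambda>_. \<infinity>)"
    by (simp add: random_stopping_time_def top_unique)
  ultimately show ?thesis
    unfolding local_martingale_def using proc_adapted
    by (auto intro!: exI[of _ "\<lambda>_ _. \<infinity>"] simp: incseq_def)
qed

text \<open>A function that ignores the latest toss is known one unit of time in advance: on
  \<open>[n + 1, n + 2)\<close> its value is determined by the tosses up to time \<open>n\<close>.
  Hence the level sets are countable unions of foreseen rectangles, apart from the initial
  slab.\<close>

lemma proc_predictable:
  assumes f: "\<And>b b' h. f (b # h) = f (b' # h)"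
  shows "predictable_process P Ft (proc f)"
proof -
  interpret usual_filtered_prob_space P Ft by (rule filtered)
  let ?PS = "predictable_sigma P Ft"
  have known: "{\<omega> \<in> \<Omega>. f (hist (Suc n) \<omega>) \<in> D} \<in> sets (Ft (real n))" for n D
  proof (cases "n < R")
    case True
    have "f (hist (Suc n) \<omega>) = f (True # hist n \<omega>)" if "\<omega> \<in> \<Omega>" for \<omega>
      using hist_Suc[OF that True] f by metis
    then have "{\<omega> \<in> \<Omega>. f (hist (Suc n) \<omega>) \<in> D} = hist (nat \<lfloor>real n\<rfloor>) -` {h. f (True # h) \<in> D} \<inter> \<Omega>"
      by auto
    then show ?thesis unfolding sets_Ft by blast
  next
    case False
    \<comment> \<open>From depth \<open>R\<close> on the history no longer changes, so the shift by
      one is immaterial.\<close>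
    then have "{\<omega> \<in> \<Omega>. f (hist (Suc n) \<omega>) \<in> D} = hist (nat \<lfloor>real n\<rfloor>) -` {h. f h \<in> D} \<inter> \<Omega>"
      by (auto simp: hist_ge)
    then show ?thesis unfolding sets_Ft by blast
  qed
  have slab: "{real (Suc n)..<real (Suc (Suc n))} \<times> {\<omega> \<in> \<Omega>. f (hist (Suc n) \<omega>) \<in> D} \<in> sets ?PS" for n D
  proof -
    let ?B = "{\<omega> \<in> \<Omega>. f (hist (Suc n) \<omega>) \<in> D}"
    have "{real (Suc n)..<real (Suc (Suc n))} = (\<Union>m. {real (Suc n)..real (Suc (Suc n)) - 1 / real (Suc m)})"
    proof (intro equalityI subsetI)
      fix x assume x: "x \<in> {real (Suc n)..<real (Suc (Suc n))}"
      then obtain m where "inverse (real (Suc m)) < real (Suc (Suc n)) - x"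
        using reals_Archimedean[of "real (Suc (Suc n)) - x"] by auto
      then show "x \<in> (\<Union>m. {real (Suc n)..real (Suc (Suc n)) - 1 / real (Suc m)})"
        using x by (intro UN_I[of m]) (auto simp: inverse_eq_divide)
    next
      fix x assume "x \<in> (\<Union>m. {real (Suc n)..real (Suc (Suc n)) - 1 / real (Suc m)})"
      then obtain m where "real (Suc n) \<le> x" "x \<le> real (Suc (Suc n)) - 1 / real (Suc m)" by auto
      moreover have "0 < 1 / real (Suc m)" by simp
      ultimately have "real (Suc n) \<le> x" "x < real (Suc (Suc n))" by linarith+
      then show "x \<in> {real (Suc n)..<real (Suc (Suc n))}" by simp
    qed
    then have "{real (Suc n)..<real (Suc (Suc n))} \<times> ?B = (\<Union>m. {real (Suc n)..real (Suc (Suc n)) - 1 / real (Suc m)} \<times> ?B)"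
      by auto
    also have "\<dots> \<in> sets ?PS"
      using known[of n D] by (intro sets.countable_UN image_subsetI foreseen_predictable foreseen_rect[of "real n"]) auto
    finally show ?thesis .
  qed
  have zero: "{0..<1} \<times> \<Omega> \<in> sets ?PS"
  proof -
    have "{0<..<1::real} = (\<Union>m. {0<..1 - 1 / real (Suc m)})"
    proof (intro equalityI subsetI)
      fix x :: real assume x: "x \<in> {0<..<1}"
      then obtain m where "inverse (real (Suc m)) < 1 - x"
        using reals_Archimedean[of "1 - x"] by auto
      then show "x \<in> (\<Union>m. {0<..1 - 1 / real (Suc m)})"
        using x by (intro UN_I[of m]) (auto simp: inverse_eq_divide)
    next
      fix x :: real assume "x \<in> (\<Union>m. {0<..1 - 1 / real (Suc m)})"
      then obtain m where "0 < x" "x \<le> 1 - 1 / real (Suc m)" by auto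
      moreover have "0 < 1 / real (Suc m)" by simp
      ultimately have "0 < x" "x < 1" by linarith+
      then show "x \<in> {0<..<1}" by simp
    qed
    moreover have "{0..<1::real} = {0} \<union> {0<..<1}" by auto
    ultimately have "{0..<1} \<times> \<Omega> = {0} \<times> \<Omega> \<union> (\<Union>m. {0<..1 - 1 / real (Suc m)} \<times> \<Omega>)"
      by auto
    also have "\<dots> \<in> sets ?PS"
      using space_in_F[of 0]
      by (intro sets.Un sets.countable_UN image_subsetI predictable_rect predictable_rect0) auto
    finally show ?thesis .
  qed
  show ?thesis
    unfolding predictable_process_def
  proof (rule measurableI)
    fix D :: "real set"
    let ?L = "\<Union>n. {real (Suc n)..<real (Suc (Suc n))} \<times> {\<omega> \<in> \<Omega>. f (hist (Suc n) \<omega>) \<in> D}"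
    have "(\<lambda>(t, \<omega>). proc f t \<omega>) -` D \<inter> space ?PS = (if f [] \<in> D then {0..<1} \<times> \<Omega> else {}) \<union> ?L"
    proof (rule set_eqI)
      fix x :: "real \<times> real"
      obtain t \<omega> where x: "x = (t, \<omega>)" by (cases x)
      show "x \<in> (\<lambda>(t, \<omega>). proc f t \<omega>) -` D \<inter> space ?PS \<longleftrightarrow> x \<in> (if f [] \<in> D then {0..<1} \<times> \<Omega> else {}) \<union> ?L"
      proof (cases "0 \<le> t \<and> \<omega> \<in> \<Omega>")
        case True
        have L: "x \<in> ?L \<longleftrightarrow> (\<exists>n. nat \<lfloor>t\<rfloor> = Suc n \<and> f (hist (Suc n) \<omega>) \<in> D)"
        proof -
          have "t \<in> {real (Suc n)..<real (Suc (Suc n))} \<longleftrightarrow> nat \<lfloor>t\<rfloor> = Suc n" for n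
          proof -
            have "nat \<lfloor>t\<rfloor> = Suc n \<longleftrightarrow> \<lfloor>t\<rfloor> = int (Suc n)" using True by linarith
            also have "\<dots> \<longleftrightarrow> real (Suc n) \<le> t \<and> t < real (Suc n) + 1"
              by (simp only: floor_eq_iff of_int_of_nat_eq)
            finally show ?thesis by (simp add: add.commute)
          qed
          then show ?thesis using True x by (auto simp del: of_nat_Suc)
        qed
        have Z: "t < 1 \<longleftrightarrow> nat \<lfloor>t\<rfloor> = 0" using True by linarith
        show ?thesis
          unfolding Un_iff L using True x Z hist_0[of \<omega>]
          by (cases "nat \<lfloor>t\<rfloor>") (auto simp: space_predictable proc_def)
      next
        case False
        then show ?thesis using x by (auto simp: space_predictable split: if_splits)
      qed
    qed
    also have "\<dots> \<in> sets ?PS"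
      using zero slab by (intro sets.Un sets.countable_UN) auto
    finally show "(\<lambda>(t, \<omega>). proc f t \<omega>) -` D \<inter> space ?PS \<in> sets ?PS" .
  qed simp
qed

end

section \<open>The linear case \<open>\<eta> x = x\<close>\<close>

lemma bihari_eta_id: "0 < p \<Longrightarrow> p < 1 \<Longrightarrow> bihari_eta p (\<lambda>x. x)"
proof
  assume p: "0 < p" "p < 1"
  have eq: "eta_p p (\<lambda>x. x) x = p / (1 - p) * x" if "0 < x" for x
    using that p by (simp add: eta_p_def powr_add[symmetric] mult.assoc)
  show "concave_on {0<..} (eta_p p (\<lambda>x. x))"
    unfolding concave_on_iff
  proof (intro conjI ballI allI impI)
    fix x y u v :: real assume *: "x \<in> {0<..}" "y \<in> {0<..}" "0 \<le> u" "0 \<le> v" "u + v = 1"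
    then have "0 < u *\<^sub>R x + v *\<^sub>R y"
      by (cases "u = 0") (auto intro: add_pos_nonneg)
    then show "u * eta_p p (\<lambda>x. x) x + v * eta_p p (\<lambda>x. x) y \<le> eta_p p (\<lambda>x. x) (u *\<^sub>R x + v *\<^sub>R y)"
      using * by (simp add: eq algebra_simps)
  qed simp
  show "mono_on {0<..} (eta_p p (\<lambda>x. x))"
    using p by (intro mono_onI) (auto simp: eq intro!: mult_left_mono divide_right_mono)
qed (auto intro: mono_onI continuous_intros)

lemma bihari_G_id:
  assumes "0 < v"
  shows "bihari_G (\<lambda>x. x) v = ereal (ln v)"
proof -
  \<comment> \<open>\<open>Gr\<close> depends on \<open>\<eta>\<close> only, so any exponent in (0,
    1) may be used.\<close>
  interpret bihari_eta "1 / 2" "\<lambda>x. x" by (rule bihari_eta_id) auto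
  have int: "integral {a..b} (\<lambda>u. 1 / u) = ln b - ln a" if "0 < a" "a \<le> b" for a b :: real
    using that
    by (intro integral_unique fundamental_theorem_of_calculus)
      (auto intro!: derivative_eq_intros simp: has_real_derivative_iff_has_vector_derivative[symmetric])
  have "Gr v = ln v" using assms by (simp add: Gr_def int)
  then show ?thesis using bihari_G_eq_Gr[OF assms] by simp
qed

lemma bihari_G_inv_G_id: "0 \<le> c \<Longrightarrow> bihari_G_inv (\<lambda>x. x) (bihari_G (\<lambda>x. x) c) = c"
proof -
  interpret bihari_eta "1 / 2" "\<lambda>x. x" by (rule bihari_eta_id) auto
  assume "0 \<le> c"
  then show ?thesis
    unfolding bihari_G_inv_def using inj_on_bihari_G by (intro inv_into_f_f) auto
qed

text \<open>With \<open>G = ln\<close> the right-hand side of the estimate takes Gronwall's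
  form.\<close>

lemma bihari_G_inv_id_exp:
  assumes "0 < c"
  shows "bihari_G_inv (\<lambda>x. x) (bihari_G (\<lambda>x. x) c + ereal a) = c * exp a"
  using bihari_G_inv_G_id[of "c * exp a"] assms by (simp add: bihari_G_id ln_mult)

context coin_tree
begin

text \<open>The probabilistic hypotheses become conditions at the nodes; predictability of
  \<open>H\<close> appears as independence of the latest toss.\<close>

lemma coin_tree_setting:
  assumes p: "0 < p" "p < 1"
    and x: "\<And>h. 0 \<le> x h"
    and H: "\<And>b b' h. H (b # h) = H (b' # h)" "\<And>h. 0 \<le> H h" "\<And>b h. H h \<le> H (b # h)"
    and N: "N [] = 0" "\<And>h. \<pi> h * N (True # h) + (1 - \<pi> h) * N (False # h) = N h"
    and A: "mono_on {0..} A" "cadlag_path A" "A 0 = 0"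
    and le: "\<And>t \<omega>. 0 \<le> t \<Longrightarrow> \<omega> \<in> \<Omega> \<Longrightarrow> ereal (proc x t \<omega>) \<le>
      enn2ereal (eta_integral (\<lambda>x. x) A (proc x) t \<omega>) + ereal (proc N t \<omega>) + ereal (proc H t \<omega>)"
  shows "bihari_lasalle_setting P Ft p (proc x) A (proc H) (proc N) (\<lambda>x. x)"
proof -
  interpret eta: bihari_eta p "\<lambda>x. x" by (rule bihari_eta_id[OF p])
  have H_drop: "H (drop k h) \<le> H h" for k h
  proof (induction h arbitrary: k)
    case (Cons b h)
    show ?case
    proof (cases k)
      case (Suc j)
      have "H (drop k (b # h)) \<le> H h" using Suc Cons[of j] by simp
      also have "\<dots> \<le> H (b # h)" by (rule H(3))
      finally show ?thesis .
    qed simp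
  qed simp
  have H_mono: "proc H s \<omega> \<le> proc H t \<omega>" if "s \<le> t" for s t \<omega>
  proof -
    have "nat \<lfloor>s\<rfloor> \<le> nat \<lfloor>t\<rfloor>" using that by (intro nat_mono floor_mono)
    then show ?thesis unfolding proc_def by (simp only: hist_drop H_drop)
  qed
  have N0: "proc N 0 \<omega> = 0" if "\<omega> \<in> \<Omega>" for \<omega>
    using N(1) hist_0[OF that] by (simp add: proc_def)
  show ?thesis
  proof (intro bihari_lasalle_setting.intro filtered bihari_lasalle_setting_axioms.intro)
    show "right_continuous_path (\<lambda>t. proc x t \<omega>)" for \<omega>
      using proc_cadlag[of x \<omega>] by (simp add: cadlag_path_def)
    show "mono_on {0..} (\<lambda>t. proc H t \<omega>)" for \<omega> using H_mono by (intro mono_onI)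
    show "0 \<le> proc x t \<omega>" "0 \<le> proc H t \<omega>" for t \<omega> by (simp_all add: proc_def x H)
    show "AE \<omega> in P. ereal (proc x t \<omega>) \<le> enn2ereal (eta_integral (\<lambda>x. x) A (proc x) t \<omega>) +
        ereal (proc N t \<omega>) + ereal (proc H t \<omega>)" if "0 \<le> t" for t
      unfolding AE_P using le[OF that] by blast
    show "predictable_process P Ft (proc H)" by (rule proc_predictable) (rule H(1))
    show "local_martingale P Ft (proc N)" by (rule proc_martingale[OF N(2)])
    show "proc N 0 \<omega> = 0" if "\<omega> \<in> space P" for \<omega> using N0 that by simp
  qed (use A eta.eta_p_concave eta.eta_p_mono in
      \<open>auto intro: proc_adapted proc_cadlag mono_onI continuous_intros\<close>)
qed

text \<open>\<open>st\<close> stands for the running maximum. It suffices that its value at a leaf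
  is taken by \<open>x\<close> at some node on the way, since then its moment is at most that of the
  supremum of the process.\<close>

lemma coin_tree_bound:
  assumes valid: "bihari_estimate_valid TYPE(real) p \<alpha> \<beta>"
    and setting: "bihari_lasalle_setting P Ft p (proc x) A (proc H) (proc N) (\<lambda>x. x)"
    and p: "0 < p" and R: "0 < R"
    and st: "\<And>h. length h = R \<Longrightarrow> \<exists>n\<le>R. st h = x (drop (R - n) h)"
  defines "c \<equiv> \<alpha> * expect R (\<lambda>h. H h powr p) powr (1 / p)"
  shows "0 \<le> c" "expect R (\<lambda>h. st h powr p) powr (1 / p) \<le>
      bihari_G_inv (\<lambda>x. x) (bihari_G (\<lambda>x. x) c + ereal (\<beta> * A (real R)))"
proof -
  have HR: "proc H (real R) \<omega> = H (leaf \<omega>)" for \<omega> by (simp add: proc_def hist_ge)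
  have "(\<integral>\<^sup>+ \<omega>. ennreal (proc H (real R) \<omega> powr p) \<partial>P) < \<infinity>"
    unfolding HR by (subst nn_integral_P) auto
  then have est: "bihari_estimate p \<alpha> \<beta> P (proc x) A (proc H) (\<lambda>x. x) (real R)"
    using valid setting R unfolding bihari_estimate_valid_def by simp
  have E: "(\<integral>\<omega>. proc H (real R) \<omega> powr p \<partial>P) = expect R (\<lambda>h. H h powr p)"
    unfolding HR by (rule integral_P)
  let ?w = "bihari_G_inv (\<lambda>x. x) (bihari_G (\<lambda>x. x) c + ereal (\<beta> * A (real R)))"
  let ?I = "\<integral>\<^sup>+ \<omega>. (SUP t\<in>{0..real R}. ennreal (proc x t \<omega> powr p)) \<partial>P"
  have e: "0 \<le> c" "ennreal_powr ?I (1 / p) \<le> ennreal ?w"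
    using est unfolding bihari_estimate_def Let_def E c_def by auto
  show "0 \<le> c" by (rule e)
  let ?J = "expect R (\<lambda>h. st h powr p)"
  have J: "0 \<le> ?J" using expect_mono[of R "\<lambda>_. 0" "\<lambda>h. st h powr p"] expect_const[of R 0] by simp
  have "ennreal ?J = (\<integral>\<^sup>+ \<omega>. ennreal (st (leaf \<omega>) powr p) \<partial>P)"
    by (rule nn_integral_P[symmetric]) simp
  also have "\<dots> \<le> ?I"
  proof (rule nn_integral_mono)
    fix \<omega> assume "\<omega> \<in> space P"
    then obtain n where n: "n \<le> R" "st (leaf \<omega>) = x (drop (R - n) (leaf \<omega>))"
      using st[of "leaf \<omega>"] length_leaf[of \<omega>] by auto
    then have "ennreal (st (leaf \<omega>) powr p) = ennreal (proc x (real n) \<omega> powr p)"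
      by (simp add: proc_def hist_def)
    also have "\<dots> \<le> (SUP t\<in>{0..real R}. ennreal (proc x t \<omega> powr p))"
      using n by (intro SUP_upper) auto
    finally show "ennreal (st (leaf \<omega>) powr p) \<le> (SUP t\<in>{0..real R}. ennreal (proc x t \<omega> powr p))" .
  qed
  finally have JI: "ennreal ?J \<le> ?I" .
  have "?I \<noteq> \<infinity>" using e(2) by (auto simp: ennreal_powr_def top_unique)
  then obtain i where i: "?I = ennreal i" "0 \<le> i" by (cases ?I) auto
  have "?J \<le> i" using JI i by simp
  then have "?J powr (1 / p) \<le> i powr (1 / p)" using J p by (intro powr_mono2) auto
  moreover have "ennreal (i powr (1 / p)) \<le> ennreal ?w" using e(2) i by (simp add: ennreal_powr_def)
  ultimately have "ennreal (?J powr (1 / p)) \<le> ennreal ?w"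
    using ennreal_leI order_trans by blast
  moreover have "0 \<le> ?w"
  proof -
    have "bihari_G (\<lambda>x. x) c + ereal (\<beta> * A (real R)) \<in> bihari_G (\<lambda>x. x) ` {0..}"
      using est unfolding bihari_estimate_def Let_def E c_def by auto
    from inv_into_into[OF this] show ?thesis by (simp add: bihari_G_inv_def)
  qed
  ultimately show "?J powr (1 / p) \<le> ?w" by (simp add: ennreal_le_iff)
qed

end

text \<open>Up to time \<open>I\<close> the dominating process \<open>tree_H\<close> grows geometrically until the first success,
  which lifts \<open>tree_X\<close> from 0 to \<open>v * tree_H\<close> with \<open>v\<close> close to \<open>1 / p\<close>; the success probability
  \<open>1 - g powr - p\<close> makes each step contribute equally to the moments. After time \<open>I\<close>,
  \<open>tree_X\<close> is a martingale which is multiplied by \<open>l\<close> or dies.\<close>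

fun tree_X :: "real \<Rightarrow> real \<Rightarrow> real \<Rightarrow> nat \<Rightarrow> bool list \<Rightarrow> real" where
  "tree_X v g l I [] = 0"
| "tree_X v g l I (b # h) = (if length h < I
     then (if True \<in> set h then tree_X v g l I h else if b then v * g ^ Suc (length h) else 0)
     else if b then l * tree_X v g l I h else 0)"

fun tree_H :: "real \<Rightarrow> nat \<Rightarrow> bool list \<Rightarrow> real" where
  "tree_H g I [] = 1"
| "tree_H g I (b # h) = (if length h < I \<and> True \<notin> set h then g ^ Suc (length h) else tree_H g I h)"

fun tree_max :: "real \<Rightarrow> real \<Rightarrow> real \<Rightarrow> nat \<Rightarrow> bool list \<Rightarrow> real" where
  "tree_max v g l I [] = 0"
| "tree_max v g l I (b # h) = max (tree_max v g l I h) (tree_X v g l I (b # h))"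

definition alpha_pi :: "real \<Rightarrow> real \<Rightarrow> nat \<Rightarrow> bool list \<Rightarrow> real" where
  "alpha_pi q l I h = (if length h < I then q else 1 / l)"

text \<open>In the first \<open>I\<close> rounds the moments of \<open>x\<close> and
  \<open>H\<close> grow linearly, with slopes in the ratio \<open>v powr p\<close>; \<open>v\<close>
  is chosen so that a jump to \<open>v * g ^ Suc n\<close> with probability \<open>q\<close>
  compensates the growth of \<open>H\<close> from \<open>g ^ n\<close> to \<open>g ^ Suc n\<close>.
  In the next \<open>K\<close> rounds the maximum collects the tail of the excursion, which raises
  its moment by a factor tending to \<open>1 + c\<close> as \<open>K\<close> grows.\<close>

lemma alpha_tree_inequality:
  assumes p: "0 < p" "p < 1" and valid: "bihari_estimate_valid TYPE(real) p \<alpha> \<beta>"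
    and g: "1 < g" and l: "1 < l" and I: "0 < I"
  defines "q \<equiv> 1 - g powr (- p)" and "c \<equiv> (l powr (p - 1) - 1 / l) / (1 - l powr (p - 1))"
  defines "v \<equiv> (1 - 1 / g) / q"
  shows "0 \<le> \<alpha>" "(1 + c - c * (l powr (p - 1)) ^ K) * (real I * q * (v * g) powr p) \<le> \<alpha> powr p * (1 + real I * q * g powr p)"
proof -
  have gp: "g powr (- p) < 1" using powr_less_mono[of "- p" 0 g] p g by simp
  have q: "0 < q" "q < 1" using gp g by (auto simp: q_def)
  have v: "0 < v" using q g by (simp add: v_def)
  have qv: "q * v = 1 - 1 / g" using q by (simp add: v_def)
  define \<theta> where "\<theta> = l powr (p - 1)"
  have \<theta>: "0 < \<theta>" "\<theta> < 1" using powr_less_mono[of "p - 1" 0 l] p l by (auto simp: \<theta>_def)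
  have l\<theta>: "1 / l * l powr p = \<theta>" using l by (simp add: \<theta>_def powr_diff)
  have "1 / l \<le> \<theta>"
    using powr_mono[of "- 1" "p - 1" l] p l by (simp add: \<theta>_def powr_minus_divide)
  then have c: "0 \<le> c" "c * (1 - \<theta>) = \<theta> - 1 / l" using \<theta> by (simp_all add: c_def \<theta>_def[symmetric])
  define \<pi> where "\<pi> = alpha_pi q l I"
  define x where "x = tree_X v g l I"
  define H where "H = tree_H g I"
  define st where "st = tree_max v g l I"
  interpret coin_tree \<pi> "I + K"
    by unfold_locales (use q l in \<open>auto simp: \<pi>_def alpha_pi_def\<close>)
  have x_nonneg: "0 \<le> x h" for h
    unfolding x_def using v g l by (induction h) (auto intro!: mult_nonneg_nonneg)
  have x_run: "x h = 0" if "True \<notin> set h" for h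
    using that unfolding x_def by (induction h) auto
  have H_run: "H h = g ^ length h" if "True \<notin> set h" "length h \<le> I" for h
    using that unfolding H_def by (induction h) auto
  have H_nonneg: "0 \<le> H h" for h
    unfolding H_def using g by (induction h) auto
  have H_mono: "H h \<le> H (b # h)" for h b
  proof (cases "length h < I \<and> True \<notin> set h")
    case True
    then have "H h = g ^ length h" "H (b # h) = g ^ Suc (length h)" using H_run by (auto simp: H_def)
    then show ?thesis using g by simp
  qed (auto simp: H_def)
  have x_Cons: "x (b # h) = (if length h < I
     then (if True \<in> set h then x h else if b then v * g ^ Suc (length h) else 0)
     else if b then l * x h else 0)" for b h
    by (simp add: x_def)
  have st_Cons: "st (b # h) = max (st h) (x (b # h))" for b h
    by (simp add: st_def x_def)
  have H_Cons: "H (b # h) = (if length h < I \<and> True \<notin> set h then g ^ Suc (length h) else H h)" for b h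
    by (simp add: H_def)
  have Nil: "x [] = 0" "st [] = 0" "H [] = 1" by (simp_all add: x_def st_def H_def)
  have st_ge: "x h \<le> st h" "0 \<le> st h" for h
  proof -
    show "x h \<le> st h" by (cases h) (auto simp: st_Cons Nil)
    show "0 \<le> st h" by (induction h) (auto simp: st_Cons Nil)
  qed
  have st_run: "st h = 0" if "True \<notin> set h" for h
    using that by (induction h) (auto simp: Nil st_Cons x_run)
  \<comment> \<open>A path that is still alive has never decreased, so its present value is its
    maximum.\<close>
  have st_x: "st h = x h" if "0 < x h" for h
    using that
  proof (induction h)
    case (Cons b h)
    show ?case
    proof (cases "True \<in> set h")
      case False
      then show ?thesis using Cons.prems by (simp add: st_Cons st_run)
    next
      case True
      then have "0 < x h" "x h \<le> x (b # h)"
        using Cons.prems l x_nonneg[of h] by (auto simp: x_Cons zero_less_mult_iff split: if_splits)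
      then show ?thesis using Cons.IH by (simp add: st_Cons max_def)
    qed
  qed (simp add: Nil)
  have st_attained: "\<exists>k\<le>length h. st h = x (drop k h)" for h
  proof (induction h)
    case (Cons b h)
    then obtain k where k: "k \<le> length h" "st h = x (drop k h)" by blast
    show ?case
    proof (cases "st h \<le> x (b # h)")
      case True
      then show ?thesis by (intro exI[of _ 0]) (simp add: st_Cons)
    next
      case False
      then show ?thesis using k by (intro exI[of _ "Suc k"]) (simp add: st_Cons)
    qed
  qed (simp add: Nil)
  have pi1: "\<pi> h = q" if "length h < I" for h using that by (simp add: \<pi>_def alpha_pi_def)
  have pi2: "\<pi> h = 1 / l" if "I \<le> length h" for h using that by (simp add: \<pi>_def alpha_pi_def)
  \<comment> \<open>With \<open>A = 0\<close> the required inequality reads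
    \<open>x \<le> N + H\<close>. The summand 1 offsets \<open>H [] = 1\<close>, so that
    \<open>N\<close> starts at 0.\<close>
  define N where "N h = x h - H h + 1" for h
  have N_martingale: "\<pi> h * N (True # h) + (1 - \<pi> h) * N (False # h) = N h" for h
  proof (cases "length h < I")
    case True
    show ?thesis
    proof (cases "True \<in> set h")
      case run: False
      have "q * (v * g ^ Suc (length h)) = g ^ Suc (length h) - g ^ length h"
        unfolding mult.assoc[symmetric] qv using g by (simp add: left_diff_distrib)
      then show ?thesis
        using True run by (simp add: N_def x_Cons H_Cons pi1 x_run H_run algebra_simps)
    qed (use True in \<open>simp add: N_def x_Cons H_Cons algebra_simps\<close>)
  next
    case False
    then show ?thesis using l by (simp add: N_def x_Cons H_Cons pi2 algebra_simps)
  qed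
  have setting: "bihari_lasalle_setting P Ft p (proc x) (\<lambda>_. 0) (proc H) (proc N) (\<lambda>x. x)"
  proof (rule coin_tree_setting[OF p x_nonneg _ H_nonneg H_mono _ N_martingale])
    show "H (b # h) = H (b' # h)" for b b' h by (simp add: H_Cons)
    show "N [] = 0" by (simp add: N_def Nil)
    show "cadlag_path (\<lambda>_. 0)" by (rule cadlag_step)
    fix t \<omega>
    have "ereal (proc x t \<omega>) \<le> 0 + ereal (proc N t \<omega>) + ereal (proc H t \<omega>)"
      by (simp add: proc_def N_def)
    also have "\<dots> \<le> enn2ereal (eta_integral (\<lambda>x. x) (\<lambda>_. 0) (proc x) t \<omega>) + ereal (proc N t \<omega>) + ereal (proc H t \<omega>)"
      by (intro add_right_mono) simp
    finally show "ereal (proc x t \<omega>) \<le> enn2ereal (eta_integral (\<lambda>x. x) (\<lambda>_. 0) (proc x) t \<omega>) +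
      ereal (proc N t \<omega>) + ereal (proc H t \<omega>)" .
  qed (auto intro: mono_onI)
  define run where "run h = (if True \<in> set h then 0 else 1 :: real)" for h
  have prob_run: "expect n run = (g powr (- p)) ^ n" if "n \<le> I" for n
    using that
  proof (induction n)
    case (Suc n)
    have "expect (Suc n) run = expect n (\<lambda>h. g powr (- p) * run h)"
      unfolding expect_Suc using Suc.prems by (intro expect_cong) (auto simp: pi1 run_def q_def)
    then show ?case using Suc by (simp add: expect_cmult)
  qed (simp add: expect_0 run_def)
  have gpow: "(g ^ n) powr p * (g powr (- p)) ^ n = 1" for n
  proof -
    have "(g ^ n) powr p = (g powr p) ^ n"
      using g by (simp add: powr_realpow[symmetric] powr_powr mult.commute)
    moreover have "(g powr p) ^ n * (g powr (- p)) ^ n = (g powr p * g powr (- p)) ^ n"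
      by (rule power_mult_distrib[symmetric])
    moreover have "g powr p * g powr (- p) = 1" using g by (simp add: powr_minus)
    ultimately show ?thesis by simp
  qed
  let ?e = "real I * q * (v * g) powr p"
  have moment_x: "expect n (\<lambda>h. x h powr p) = real n * q * (v * g) powr p" if "n \<le> I" for n
    using that
  proof (induction n)
    case (Suc n)
    have "expect (Suc n) (\<lambda>h. x h powr p) = expect n (\<lambda>h. x h powr p + q * (v * g ^ Suc n) powr p * run h)"
      unfolding expect_Suc using Suc.prems
      by (intro expect_cong) (auto simp: pi1 x_Cons run_def x_run algebra_simps)
    also have "\<dots> = expect n (\<lambda>h. x h powr p) + q * (v * g ^ Suc n) powr p * (g powr (- p)) ^ n"
      using Suc.prems by (simp add: expect_add expect_cmult prob_run)
    also have "(v * g ^ Suc n) powr p = (v * g) powr p * (g ^ n) powr p"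
      using v g by (simp add: powr_mult[symmetric] mult.assoc)
    also have "q * ((v * g) powr p * (g ^ n) powr p) * (g powr (- p)) ^ n =
        q * (v * g) powr p * ((g ^ n) powr p * (g powr (- p)) ^ n)" by simp
    finally show ?case using Suc by (simp add: gpow algebra_simps)
  qed (simp add: expect_0 Nil)
  have moment_H: "expect n (\<lambda>h. H h powr p) = 1 + real n * q * g powr p" if "n \<le> I" for n
    using that
  proof (induction n)
    case (Suc n)
    have "expect (Suc n) (\<lambda>h. H h powr p) =
        expect n (\<lambda>h. H h powr p + ((g ^ Suc n) powr p - (g ^ n) powr p) * run h)"
      unfolding expect_Suc using Suc.prems
      by (intro expect_cong) (auto simp: pi1 H_Cons run_def H_run algebra_simps)
    also have "\<dots> = expect n (\<lambda>h. H h powr p) + ((g ^ Suc n) powr p - (g ^ n) powr p) * (g powr (- p)) ^ n"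
      using Suc.prems by (simp add: expect_add expect_cmult prob_run)
    also have "(g ^ Suc n) powr p = g powr p * (g ^ n) powr p"
      using g by (simp add: powr_mult)
    also have "(g powr p * (g ^ n) powr p - (g ^ n) powr p) * (g powr (- p)) ^ n =
        (g powr p - 1) * ((g ^ n) powr p * (g powr (- p)) ^ n)" by (simp add: algebra_simps)
    also have "g powr p - 1 = q * g powr p" using g by (simp add: q_def left_diff_distrib powr_minus)
    finally show ?case using Suc by (simp add: gpow algebra_simps)
  qed (simp add: expect_0 Nil)
  have moment_H2: "expect (I + j) (\<lambda>h. H h powr p) = 1 + real I * q * g powr p" for j
  proof (induction j)
    case (Suc j)
    have "expect (I + Suc j) (\<lambda>h. H h powr p) = expect (I + j) (\<lambda>h. H h powr p)"
      unfolding add_Suc_right expect_Suc by (intro expect_cong) (simp add: H_Cons algebra_simps)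
    then show ?case using Suc by simp
  qed (simp add: moment_H)
  have step_x: "\<pi> h * x (True # h) powr p + (1 - \<pi> h) * x (False # h) powr p = \<theta> * x h powr p"
    if "I \<le> length h" for h
    using that l x_nonneg[of h] by (simp add: x_Cons pi2 powr_mult l\<theta>[symmetric])
  have moment_x2: "expect (I + j) (\<lambda>h. x h powr p) = \<theta> ^ j * ?e" for j
  proof (induction j)
    case (Suc j)
    have "expect (I + Suc j) (\<lambda>h. x h powr p) = expect (I + j) (\<lambda>h. \<theta> * x h powr p)"
      unfolding add_Suc_right expect_Suc by (intro expect_cong step_x) simp
    then show ?case using Suc by (simp add: expect_cmult)
  qed (simp add: moment_x)
  \<comment> \<open>The potential \<open>st powr p + c * x powr p\<close> does not decrease in mean:
    a toss at a living node raises the first term by \<open>(\<theta> - 1 / l) * x powr p\<close>,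
    and the second falls by \<open>c * (1 - \<theta>) * x powr p\<close>, which is the same amount
    by the choice of \<open>c\<close>.\<close>
  have V: "(1 + c) * ?e \<le> expect (I + j) (\<lambda>h. st h powr p + c * x h powr p)" for j
  proof (induction j)
    case 0
    have "(1 + c) * ?e = expect I (\<lambda>h. (1 + c) * x h powr p)"
      by (simp add: expect_cmult moment_x)
    also have "\<dots> \<le> expect I (\<lambda>h. st h powr p + c * x h powr p)"
      using st_ge x_nonneg p by (intro expect_mono) (simp add: distrib_right powr_mono2)
    finally show ?case by simp
  next
    case (Suc j)
    also have "expect (I + j) (\<lambda>h. st h powr p + c * x h powr p) \<le>
        expect (I + j) (\<lambda>h. \<pi> h * (st (True # h) powr p + c * x (True # h) powr p) +
          (1 - \<pi> h) * (st (False # h) powr p + c * x (False # h) powr p))"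
    proof (rule expect_mono)
      fix h :: "bool list" assume "length h = I + j"
      then have h: "I \<le> length h" by simp
      have "\<pi> h * (st (True # h) powr p + c * x (True # h) powr p) +
          (1 - \<pi> h) * (st (False # h) powr p + c * x (False # h) powr p) =
          \<pi> h * st (True # h) powr p + (1 - \<pi> h) * st (False # h) powr p + c * (\<theta> * x h powr p)"
        unfolding step_x[OF h, symmetric] by (simp add: algebra_simps)
      moreover have "st h powr p + c * x h powr p \<le>
          \<pi> h * st (True # h) powr p + (1 - \<pi> h) * st (False # h) powr p + c * (\<theta> * x h powr p)"
      proof (cases "x h = 0")
        case True
        then show ?thesis using h st_ge(2)[of h] by (simp add: st_Cons x_Cons max_def algebra_simps)
      next
        case False
        then have xh: "0 < x h" using x_nonneg[of h] by simp
        then have st: "st h = x h" by (rule st_x)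
        have "st (True # h) = l * x h" "st (False # h) = x h"
          using h l xh by (simp_all add: st_Cons x_Cons st max_def)
        then have "\<pi> h * st (True # h) powr p + (1 - \<pi> h) * st (False # h) powr p =
            (1 / l * l powr p) * x h powr p + (1 - 1 / l) * x h powr p"
          using h l xh by (simp add: pi2 powr_mult)
        also have "\<dots> = x h powr p + (\<theta> - 1 / l) * x h powr p"
          unfolding l\<theta> by (simp add: algebra_simps)
        also have "\<dots> = x h powr p + c * x h powr p - c * (\<theta> * x h powr p)"
          unfolding c(2)[symmetric] by (simp add: algebra_simps)
        finally show ?thesis by (simp add: st)
      qed
      ultimately show "st h powr p + c * x h powr p \<le>
          \<pi> h * (st (True # h) powr p + c * x (True # h) powr p) +
          (1 - \<pi> h) * (st (False # h) powr p + c * x (False # h) powr p)" by simp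
    qed
    finally show ?case by (simp add: expect_Suc)
  qed
  let ?EH = "1 + real I * q * g powr p" and ?J = "expect (I + K) (\<lambda>h. st h powr p)"
  have J: "(1 + c - c * \<theta> ^ K) * ?e \<le> ?J"
    using V[of K] by (simp add: expect_add expect_cmult moment_x2 algebra_simps)
  have EH: "1 \<le> ?EH" using q g by simp
  have bound: "0 \<le> \<alpha> * ?EH powr (1 / p)"
    "?J powr (1 / p) \<le> bihari_G_inv (\<lambda>x. x) (bihari_G (\<lambda>x. x) (\<alpha> * ?EH powr (1 / p)) + ereal (\<beta> * 0))"
  proof -
    have "\<exists>n\<le>I + K. st h = x (drop (I + K - n) h)" if "length h = I + K" for h
    proof -
      obtain k where "k \<le> length h" "st h = x (drop k h)" using st_attained by blast
      then show ?thesis using that by (intro exI[of _ "I + K - k"]) simp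
    qed
    from coin_tree_bound[OF valid setting p(1) _ this] I
    show "0 \<le> \<alpha> * ?EH powr (1 / p)"
      "?J powr (1 / p) \<le> bihari_G_inv (\<lambda>x. x) (bihari_G (\<lambda>x. x) (\<alpha> * ?EH powr (1 / p)) + ereal (\<beta> * 0))"
      by (simp_all add: moment_H2)
  qed
  have "0 < ?EH powr (1 / p)" using EH by simp
  then show \<alpha>: "0 \<le> \<alpha>" using bound(1) by (simp add: zero_le_mult_iff)
  have J0: "0 \<le> ?J" using expect_mono[of "I + K" "\<lambda>_. 0" "\<lambda>h. st h powr p"] expect_const[of "I + K" 0] by simp
  have "?J powr (1 / p) \<le> \<alpha> * ?EH powr (1 / p)"
    using bound by (simp add: bihari_G_inv_G_id zero_ereal_def[symmetric])
  then have "(?J powr (1 / p)) powr p \<le> (\<alpha> * ?EH powr (1 / p)) powr p"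
    using p by (intro powr_mono2) auto
  then have "?J \<le> \<alpha> powr p * ?EH"
    using p J0 \<alpha> EH by (simp add: powr_powr powr_mult)
  with J show "(1 + c - c * (l powr (p - 1)) ^ K) * ?e \<le> \<alpha> powr p * ?EH"
    unfolding \<theta>_def by (rule order_trans)
qed

section \<open>Sharpness\<close>

text \<open>The parameters reach their limits one at a time. \<open>K\<close> to infinity removes
  the term of the living paths and \<open>I\<close> to infinity the initial value of
  \<open>H\<close>; as \<open>l\<close> and \<open>g\<close> decrease to 1, the two remaining
  quotients tend to \<open>1 / (1 - p)\<close> and \<open>1 / p\<close>.\<close>

lemma sharp_alpha_bound:
  assumes p: "0 < p" "p < 1" and valid: "bihari_estimate_valid TYPE(real) p \<alpha> \<beta>"
  shows "(1 - p) powr (- 1 / p) * p powr (- 1) \<le> \<alpha>"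
proof -
  have \<alpha>: "0 \<le> \<alpha>" by (rule alpha_tree_inequality(1)[OF p valid, of 2 2 1]) auto
  have gl: "(1 - 1 / l) / (1 - l powr (p - 1)) * ((1 - 1 / g) / (1 - g powr (- p))) powr p \<le> \<alpha> powr p"
    if g: "1 < g" and l: "1 < l" for g l
  proof -
    define q where "q = 1 - g powr (- p)"
    define \<theta> where "\<theta> = l powr (p - 1)"
    define c where "c = (\<theta> - 1 / l) / (1 - \<theta>)"
    define v where "v = (1 - 1 / g) / q"
    have q: "0 < q" using powr_less_mono[of "- p" 0 g] p g by (simp add: q_def)
    have \<theta>: "0 < \<theta>" "\<theta> < 1" using powr_less_mono[of "p - 1" 0 l] p l by (auto simp: \<theta>_def)
    have v: "0 < v" using q g by (simp add: v_def)
    have c1: "1 + c = (1 - 1 / l) / (1 - \<theta>)" using \<theta> by (simp add: c_def field_simps)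
    have le: "(1 + c - c * \<theta> ^ K) * (real I * q * (v * g) powr p) \<le> \<alpha> powr p * (1 + real I * q * g powr p)"
      if "0 < I" for I K
      using alpha_tree_inequality(2)[OF p valid g l that, of K] by (simp add: q_def \<theta>_def c_def v_def)
    have le2: "(1 + c) * (q * (v * g) powr p) \<le> \<alpha> powr p * (1 / real (Suc n) + q * g powr p)" for n
    proof -
      let ?I = "real (Suc n)"
      have "(\<lambda>K. (1 + c - c * \<theta> ^ K) * (?I * q * (v * g) powr p)) \<longlonglongrightarrow> (1 + c - c * 0) * (?I * q * (v * g) powr p)"
        using \<theta> by (intro tendsto_intros LIMSEQ_power_zero) auto
      then have "(1 + c - c * 0) * (?I * q * (v * g) powr p) \<le> \<alpha> powr p * (1 + ?I * q * g powr p)"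
        by (rule LIMSEQ_le_const2) (use le[of "Suc n"] in blast)
      then have "?I * ((1 + c) * (q * (v * g) powr p)) \<le> ?I * (\<alpha> powr p * (1 / ?I + q * g powr p))"
        by (simp add: distrib_left mult_ac del: of_nat_Suc)
      then show ?thesis by (rule mult_left_le_imp_le) simp
    qed
    have "(\<lambda>n. \<alpha> powr p * (1 / real (Suc n) + q * g powr p)) \<longlonglongrightarrow> \<alpha> powr p * (0 + q * g powr p)"
      by (intro tendsto_intros LIMSEQ_Suc[OF lim_const_over_n])
    then have "(1 + c) * (q * (v * g) powr p) \<le> \<alpha> powr p * (0 + q * g powr p)"
      by (rule LIMSEQ_le_const) (use le2 in blast)
    then have "(q * g powr p) * ((1 + c) * v powr p) \<le> (q * g powr p) * \<alpha> powr p"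
      using v g by (simp add: powr_mult mult_ac)
    then have "(1 + c) * v powr p \<le> \<alpha> powr p"
      by (rule mult_left_le_imp_le) (use q g in simp)
    then show ?thesis by (simp add: c1 \<theta>_def v_def q_def)
  qed
  have lim_l: "((\<lambda>l. (1 - 1 / l) / (1 - l powr (p - 1))) \<longlongrightarrow> 1 / (1 - p)) (at_right 1)"
    unfolding inverse_eq_divide[symmetric, of "1 - p"] using p by real_asymp
  have lim_g: "((\<lambda>g. (1 - 1 / g) / (1 - g powr (- p))) \<longlongrightarrow> 1 / p) (at_right 1)"
    unfolding inverse_eq_divide[symmetric, of p] using p by real_asymp
  have g_le: "1 / (1 - p) * ((1 - 1 / g) / (1 - g powr (- p))) powr p \<le> \<alpha> powr p" if "1 < g" for g
  proof (rule tendsto_upperbound)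
    show "((\<lambda>l. (1 - 1 / l) / (1 - l powr (p - 1)) * ((1 - 1 / g) / (1 - g powr (- p))) powr p) \<longlongrightarrow>
        1 / (1 - p) * ((1 - 1 / g) / (1 - g powr (- p))) powr p) (at_right 1)"
      by (intro tendsto_intros lim_l)
    show "\<forall>\<^sub>F l in at_right 1. (1 - 1 / l) / (1 - l powr (p - 1)) * ((1 - 1 / g) / (1 - g powr (- p))) powr p \<le> \<alpha> powr p"
      using eventually_at_right_less by eventually_elim (rule gl[OF that])
  qed simp
  have "1 / (1 - p) * (1 / p) powr p \<le> \<alpha> powr p"
  proof (rule tendsto_upperbound)
    show "((\<lambda>g. 1 / (1 - p) * ((1 - 1 / g) / (1 - g powr (- p))) powr p) \<longlongrightarrow> 1 / (1 - p) * (1 / p) powr p) (at_right 1)"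
      using p by (intro tendsto_mult tendsto_const tendsto_powr lim_g) auto
    show "\<forall>\<^sub>F g in at_right 1. 1 / (1 - p) * ((1 - 1 / g) / (1 - g powr (- p))) powr p \<le> \<alpha> powr p"
      using eventually_at_right_less by eventually_elim (rule g_le)
  qed simp
  then have "(1 / (1 - p) * (1 / p) powr p) powr (1 / p) \<le> (\<alpha> powr p) powr (1 / p)"
    using p by (intro powr_mono2) auto
  then show ?thesis
    using p \<alpha> by (simp add: powr_powr powr_mult powr_divide powr_minus_divide)
qed

text \<open>\<open>grow_max\<close> is the running maximum of \<open>grow_X\<close>. The probability of success is the one for which
  the drift of \<open>grow_X\<close> is \<open>d * grow_max\<close>.\<close>

fun grow_max :: "real \<Rightarrow> bool list \<Rightarrow> real" where
  "grow_max l [] = 1"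
| "grow_max l (b # h) = (if b then l * grow_max l h else grow_max l h)"

fun grow_X :: "real \<Rightarrow> bool list \<Rightarrow> real" where
  "grow_X l [] = 1"
| "grow_X l (b # h) = (if b then l * grow_max l h else 0)"

text \<open>Sum of the maxima at the strictly earlier nodes; multiplied by \<open>d\<close> it is
  the drift integral for \<open>A s = d * s\<close> at integer times.\<close>

fun grow_drift :: "real \<Rightarrow> bool list \<Rightarrow> real" where
  "grow_drift l [] = 0"
| "grow_drift l (b # h) = grow_drift l h + grow_max l h"

definition beta_pi :: "real \<Rightarrow> real \<Rightarrow> bool list \<Rightarrow> real" where
  "beta_pi d l h = (grow_X l h + d * grow_max l h) / (l * grow_max l h)"

lemma extend_eta_id_ge: "0 \<le> c \<Longrightarrow> ennreal c \<le> x \<Longrightarrow> ennreal c \<le> extend_eta (\<lambda>x. x) x"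
proof (cases x)
  case top
  assume "0 \<le> c"
  then show ?thesis using top by (auto simp: extend_eta_def intro: SUP_upper)
qed (simp add: extend_eta_def)

text \<open>On \<open>(j, j + 1]\<close> the left running supremum has seen all times up to
  \<open>j\<close>, among them one at which the process takes the value
  \<open>S (hist j \<omega>)\<close>.\<close>

lemma (in coin_tree) eta_integral_ge:
  assumes d: "0 \<le> d" and n: "n \<le> R" and \<omega>: "\<omega> \<in> \<Omega>"
    and S: "\<And>h. 0 \<le> S h" "\<And>h. \<exists>k\<le>length h. S h = x (drop k h)"
  shows "ennreal (d * (\<Sum>j<n. S (hist j \<omega>))) \<le> eta_integral (\<lambda>x. x) (\<lambda>s. d * s) (proc x) (real n) \<omega>"
proof -
  let ?\<nu> = "interval_measure (\<lambda>s. d * max 0 s)"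
  have slab: "emeasure ?\<nu> {real j<..real (Suc j)} = ennreal d" for j
  proof (subst emeasure_interval_measure_Ioc)
    show "continuous (at_right a) (\<lambda>s. d * max 0 s)" for a by (intro continuous_intros)
    show "d * max 0 s \<le> d * max 0 t" if "s \<le> t" for s t using that d by (intro mult_left_mono) auto
  qed (use d in \<open>simp_all add: algebra_simps\<close>)
  have "ennreal (d * (\<Sum>j<n. S (hist j \<omega>))) = (\<Sum>j<n. ennreal (S (hist j \<omega>)) * ennreal d)"
  proof -
    have "d * (\<Sum>j<n. S (hist j \<omega>)) = (\<Sum>j<n. S (hist j \<omega>) * d)"
      by (simp add: sum_distrib_left mult.commute)
    also have "ennreal \<dots> = (\<Sum>j<n. ennreal (S (hist j \<omega>) * d))"
      using S(1) d by (intro sum_ennreal[symmetric] mult_nonneg_nonneg)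
    also have "\<dots> = (\<Sum>j<n. ennreal (S (hist j \<omega>)) * ennreal d)"
      using S(1) d by (intro sum.cong ennreal_mult refl)
    finally show ?thesis .
  qed
  also have "\<dots> = (\<Sum>j<n. \<integral>\<^sup>+ s. ennreal (S (hist j \<omega>)) * indicator {real j<..real (Suc j)} s \<partial>?\<nu>)"
    by (simp add: nn_integral_cmult_indicator slab del: of_nat_Suc)
  also have "\<dots> = (\<integral>\<^sup>+ s. (\<Sum>j<n. ennreal (S (hist j \<omega>)) * indicator {real j<..real (Suc j)} s) \<partial>?\<nu>)"
    by (rule nn_integral_sum[symmetric]) simp
  also have "\<dots> \<le> eta_integral (\<lambda>x. x) (\<lambda>s. d * s) (proc x) (real n) \<omega>"
    unfolding eta_integral_def
  proof (rule nn_integral_mono)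
    fix s :: real
    show "(\<Sum>j<n. ennreal (S (hist j \<omega>)) * indicator {real j<..real (Suc j)} s) \<le>
        extend_eta (\<lambda>x. x) (running_sup_left (proc x) s \<omega>) * indicator {0<..real n} s"
    proof (cases "\<exists>j<n. s \<in> {real j<..real (Suc j)}")
      case True
      then obtain i where i: "i < n" "real i < s" "s \<le> real (Suc i)" by auto
      have "indicator {real j<..real (Suc j)} s = (if j = i then 1 else 0 :: ennreal)" for j
      proof -
        have "s \<in> {real j<..real (Suc j)} \<longleftrightarrow> j = i"
        proof
          assume "s \<in> {real j<..real (Suc j)}"
          then have "real j < real (Suc i)" "real i < real (Suc j)" using i by auto
          then show "j = i" by (simp only: of_nat_less_iff)
        qed (use i in auto)
        then show ?thesis by (simp add: indicator_def)
      qed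
      then have "(\<Sum>j<n. ennreal (S (hist j \<omega>)) * indicator {real j<..real (Suc j)} s) = ennreal (S (hist i \<omega>))"
        using i by (simp add: if_distrib[of "\<lambda>y. ennreal _ * y"] cong: if_cong)
      also have "\<dots> \<le> extend_eta (\<lambda>x. x) (running_sup_left (proc x) s \<omega>)"
      proof (rule extend_eta_id_ge[OF S(1)])
        have len: "length (hist i \<omega>) = i" using i n length_leaf[OF \<omega>] by (simp add: hist_def)
        obtain k where k: "k \<le> i" "S (hist i \<omega>) = x (drop k (hist i \<omega>))"
          using S(2)[of "hist i \<omega>"] len by auto
        have "drop k (hist i \<omega>) = hist (i - k) \<omega>"
          using k i n by (simp add: hist_def add.commute)
        then have "ennreal (S (hist i \<omega>)) = ennreal (proc x (real (i - k)) \<omega>)"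
          unfolding proc_def floor_of_nat nat_int using k by simp
        also have "\<dots> \<le> running_sup_left (proc x) s \<omega>"
          using i k unfolding running_sup_left_def by (auto intro!: SUP_upper)
        finally show "ennreal (S (hist i \<omega>)) \<le> running_sup_left (proc x) s \<omega>" .
      qed
      also have "\<dots> = extend_eta (\<lambda>x. x) (running_sup_left (proc x) s \<omega>) * indicator {0<..real n} s"
        using i by (simp add: indicator_def)
      finally show ?thesis .
    next
      case False
      then have "(\<Sum>j<n. ennreal (S (hist j \<omega>)) * indicator {real j<..real (Suc j)} s) = 0"
        by (intro sum.neutral) auto
      then show ?thesis by simp
    qed
  qed
  finally show ?thesis .
qed

text \<open>The potential \<open>V\<close> is \<open>\<gamma> * S powr p\<close> at a living node
  and \<open>S powr p\<close> at a dead one; the factor \<open>\<gamma>\<close> anticipates the gain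
  of the current excursion. The conditions \<open>dead\<close> and \<open>alive\<close> say that in
  either state a toss multiplies \<open>V\<close> in mean by at least
  \<open>1 + \<kappa> * d\<close>, whereas the estimate lets the moment of \<open>S\<close> grow
  only by \<open>exp (p * \<beta> * d)\<close> per toss.\<close>

lemma beta_tree_inequality:
  assumes p: "0 < p" "p < 1" and valid: "bihari_estimate_valid TYPE(real) p \<alpha> \<beta>" and \<alpha>: "0 < \<alpha>"
    and d: "0 < d" "1 + d < l" and R: "0 < R" and \<gamma>: "1 \<le> \<gamma>" and \<kappa>: "0 \<le> \<kappa>"
    and dead: "\<kappa> \<le> l powr (p - 1) * \<gamma> - 1 / l"
    and alive: "\<gamma> * (1 + \<kappa> * d) \<le> (1 + d) * (\<gamma> * l powr (p - 1)) + 1 - (1 + d) / l"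
  shows "(1 + \<kappa> * d) ^ R \<le> \<gamma> * (\<alpha> powr p * exp (p * \<beta> * d) ^ R)"
proof -
  have l: "1 < l" using d by simp
  define S where "S = grow_max l"
  define x where "x = grow_X l"
  define U where "U = grow_drift l"
  have S_pos: "0 < S h" for h unfolding S_def using l by (induction h) auto
  have x_cases: "x h = S h \<or> x h = 0" for h unfolding S_def x_def by (cases h) auto
  have x_nonneg: "0 \<le> x h" for h using x_cases[of h] S_pos[of h] by auto
  have toss: "S (b # h) = (if b then l * S h else S h)" "x (b # h) = (if b then l * S h else 0)"
      "U (b # h) = U h + S h" for b h
    by (simp_all add: S_def x_def U_def)
  have root: "S [] = 1" "x [] = 1" "U [] = 0" by (simp_all add: S_def x_def U_def)
  define \<pi> where "\<pi> = beta_pi d l"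
  have \<pi>: "\<pi> h = (x h + d * S h) / (l * S h)" for h by (simp add: \<pi>_def beta_pi_def x_def S_def)
  have \<pi>S: "\<pi> h * (l * S h) = x h + d * S h" for h using S_pos[of h] l by (simp add: \<pi>)
  have \<pi>_alive: "\<pi> h = (1 + d) / l" if "x h = S h" for h
    using S_pos[of h] l that by (simp add: \<pi> field_simps)
  have \<pi>_dead: "\<pi> h = d / l" if "x h = 0" for h using S_pos[of h] that by (simp add: \<pi>)
  interpret coin_tree \<pi> R
  proof
    show "0 < \<pi> h" for h using x_cases[of h] \<pi>_alive[of h] \<pi>_dead[of h] d l by (auto intro!: divide_pos_pos)
    show "\<pi> h < 1" for h using x_cases[of h] \<pi>_alive[of h] \<pi>_dead[of h] d l by auto
  qed
  \<comment> \<open>The success probability makes \<open>d * U\<close> the compensator of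
    \<open>x\<close>, so that \<open>x = d * U + N + 1\<close> with \<open>H = 1\<close>.\<close>
  define N where "N h = x h - 1 - d * U h" for h
  have S_attained: "\<exists>k\<le>length h. S h = x (drop k h)" for h
  proof (induction h)
    case (Cons b h)
    then obtain k where "k \<le> length h" "S h = x (drop k h)" by blast
    then show ?case
      by (cases b) (auto simp: toss intro: exI[of _ 0] exI[of _ "Suc k"])
  qed (simp add: root)
  have U_hist: "U (hist n \<omega>) = (\<Sum>j<n. S (hist j \<omega>))" if n: "n \<le> R" and \<omega>: "\<omega> \<in> \<Omega>" for n \<omega>
    using n
  proof (induction n)
    case (Suc n)
    obtain b where "hist (Suc n) \<omega> = b # hist n \<omega>" using hist_Suc[OF \<omega>, of n] Suc.prems by auto
    then show ?case using Suc by (simp add: toss)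
  qed (simp add: hist_0[OF \<omega>] root)
  have setting: "bihari_lasalle_setting P Ft p (proc x) (\<lambda>s. d * s) (proc (\<lambda>_. 1)) (proc N) (\<lambda>x. x)"
  proof (rule coin_tree_setting[OF p x_nonneg])
    show "N [] = 0" by (simp add: N_def root)
    show "\<pi> h * N (True # h) + (1 - \<pi> h) * N (False # h) = N h" for h
    proof -
      have "\<pi> h * N (True # h) + (1 - \<pi> h) * N (False # h) = \<pi> h * (l * S h) - 1 - d * (U h + S h)"
        by (simp add: N_def toss algebra_simps)
      also have "\<dots> = N h" unfolding \<pi>S by (simp add: N_def algebra_simps)
      finally show ?thesis .
    qed
    show "mono_on {0..} ((*) d)" using d by (intro mono_onI mult_left_mono) auto
    show "cadlag_path ((*) d)"
      unfolding cadlag_path_def right_continuous_path_def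
    proof (intro conjI allI impI)
      show "continuous (at_right t) ((*) d)" for t by (intro continuous_intros)
      show "\<exists>k. ((*) d \<longlongrightarrow> k) (at_left t)" for t by (rule exI[of _ "d * t"]) (intro tendsto_intros)
    qed
    fix t :: real and \<omega> assume t: "0 \<le> t" and \<omega>: "\<omega> \<in> \<Omega>"
    \<comment> \<open>After depth \<open>R\<close> the path is frozen while the integral does not
      decrease, so the inequality at depth \<open>n\<close> persists.\<close>
    define n where "n = min R (nat \<lfloor>t\<rfloor>)"
    have hist: "hist (nat \<lfloor>t\<rfloor>) \<omega> = hist n \<omega>" by (simp add: n_def hist_def min_def)
    have nt: "real n \<le> t" using t by (simp add: n_def) linarith
    have "ennreal (d * U (hist n \<omega>)) \<le> eta_integral (\<lambda>x. x) (\<lambda>s. d * s) (proc x) (real n) \<omega>"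
      using eta_integral_ge[OF _ _ \<omega> _ S_attained, of d n] d S_pos U_hist[OF _ \<omega>, of n]
      by (simp add: n_def less_imp_le)
    also have "\<dots> \<le> eta_integral (\<lambda>x. x) (\<lambda>s. d * s) (proc x) t \<omega>"
      unfolding eta_integral_def using nt by (intro nn_integral_mono) (auto simp: indicator_def)
    finally have "enn2ereal (ennreal (d * U (hist n \<omega>))) \<le> enn2ereal (eta_integral (\<lambda>x. x) (\<lambda>s. d * s) (proc x) t \<omega>)"
      by (simp add: less_eq_ennreal.rep_eq)
    moreover have "0 \<le> d * U (hist n \<omega>)"
    proof -
      have "0 \<le> U h" for h by (induction h) (use S_pos in \<open>auto simp: root toss intro: add_nonneg_nonneg less_imp_le\<close>)
      then show ?thesis using d by simp
    qed
    ultimately have I: "ereal (d * U (hist n \<omega>)) \<le> enn2ereal (eta_integral (\<lambda>x. x) (\<lambda>s. d * s) (proc x) t \<omega>)"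
      by (simp add: enn2ereal_ennreal)
    have "ereal (proc x t \<omega>) = ereal (d * U (hist n \<omega>)) + ereal (proc N t \<omega>) + ereal (proc (\<lambda>_. 1) t \<omega>)"
      by (simp add: proc_def hist N_def)
    also have "\<dots> \<le> enn2ereal (eta_integral (\<lambda>x. x) (\<lambda>s. d * s) (proc x) t \<omega>) + ereal (proc N t \<omega>) + ereal (proc (\<lambda>_. 1) t \<omega>)"
      by (intro add_right_mono I)
    finally show "ereal (proc x t \<omega>) \<le> enn2ereal (eta_integral (\<lambda>x. x) (\<lambda>s. d * s) (proc x) t \<omega>) +
        ereal (proc N t \<omega>) + ereal (proc (\<lambda>_. 1) t \<omega>)" .
  qed auto
  define V where "V h = S h powr p + (\<gamma> - 1) * x h powr p" for h
  have V_step: "(1 + \<kappa> * d) * V h \<le> \<pi> h * V (True # h) + (1 - \<pi> h) * V (False # h)" for h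
  proof -
    let ?s = "S h powr p" and ?L = "l powr p"
    have s: "0 < ?s" using S_pos[of h] by simp
    have lp: "?L / l = l powr (p - 1)" using l by (simp add: powr_diff)
    have "V (True # h) = \<gamma> * (?L * ?s)" "V (False # h) = ?s"
      using l S_pos[of h] p by (simp_all add: V_def toss powr_mult algebra_simps)
    then have eq: "\<pi> h * V (True # h) + (1 - \<pi> h) * V (False # h) = (\<pi> h * l * (\<gamma> * (?L / l)) + 1 - \<pi> h) * ?s"
      using l by (simp add: algebra_simps)
    have "(1 + \<kappa> * d) * (V h / ?s) \<le> \<pi> h * l * (\<gamma> * (?L / l)) + 1 - \<pi> h"
    proof (cases "x h = 0")
      case True
      have "1 + \<kappa> * d \<le> 1 + (l powr (p - 1) * \<gamma> - 1 / l) * d"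
        using dead d by (intro add_left_mono mult_right_mono) auto
      then show ?thesis using True s l p unfolding lp by (simp add: V_def \<pi>_dead algebra_simps)
    next
      case False
      then have "x h = S h" using x_cases[of h] by auto
      then have "V h / ?s = \<gamma>" "\<pi> h = (1 + d) / l" using s by (simp_all add: V_def \<pi>_alive algebra_simps)
      then show ?thesis using alive l unfolding lp by (simp add: mult.commute)
    qed
    then have "(1 + \<kappa> * d) * (V h / ?s) * ?s \<le> (\<pi> h * l * (\<gamma> * (?L / l)) + 1 - \<pi> h) * ?s"
      using s by (intro mult_right_mono) auto
    then show ?thesis unfolding eq using s by simp
  qed
  have growth: "(1 + \<kappa> * d) ^ n \<le> expect n V" for n
  proof (induction n)
    case 0
    show ?case using \<gamma> by (simp add: expect_0 V_def root)
  next
    case (Suc n)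
    have "(1 + \<kappa> * d) ^ Suc n \<le> (1 + \<kappa> * d) * expect n V"
      using Suc \<kappa> d by (simp add: mult_left_mono)
    also have "\<dots> = expect n (\<lambda>h. (1 + \<kappa> * d) * V h)" by (simp add: expect_cmult)
    also have "\<dots> \<le> expect (Suc n) V" unfolding expect_Suc by (intro expect_mono V_step)
    finally show ?case .
  qed
  let ?J = "expect R (\<lambda>h. S h powr p)"
  have "expect R V \<le> expect R (\<lambda>h. \<gamma> * S h powr p)"
  proof (rule expect_mono)
    fix h
    have "x h powr p \<le> S h powr p" using x_cases[of h] S_pos[of h] by auto
    then have "(\<gamma> - 1) * x h powr p \<le> (\<gamma> - 1) * S h powr p" using \<gamma> by (intro mult_left_mono) auto
    then show "V h \<le> \<gamma> * S h powr p" by (simp add: V_def algebra_simps)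
  qed
  then have VJ: "expect R V \<le> \<gamma> * ?J" by (simp add: expect_cmult)
  have J0: "0 \<le> ?J" using expect_mono[of R "\<lambda>_. 0" "\<lambda>h. S h powr p"] expect_const[of R 0] by simp
  have "\<exists>n\<le>R. S h = x (drop (R - n) h)" if "length h = R" for h
  proof -
    obtain k where "k \<le> length h" "S h = x (drop k h)" using S_attained by blast
    then show ?thesis using that by (intro exI[of _ "R - k"]) simp
  qed
  from coin_tree_bound(2)[OF valid setting p(1) R this]
  have "?J powr (1 / p) \<le> \<alpha> * exp (\<beta> * (d * real R))"
    using \<alpha> by (simp add: expect_const bihari_G_inv_id_exp)
  then have "(?J powr (1 / p)) powr p \<le> (\<alpha> * exp (\<beta> * (d * real R))) powr p"
    using p by (intro powr_mono2) auto
  also have "(?J powr (1 / p)) powr p = ?J" using J0 p by (simp add: powr_powr)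
  also have "(\<alpha> * exp (\<beta> * (d * real R))) powr p = \<alpha> powr p * exp (p * \<beta> * d) ^ R"
    using \<alpha> by (simp add: powr_mult exp_powr_real exp_of_nat_mult[symmetric] mult_ac)
  finally have "\<gamma> * ?J \<le> \<gamma> * (\<alpha> powr p * exp (p * \<beta> * d) ^ R)"
    using \<gamma> by (intro mult_left_mono) auto
  with growth[of R] VJ show ?thesis by linarith
qed

text \<open>As \<open>l\<close> decreases to 1, \<open>\<gamma>\<close> may approach
  \<open>1 / (1 - p)\<close>, the moment of the maximum of an excursion from height 1, and
  \<open>\<kappa>\<close> may approach \<open>\<gamma> - 1\<close>, that is
  \<open>p / (1 - p)\<close>. If \<open>p * \<beta>\<close> is smaller, the moments outgrow the
  estimate as the depth of the tree increases.\<close>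

lemma sharp_beta_bound:
  assumes p: "0 < p" "p < 1" and valid: "bihari_estimate_valid TYPE(real) p \<alpha> \<beta>" and \<alpha>: "0 < \<alpha>"
  shows "1 / (1 - p) \<le> \<beta>"
proof (rule ccontr)
  assume "\<not> 1 / (1 - p) \<le> \<beta>"
  then have "p * \<beta> < p * (1 / (1 - p))" using p by (intro mult_strict_left_mono) auto
  moreover have "0 < p / (1 - p)" using p by simp
  \<comment> \<open>\<open>\<beta>\<close> may be negative, while the growth rate
    \<open>\<kappa>\<close> has to be nonnegative.\<close>
  ultimately have "max (p * \<beta>) 0 < p / (1 - p)" by simp
  then obtain \<kappa> where \<kappa>: "max (p * \<beta>) 0 < \<kappa>" "\<kappa> < p / (1 - p)" using dense by blast
  have "\<kappa> + 1 < 1 / (1 - p)" using \<kappa>(2) p by (simp add: field_simps)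
  then obtain \<gamma> where \<gamma>: "\<kappa> + 1 < \<gamma>" "\<gamma> < 1 / (1 - p)" using dense by blast
  have "((\<lambda>l. l powr (p - 1) * \<gamma> - 1 / l) \<longlongrightarrow> 1 powr (p - 1) * \<gamma> - 1 / 1) (at_right 1)"
    by (intro tendsto_intros) auto
  then have e1: "\<forall>\<^sub>F l in at_right 1. \<kappa> < l powr (p - 1) * \<gamma> - 1 / l"
    by (rule order_tendstoD) (use \<gamma> in simp)
  \<comment> \<open>For \<open>d = 0\<close> the condition \<open>alive\<close> reads
    \<open>\<gamma> * (1 - l powr (p - 1)) \<le> 1 - 1 / l\<close>. Arranged here as a strict
    inequality, it survives for small \<open>d\<close>.\<close>
  have "((\<lambda>l. (1 - 1 / l) / (1 - l powr (p - 1))) \<longlongrightarrow> 1 / (1 - p)) (at_right 1)"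
    unfolding inverse_eq_divide[symmetric, of "1 - p"] using p by real_asymp
  then have e2: "\<forall>\<^sub>F l in at_right 1. \<gamma> < (1 - 1 / l) / (1 - l powr (p - 1))"
    by (rule order_tendstoD) (rule \<gamma>)
  have "\<forall>\<^sub>F l in at_right 1. 1 < l \<and> \<kappa> < l powr (p - 1) * \<gamma> - 1 / l \<and> \<gamma> < (1 - 1 / l) / (1 - l powr (p - 1))"
    using eventually_at_right_less e1 e2 by eventually_elim auto
  then obtain l where l: "1 < l" "\<kappa> < l powr (p - 1) * \<gamma> - 1 / l" "\<gamma> < (1 - 1 / l) / (1 - l powr (p - 1))"
    using eventually_happens[of _ "at_right (1::real)"] by auto
  have "l powr (p - 1) < 1" using powr_less_mono[of "p - 1" 0 l] p l by simp
  then have l3: "\<gamma> * (1 - l powr (p - 1)) < 1 - 1 / l" using l(3) by (simp add: pos_less_divide_eq)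
  have "((\<lambda>d. \<gamma> * (1 + \<kappa> * d) - ((1 + d) * (\<gamma> * l powr (p - 1)) + 1 - (1 + d) / l)) \<longlongrightarrow>
      \<gamma> * (1 + \<kappa> * 0) - ((1 + 0) * (\<gamma> * l powr (p - 1)) + 1 - (1 + 0) / l)) (at_right 0)"
    using l by (intro tendsto_intros) auto
  then have d1: "\<forall>\<^sub>F d in at_right 0. \<gamma> * (1 + \<kappa> * d) - ((1 + d) * (\<gamma> * l powr (p - 1)) + 1 - (1 + d) / l) < 0"
    by (rule order_tendstoD) (use l3 in \<open>simp add: algebra_simps\<close>)
  have "((\<lambda>d. (exp (p * \<beta> * d) - 1) / d) \<longlongrightarrow> p * \<beta>) (at_right 0)"
  proof -
    have "((\<lambda>d. exp (p * \<beta> * d)) has_real_derivative p * \<beta>) (at 0)"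
      by (auto intro!: derivative_eq_intros)
    then have "((\<lambda>d. (exp (p * \<beta> * d) - 1) / d) \<longlongrightarrow> p * \<beta>) (at 0)"
      by (simp add: DERIV_def)
    then show ?thesis by (rule tendsto_within_subset) simp
  qed
  then have d2: "\<forall>\<^sub>F d in at_right 0. (exp (p * \<beta> * d) - 1) / d < \<kappa>"
    by (rule order_tendstoD) (use \<kappa> in simp)
  have d3: "\<forall>\<^sub>F d in at_right 0. d < l - 1"
    using l by (intro order_tendstoD[OF tendsto_ident_at]) auto
  have "\<forall>\<^sub>F d in at_right 0. 0 < d \<and> d < l - 1 \<and> (exp (p * \<beta> * d) - 1) / d < \<kappa> \<and>
      \<gamma> * (1 + \<kappa> * d) - ((1 + d) * (\<gamma> * l powr (p - 1)) + 1 - (1 + d) / l) < 0"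
    using eventually_at_right_less d1 d2 d3 by eventually_elim auto
  then obtain d where d: "0 < d" "d < l - 1" "(exp (p * \<beta> * d) - 1) / d < \<kappa>"
      "\<gamma> * (1 + \<kappa> * d) - ((1 + d) * (\<gamma> * l powr (p - 1)) + 1 - (1 + d) / l) < 0"
    using eventually_happens[of _ "at_right (0::real)"] by auto
  \<comment> \<open>The quotient of the two growth factors per toss; its powers exceed every
    bound.\<close>
  define r where "r = (1 + \<kappa> * d) / exp (p * \<beta> * d)"
  have "exp (p * \<beta> * d) < 1 + \<kappa> * d" using d(1,3) by (simp add: divide_less_eq)
  then have r: "1 < r" by (simp add: r_def)
  obtain n where n: "\<gamma> * \<alpha> powr p < r ^ n" using real_arch_pow[OF r] by blast
  have "(1 + \<kappa> * d) ^ Suc n \<le> \<gamma> * (\<alpha> powr p * exp (p * \<beta> * d) ^ Suc n)"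
    by (rule beta_tree_inequality[OF p valid \<alpha>, where l = l]) (use d l \<gamma> \<kappa> in auto)
  then have "r ^ Suc n \<le> \<gamma> * \<alpha> powr p"
    unfolding r_def power_divide by (simp add: pos_divide_le_eq mult.assoc del: power_Suc)
  moreover have "r ^ n \<le> r ^ Suc n" using r by (intro power_increasing) auto
  ultimately show False using n by simp
qed

theorem theorem1p2:
  fixes p \<alpha> \<beta> :: real
  assumes "0 < p" and "p < 1"
    and "\<alpha> = (1 - p) powr (- 1 / p) * p powr (- 1)"
    and "\<beta> = (1 - p) powr (- 1)"
  shows "(\<forall>(M :: 'a measure) F X A H N \<eta> T.
            bihari_lasalle_setting M F p X A H N \<eta> \<longrightarrow> 0 < T \<longrightarrow>
            (\<integral>\<^sup>+ \<omega>. ennreal (H T \<omega> powr p) \<partial>M) < \<infinity> \<longrightarrow>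
            bihari_estimate p \<alpha> \<beta> M X A H \<eta> T)
         \<and> sharp_beta p \<alpha> \<beta> \<and> sharp_alpha p \<alpha> \<beta>"
proof (intro conjI allI impI)
  fix M :: "'a measure" and F X A H N \<eta> T
  assume setting: "bihari_lasalle_setting M F p X A H N \<eta>" and "0 < T"
    and "(\<integral>\<^sup>+ \<omega>. ennreal (H T \<omega> powr p) \<partial>M) < \<infinity>"
  interpret bihari_power_setting M F p X A H N \<eta>
    by (intro bihari_power_setting.intro bihari_power_setting_axioms.intro setting assms(1,2))
  show "bihari_estimate p \<alpha> \<beta> M X A H \<eta> T"
    unfolding assms(3,4) by (rule bihari_upper_bound) fact+
next
  have "0 < \<alpha>" using assms by simp
  moreover have "\<beta> = 1 / (1 - p)" using assms by (simp add: powr_minus_divide)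
  ultimately show "sharp_beta p \<alpha> \<beta>"
    unfolding sharp_beta_def using sharp_beta_bound[OF assms(1,2)] by force
  show "sharp_alpha p \<alpha> \<beta>"
    unfolding sharp_alpha_def using sharp_alpha_bound[OF assms(1,2)] assms(3) by force
qed

end
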